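(* Let $(X,\mathcal{I},E,\mu)$ be a marked ideal of maximal order. Assume there exist tangent directions $u,v\in T(\mathcal{I},\mu)_x=\mathcal{D}^{\mu-1}(\mathcal{I},\mu)_x$ at $x\in\mathrm{supp}(\mathcal{I},\mu)$ which are transversal to $E$. Then there exists an automorphism $\widehat{\phi}_{uv}$ of $\widehat{X}_x:=\mathrm{Spec}(\widehat{\mathcal{O}}_{x,X})$ such that 1. $\widehat{\phi}_{uv}^*(\mathcal{H}\widehat{\mathcal{I}})_x=(\mathcal{H}\widehat{\mathcal{I}})_x$; 2. $\widehat{\phi}_{uv}^*(E)=E$; 3. $\widehat{\phi}_{uv}^*(u)=v$; 4. $\mathrm{supp}(\widehat{\mathcal{I}},\mu):=V(T(\widehat{\mathcal{I}},\mu))$ is contained in the fixed point set of $\widehat{\phi}_{uv}$.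
   Context: The ground field $K$ is algebraically closed of characteristic zero. A marked ideal $(X,\mathcal{I},E,\mu)$ (abbreviated $(\mathcal{I},\mu)$) consists of a smooth variety $X$, a coherent sheaf of ideals $\mathcal{I}$ on $X$, a nonnegative integer $\mu$, and a totally ordered collection $E$ of divisors, each having pairwise disjoint irreducible components of multiplicity one, such that the irreducible components of all divisors in $E$ have simultaneously simple normal crossings. Set $\mathrm{ord}_x(\mathcal{I})=\max\{i\mid\mathcal{I}\subset m_x^i\}$ and $\mathrm{supp}(\mathcal{I},\mu)=\{x\in X\mid\mathrm{ord}_x(\mathcal{I})\ge\mu\}$. $\mathcal{D}(\mathcal{I})$ is the coherent ideal sheaf generated by all $f\in\mathcal{I}$ and their first derivatives, $\mathcal{D}^i(\mathcal{I})=\mathcal{D}(\mathcal{D}^{i-1}(\mathcal{I}))$, and $\mathcal{D}^i(\mathcal{I},\mu)=(\mathcal{D}^i(\mathcal{I}),\mu-i)$ for $i\le\mu$. $(\mathcal{I},\mu)$ is of maximal order if $\max_x\mathrm{ord}_x(\mathcal{I})\le\mu$, equivalently $\mathcal{D}^\mu(\mathcal{I})=\mathcal{O}_X$. Put $T(\mathcal{I})=T(\mathcal{I},\mu)=\mathcal{D}^{\mu-1}(\mathcal{I})$. A tangent direction at $x$ is a function $u\in T(\mathcal{I})$ near $x$ of multiplicity one ($\mathrm{ord}_z(u)=1$ at every point $z$ of its zero set $V(u)$). It is transversal to $E$ at $x$ if $u$ together with local equations of the components of divisors of $E$ through $x$ forms part of a system of local parameters at $x$. The homogenized ideal is $\mathcal{H}(\mathcal{I})=\mathcal{I}+\mathcal{D}\mathcal{I}\cdot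 T(\mathcal{I})+\cdots+\mathcal{D}^i\mathcal{I}\cdot T(\mathcal{I})^i+\cdots+\mathcal{D}^{\mu-1}\mathcal{I}\cdot T(\mathcal{I})^{\mu-1}$. Hats denote the ideals generated in the completed local ring $\widehat{\mathcal{O}}_{x,X}$: $\widehat{\mathcal{I}}=\mathcal{I}\cdot\widehat{\mathcal{O}}_{x,X}$, $\mathcal{H}\widehat{\mathcal{I}}=\mathcal{H}(\mathcal{I})\cdot\widehat{\mathcal{O}}_{x,X}$, $T(\widehat{\mathcal{I}},\mu)=T(\mathcal{I})\cdot\widehat{\mathcal{O}}_{x,X}$; $V(\cdot)$ denotes the zero set. *)

theory Defs
  imports
    "HOL-Analysis.Abstract_Topology"
    "HOL-Library.Extended_Nat"
    "HOL-Computational_Algebra.Polynomial"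
    "HOL-Algebra.QuotRing"
    "HOL-Algebra.Ideal_Product"
begin

section \<open>Varieties as spaces with functions\<close>

text \<open>
  Varieties over an algebraically closed field are treated classically: a topological space
  (of closed points) with a sheaf of \<open>'k\<close>-valued functions. Functions are total in HOL;
  \<open>f \<in> reg X U\<close> means that the restriction of \<open>f\<close> to \<open>U\<close> is regular, and the sheaf axiom makes
  this independent of the values of \<open>f\<close> outside \<open>U\<close>. Restriction maps are thus inclusions.
\<close>

record ('p, 'k) fun_space =
  topol :: "'p topology"
  reg :: "'p set \<Rightarrow> ('p \<Rightarrow> 'k) set"

definition sheaf_of_functions :: "('p, 'k::field) fun_space \<Rightarrow> bool" where
  "sheaf_of_functions X \<longleftrightarrow> (\<forall>U. openin (topol X) U \<longrightarrow>
     (\<forall>c. (\<lambda>_. c) \<in> reg X U) \<and>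
     (\<forall>f\<in>reg X U. \<forall>g\<in>reg X U. (\<lambda>z. f z + g z) \<in> reg X U \<and> (\<lambda>z. f z * g z) \<in> reg X U) \<and>
     (\<forall>f\<in>reg X U. \<forall>V. openin (topol X) V \<and> V \<subseteq> U \<longrightarrow> f \<in> reg X V) \<and>
     (\<forall>f. (\<forall>x\<in>U. \<exists>V g. openin (topol X) V \<and> x \<in> V \<and> V \<subseteq> U \<and> g \<in> reg X V \<and> (\<forall>z\<in>V. f z = g z))
            \<longrightarrow> f \<in> reg X U))"

definition open_subspace :: "('p, 'k) fun_space \<Rightarrow> 'p set \<Rightarrow> ('p, 'k) fun_space" where
  "open_subspace X U = \<lparr>topol = subtopology (topol X) U, reg = reg X\<rparr>"

definition space_iso :: "('p, 'k) fun_space \<Rightarrow> ('q, 'k) fun_space \<Rightarrow> ('p \<Rightarrow> 'q) \<Rightarrow> bool" where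
  "space_iso X Y h \<longleftrightarrow> homeomorphic_map (topol X) (topol Y) h \<and>
     (\<forall>V g. openin (topol Y) V \<longrightarrow>
        (g \<in> reg Y V \<longleftrightarrow> (\<lambda>z. g (h z)) \<in> reg X {z \<in> topspace (topol X). h z \<in> V}))"

subsection \<open>Affine algebraic sets\<close>

text \<open>Affine \<open>m\<close>-space consists of the extensional functions on \<open>{..<m}\<close>. As the ground field is
  infinite, polynomials in \<open>m\<close> variables are identified with polynomial functions.\<close>

definition affine_space :: "nat \<Rightarrow> (nat \<Rightarrow> 'k) set" where
  "affine_space m = (\<Pi>\<^sub>E i\<in>{..<m}. UNIV)"

inductive_set polys :: "nat \<Rightarrow> ((nat \<Rightarrow> 'k::field) \<Rightarrow> 'k) set" for m :: nat where
  const: "(\<lambda>_. c) \<in> polys m"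
| coord: "i < m \<Longrightarrow> (\<lambda>a. a i) \<in> polys m"
| add: "p \<in> polys m \<Longrightarrow> q \<in> polys m \<Longrightarrow> (\<lambda>a. p a + q a) \<in> polys m"
| mult: "p \<in> polys m \<Longrightarrow> q \<in> polys m \<Longrightarrow> (\<lambda>a. p a * q a) \<in> polys m"

text \<open>The partial derivative at \<open>a\<close> in direction \<open>i\<close>: the derivative of the univariate polynomial
  obtained by letting only the \<open>i\<close>-th coordinate vary.\<close>

definition partial :: "nat \<Rightarrow> ((nat \<Rightarrow> 'k::field) \<Rightarrow> 'k) \<Rightarrow> (nat \<Rightarrow> 'k) \<Rightarrow> 'k" where
  "partial i p a = poly (pderiv (THE q. \<forall>t. poly q t = p (a(i := t)))) (a i)"

definition zariski :: "nat \<Rightarrow> (nat \<Rightarrow> 'k::field) topology" where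
  "zariski m = topology_generated_by {{a \<in> affine_space m. p a \<noteq> 0} | p. p \<in> polys m}"

definition affine_set :: "nat \<Rightarrow> (nat \<Rightarrow> 'k::field) set \<Rightarrow> (nat \<Rightarrow> 'k, 'k) fun_space" where
  "affine_set m Z =
     \<lparr>topol = subtopology (zariski m) Z,
      reg = (\<lambda>W. {f. \<forall>w\<in>W. \<exists>V p q. openin (subtopology (zariski m) Z) V \<and> w \<in> V \<and> V \<subseteq> W \<and>
                     p \<in> polys m \<and> q \<in> polys m \<and> (\<forall>a\<in>V. q a \<noteq> 0 \<and> f a = p a / q a)})\<rparr>"

definition affine_chart ::
  "('p, 'k::field) fun_space \<Rightarrow> 'p set \<Rightarrow> nat \<Rightarrow> (nat \<Rightarrow> 'k) set \<Rightarrow> ('p \<Rightarrow> nat \<Rightarrow> 'k) \<Rightarrow> bool" where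
  "affine_chart X U m Z h \<longleftrightarrow> openin (topol X) U \<and> closedin (zariski m) Z \<and>
     space_iso (open_subspace X U) (affine_set m Z) h"

subsection \<open>Smooth varieties\<close>

definition irreducible_in :: "'p topology \<Rightarrow> 'p set \<Rightarrow> bool" where
  "irreducible_in T S \<longleftrightarrow> S \<noteq> {} \<and> S \<subseteq> topspace T \<and>
     (\<forall>A B. closedin T A \<and> closedin T B \<and> S \<subseteq> A \<union> B \<longrightarrow> S \<subseteq> A \<or> S \<subseteq> B)"

text \<open>The diagonal is closed in the product variety, whose topology has as a basis the sets
  \<open>{(x, y) \<in> U \<times> V. (\<Sum>i. f\<^sub>i x * g\<^sub>i y) \<noteq> 0}\<close> with \<open>f\<^sub>i\<close> regular on \<open>U\<close> and \<open>g\<^sub>i\<close> regular on \<open>V\<close>.\<close>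

definition separated :: "('p, 'k::field) fun_space \<Rightarrow> bool" where
  "separated X \<longleftrightarrow> (\<forall>x\<in>topspace (topol X). \<forall>y\<in>topspace (topol X). x \<noteq> y \<longrightarrow>
     (\<exists>U V (n::nat) f g. openin (topol X) U \<and> openin (topol X) V \<and> x \<in> U \<and> y \<in> V \<and>
        (\<forall>i<n. f i \<in> reg X U \<and> g i \<in> reg X V) \<and>
        (\<Sum>i<n. f i x * g i y) \<noteq> 0 \<and> (\<forall>z\<in>U \<inter> V. (\<Sum>i<n. f i z * g i z) = 0)))"

definition variety :: "('p, 'k::field) fun_space \<Rightarrow> bool" where
  "variety X \<longleftrightarrow> sheaf_of_functions X \<and> irreducible_in (topol X) (topspace (topol X)) \<and>
     separated X \<and>
     (\<exists>\<U>. finite \<U> \<and> topspace (topol X) = \<Union>\<U> \<and> (\<forall>U\<in>\<U>. \<exists>m Z h. affine_chart X U m Z h))"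

text \<open>Smoothness at a point: it has an affine neighbourhood with coordinate ring
  \<open>'k[x\<^sub>1, \<dots>, x\<^sub>m] / (f\<^sub>1, \<dots>, f\<^sub>r)\<close> such that the Jacobian matrix of the \<open>f\<^sub>j\<close> has rank \<open>r\<close> at the
  point, i.e. linearly independent rows.\<close>

definition smooth_at :: "('p, 'k::field) fun_space \<Rightarrow> 'p \<Rightarrow> bool" where
  "smooth_at X x \<longleftrightarrow> (\<exists>U m Z h (r::nat) f. x \<in> U \<and> affine_chart X U m Z h \<and>
     (\<forall>j<r. f j \<in> polys m) \<and>
     {p \<in> polys m. \<forall>a\<in>Z. p a = 0} =
       {\<lambda>a. \<Sum>j<r. q j a * f j a | q. \<forall>j<r. q j \<in> polys m} \<and>
     (\<forall>c. (\<forall>i<m. (\<Sum>j<r. c j * partial i (f j) (h x)) = 0) \<longrightarrow> (\<forall>j<r. c j = 0)))"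

definition smooth_variety :: "('p, 'k::field) fun_space \<Rightarrow> bool" where
  "smooth_variety X \<longleftrightarrow> variety X \<and> (\<forall>x\<in>topspace (topol X). smooth_at X x)"

section \<open>Local rings\<close>

definition functions_near :: "('p, 'k::field) fun_space \<Rightarrow> 'p \<Rightarrow> ('p \<Rightarrow> 'k) ring" where
  "functions_near X x =
     \<lparr>carrier = {f. \<exists>U. openin (topol X) U \<and> x \<in> U \<and> f \<in> reg X U},
      mult = (\<lambda>f g z. f z * g z), one = (\<lambda>_. 1),
      zero = (\<lambda>_. 0), add = (\<lambda>f g z. f z + g z)\<rparr>"

definition zero_near :: "('p, 'k::field) fun_space \<Rightarrow> 'p \<Rightarrow> ('p \<Rightarrow> 'k) set" where
  "zero_near X x = {f. \<exists>U. openin (topol X) U \<and> x \<in> U \<and> (\<forall>z\<in>U. f z = 0)}"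

text \<open>Germs are cosets of the ideal of functions vanishing near the point.\<close>

definition local_ring :: "('p, 'k::field) fun_space \<Rightarrow> 'p \<Rightarrow> ('p \<Rightarrow> 'k) set ring" where
  "local_ring X x = functions_near X x Quot zero_near X x"

definition germ :: "('p, 'k::field) fun_space \<Rightarrow> 'p \<Rightarrow> ('p \<Rightarrow> 'k) \<Rightarrow> ('p \<Rightarrow> 'k) set" where
  "germ X x f = zero_near X x +>\<^bsub>functions_near X x\<^esub> f"

abbreviation const_germ :: "('p, 'k::field) fun_space \<Rightarrow> 'p \<Rightarrow> 'k \<Rightarrow> ('p \<Rightarrow> 'k) set" where
  "const_germ X x c \<equiv> germ X x (\<lambda>_. c)"

definition max_ideal :: "('p, 'k::field) fun_space \<Rightarrow> 'p \<Rightarrow> ('p \<Rightarrow> 'k) set set" where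
  "max_ideal X x = {germ X x f | f. f \<in> carrier (functions_near X x) \<and> f x = 0}"

primrec ideal_pow :: "('a, 'b) ring_scheme \<Rightarrow> 'a set \<Rightarrow> nat \<Rightarrow> 'a set" where
  "ideal_pow R J 0 = carrier R"
| "ideal_pow R J (Suc n) = ideal_prod R J (ideal_pow R J n)"

definition ord_ideal :: "('p, 'k::field) fun_space \<Rightarrow> 'p \<Rightarrow> ('p \<Rightarrow> 'k) set set \<Rightarrow> enat" where
  "ord_ideal X x J = Sup {enat i | i. J \<subseteq> ideal_pow (local_ring X x) (max_ideal X x) i}"

text \<open>A system of local parameters: elements of the maximal ideal whose classes form a basis of the
  cotangent space.\<close>

definition local_parameters ::
  "('p, 'k::field) fun_space \<Rightarrow> 'p \<Rightarrow> ('p \<Rightarrow> 'k) set list \<Rightarrow> bool" where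
  "local_parameters X x ts \<longleftrightarrow> set ts \<subseteq> max_ideal X x \<and>
     (\<forall>a\<in>max_ideal X x. \<exists>!c. length c = length ts \<and>
        a \<ominus>\<^bsub>local_ring X x\<^esub>
          (\<Oplus>\<^bsub>local_ring X x\<^esub>i\<in>{..<length ts}. const_germ X x (c ! i) \<otimes>\<^bsub>local_ring X x\<^esub> ts ! i)
        \<in> ideal_pow (local_ring X x) (max_ideal X x) 2)"

definition part_of_local_parameters ::
  "('p, 'k::field) fun_space \<Rightarrow> 'p \<Rightarrow> ('p \<Rightarrow> 'k) set list \<Rightarrow> bool" where
  "part_of_local_parameters X x ts \<longleftrightarrow> (\<exists>ts'. local_parameters X x (ts @ ts'))"

section \<open>Coherent sheaves of ideals\<close>

definition stalk ::
  "('p, 'k::field) fun_space \<Rightarrow> ('p set \<Rightarrow> ('p \<Rightarrow> 'k) set) \<Rightarrow> 'p \<Rightarrow> ('p \<Rightarrow> 'k) set set" where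
  "stalk X \<I> x = {germ X x f | f. \<exists>U. openin (topol X) U \<and> x \<in> U \<and> f \<in> \<I> U}"

definition ideal_sheaf ::
  "('p, 'k::field) fun_space \<Rightarrow> ('p set \<Rightarrow> ('p \<Rightarrow> 'k) set) \<Rightarrow> bool" where
  "ideal_sheaf X \<I> \<longleftrightarrow> (\<forall>U. openin (topol X) U \<longrightarrow>
     \<I> U \<subseteq> reg X U \<and> (\<lambda>_. 0) \<in> \<I> U \<and>
     (\<forall>f\<in>\<I> U. \<forall>g\<in>\<I> U. (\<lambda>z. f z + g z) \<in> \<I> U) \<and>
     (\<forall>a\<in>reg X U. \<forall>f\<in>\<I> U. (\<lambda>z. a z * f z) \<in> \<I> U) \<and>
     (\<forall>f\<in>\<I> U. \<forall>V. openin (topol X) V \<and> V \<subseteq> U \<longrightarrow> f \<in> \<I> V) \<and>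
     (\<forall>f. (\<forall>x\<in>U. \<exists>V g. openin (topol X) V \<and> x \<in> V \<and> V \<subseteq> U \<and> g \<in> \<I> V \<and> (\<forall>z\<in>V. f z = g z))
            \<longrightarrow> f \<in> \<I> U))"

text \<open>On a variety, a sheaf of ideals is coherent iff it is locally finitely generated.\<close>

definition coherent_ideal_sheaf ::
  "('p, 'k::field) fun_space \<Rightarrow> ('p set \<Rightarrow> ('p \<Rightarrow> 'k) set) \<Rightarrow> bool" where
  "coherent_ideal_sheaf X \<I> \<longleftrightarrow> ideal_sheaf X \<I> \<and>
     (\<forall>x\<in>topspace (topol X). \<exists>U F. openin (topol X) U \<and> x \<in> U \<and> finite F \<and> F \<subseteq> \<I> U \<and>
        (\<forall>z\<in>U. stalk X \<I> z = Idl\<^bsub>local_ring X z\<^esub> (germ X z ` F)))"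

section \<open>Divisors\<close>

definition prime_divisor :: "('p, 'k::field) fun_space \<Rightarrow> 'p set \<Rightarrow> bool" where
  "prime_divisor X Y \<longleftrightarrow> closedin (topol X) Y \<and> irreducible_in (topol X) Y \<and> Y \<noteq> topspace (topol X) \<and>
     (\<forall>Z. closedin (topol X) Z \<and> irreducible_in (topol X) Z \<and> Y \<subset> Z \<longrightarrow> Z = topspace (topol X))"

text \<open>A divisor all of whose components have multiplicity one is represented by the finite set of
  its irreducible components, so a totally ordered collection of such divisors is an
  \<open>'p set set list\<close>.\<close>

definition divisor_components :: "'p set set list \<Rightarrow> 'p set set" where
  "divisor_components E = \<Union>(set E)"

text \<open>The stalk of the ideal sheaf of all functions vanishing on \<open>Y\<close>.\<close>

definition vanishing_stalk :: "('p, 'k::field) fun_space \<Rightarrow> 'p set \<Rightarrow> 'p \<Rightarrow> ('p \<Rightarrow> 'k) set set" where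
  "vanishing_stalk X Y x = stalk X (\<lambda>U. {f \<in> reg X U. \<forall>z\<in>U \<inter> Y. f z = 0}) x"

definition local_equation ::
  "('p, 'k::field) fun_space \<Rightarrow> 'p \<Rightarrow> 'p set \<Rightarrow> ('p \<Rightarrow> 'k) set \<Rightarrow> bool" where
  "local_equation X x Y e \<longleftrightarrow> e \<in> carrier (local_ring X x) \<and>
     vanishing_stalk X Y x = PIdl\<^bsub>local_ring X x\<^esub> e"

text \<open>\<open>es\<close> lists local equations at \<open>x\<close>, one for each component of \<open>E\<close> through \<open>x\<close>.\<close>

definition local_equations ::
  "('p, 'k::field) fun_space \<Rightarrow> 'p set set list \<Rightarrow> 'p \<Rightarrow> ('p \<Rightarrow> 'k) set list \<Rightarrow> bool" where
  "local_equations X E x es \<longleftrightarrow> (\<exists>Ys. distinct Ys \<and> set Ys = {Y \<in> divisor_components E. x \<in> Y} \<and>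
     list_all2 (local_equation X x) Ys es)"

definition simple_normal_crossings :: "('p, 'k::field) fun_space \<Rightarrow> 'p set set list \<Rightarrow> bool" where
  "simple_normal_crossings X E \<longleftrightarrow> (\<forall>x\<in>topspace (topol X). \<exists>es. local_equations X E x es \<and>
     part_of_local_parameters X x es)"

section \<open>Marked ideals\<close>

definition marked_ideal ::
  "('p, 'k::field) fun_space \<Rightarrow> ('p set \<Rightarrow> ('p \<Rightarrow> 'k) set) \<Rightarrow> 'p set set list \<Rightarrow> nat \<Rightarrow> bool" where
  "marked_ideal X \<I> E \<mu> \<longleftrightarrow> smooth_variety X \<and> coherent_ideal_sheaf X \<I> \<and>
     (\<forall>D\<in>set E. finite D \<and> (\<forall>Y\<in>D. prime_divisor X Y) \<and> pairwise disjnt D) \<and>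
     simple_normal_crossings X E"

definition marked_support ::
  "('p, 'k::field) fun_space \<Rightarrow> ('p set \<Rightarrow> ('p \<Rightarrow> 'k) set) \<Rightarrow> nat \<Rightarrow> 'p set" where
  "marked_support X \<I> \<mu> = {x \<in> topspace (topol X). ord_ideal X x (stalk X \<I> x) \<ge> enat \<mu>}"

definition maximal_order ::
  "('p, 'k::field) fun_space \<Rightarrow> ('p set \<Rightarrow> ('p \<Rightarrow> 'k) set) \<Rightarrow> nat \<Rightarrow> bool" where
  "maximal_order X \<I> \<mu> \<longleftrightarrow> (\<forall>x\<in>topspace (topol X). ord_ideal X x (stalk X \<I> x) \<le> enat \<mu>)"

definition derivation ::
  "('p, 'k::field) fun_space \<Rightarrow> 'p \<Rightarrow> (('p \<Rightarrow> 'k) set \<Rightarrow> ('p \<Rightarrow> 'k) set) \<Rightarrow> bool" where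
  "derivation X x \<delta> \<longleftrightarrow> (let R = local_ring X x in
     \<delta> \<in> carrier R \<rightarrow> carrier R \<and>
     (\<forall>a\<in>carrier R. \<forall>b\<in>carrier R. \<delta> (a \<oplus>\<^bsub>R\<^esub> b) = \<delta> a \<oplus>\<^bsub>R\<^esub> \<delta> b \<and>
        \<delta> (a \<otimes>\<^bsub>R\<^esub> b) = \<delta> a \<otimes>\<^bsub>R\<^esub> b \<oplus>\<^bsub>R\<^esub> a \<otimes>\<^bsub>R\<^esub> \<delta> b) \<and>
     (\<forall>c. \<delta> (const_germ X x c) = \<zero>\<^bsub>R\<^esub>))"

text \<open>
  The sheaves \<open>\<D>\<^sup>i(\<I>)\<close>, \<open>T(\<I>)\<close> and \<open>\<H>(\<I>)\<close> are given by their stalks. The derivations of a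
  local ring of a variety are exactly the germs of derivations of the structure sheaf, and sums and
  products of ideal sheaves are formed stalkwise.
\<close>

definition D_ideal ::
  "('p, 'k::field) fun_space \<Rightarrow> 'p \<Rightarrow> ('p \<Rightarrow> 'k) set set \<Rightarrow> ('p \<Rightarrow> 'k) set set" where
  "D_ideal X x J = Idl\<^bsub>local_ring X x\<^esub> (J \<union> {\<delta> f | \<delta> f. derivation X x \<delta> \<and> f \<in> J})"

definition D_stalk ::
  "('p, 'k::field) fun_space \<Rightarrow> ('p set \<Rightarrow> ('p \<Rightarrow> 'k) set) \<Rightarrow> nat \<Rightarrow> 'p \<Rightarrow> ('p \<Rightarrow> 'k) set set" where
  "D_stalk X \<I> i x = (D_ideal X x ^^ i) (stalk X \<I> x)"

text \<open>For \<open>\<mu> = 0\<close> truncated subtraction gives \<open>T(\<I>) = \<I>\<close>.\<close>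

definition T_stalk ::
  "('p, 'k::field) fun_space \<Rightarrow> ('p set \<Rightarrow> ('p \<Rightarrow> 'k) set) \<Rightarrow> nat \<Rightarrow> 'p \<Rightarrow> ('p \<Rightarrow> 'k) set set" where
  "T_stalk X \<I> \<mu> x = D_stalk X \<I> (\<mu> - 1) x"

definition H_stalk ::
  "('p, 'k::field) fun_space \<Rightarrow> ('p set \<Rightarrow> ('p \<Rightarrow> 'k) set) \<Rightarrow> nat \<Rightarrow> 'p \<Rightarrow> ('p \<Rightarrow> 'k) set set" where
  "H_stalk X \<I> \<mu> x = Idl\<^bsub>local_ring X x\<^esub>
     (\<Union>i\<in>{..\<mu> - 1}. ideal_prod (local_ring X x) (D_stalk X \<I> i x)
                      (ideal_pow (local_ring X x) (T_stalk X \<I> \<mu> x) i))"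

text \<open>\<open>u\<close> is a section of \<open>T(\<I>)\<close> over the neighbourhood \<open>U\<close> of \<open>x\<close>, of multiplicity one.\<close>

definition tangent_direction ::
  "('p, 'k::field) fun_space \<Rightarrow> ('p set \<Rightarrow> ('p \<Rightarrow> 'k) set) \<Rightarrow> nat \<Rightarrow> 'p \<Rightarrow> 'p set \<Rightarrow> ('p \<Rightarrow> 'k) \<Rightarrow> bool"
where
  "tangent_direction X \<I> \<mu> x U u \<longleftrightarrow> openin (topol X) U \<and> x \<in> U \<and> u \<in> reg X U \<and>
     (\<forall>z\<in>U. germ X z u \<in> T_stalk X \<I> \<mu> z) \<and>
     (\<forall>z\<in>U. u z = 0 \<longrightarrow> ord_ideal X z (PIdl\<^bsub>local_ring X z\<^esub> (germ X z u)) = 1)"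

definition transversal ::
  "('p, 'k::field) fun_space \<Rightarrow> 'p set set list \<Rightarrow> 'p \<Rightarrow> ('p \<Rightarrow> 'k) \<Rightarrow> bool" where
  "transversal X E x u \<longleftrightarrow> (\<exists>es. local_equations X E x es \<and>
     part_of_local_parameters X x (germ X x u # es))"

section \<open>The completed local ring and its spectrum\<close>

text \<open>The \<open>J\<close>-adic completion, i.e. the inverse limit of the rings \<open>R / J\<^sup>n\<close>. The transition map
  \<open>R / J\<^sup>n\<^sup>+\<^sup>1 \<rightarrow> R / J\<^sup>n\<close> sends a coset to the unique coset containing it.\<close>

definition completion :: "('a, 'b) ring_scheme \<Rightarrow> 'a set \<Rightarrow> (nat \<Rightarrow> 'a set) ring" where
  "completion R J =
     \<lparr>carrier = {s. (\<forall>n. s n \<in> carrier (R Quot ideal_pow R J n)) \<and> (\<forall>n. s (Suc n) \<subseteq> s n)},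
      mult = (\<lambda>s t n. s n \<otimes>\<^bsub>R Quot ideal_pow R J n\<^esub> t n),
      one = (\<lambda>n. \<one>\<^bsub>R Quot ideal_pow R J n\<^esub>),
      zero = (\<lambda>n. \<zero>\<^bsub>R Quot ideal_pow R J n\<^esub>),
      add = (\<lambda>s t n. s n \<oplus>\<^bsub>R Quot ideal_pow R J n\<^esub> t n)\<rparr>"

definition completed_ring :: "('p, 'k::field) fun_space \<Rightarrow> 'p \<Rightarrow> (nat \<Rightarrow> ('p \<Rightarrow> 'k) set set) ring" where
  "completed_ring X x = completion (local_ring X x) (max_ideal X x)"

definition to_completed ::
  "('p, 'k::field) fun_space \<Rightarrow> 'p \<Rightarrow> ('p \<Rightarrow> 'k) set \<Rightarrow> nat \<Rightarrow> ('p \<Rightarrow> 'k) set set" where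
  "to_completed X x a =
     (\<lambda>n. ideal_pow (local_ring X x) (max_ideal X x) n +>\<^bsub>local_ring X x\<^esub> a)"

definition completed_ideal ::
  "('p, 'k::field) fun_space \<Rightarrow> 'p \<Rightarrow> ('p \<Rightarrow> 'k) set set \<Rightarrow> (nat \<Rightarrow> ('p \<Rightarrow> 'k) set set) set" where
  "completed_ideal X x J = Idl\<^bsub>completed_ring X x\<^esub> (to_completed X x ` J)"

text \<open>Automorphisms of the \<open>'k\<close>-scheme \<open>Spec\<close> of the completed ring are given by their comorphisms,
  the \<open>'k\<close>-algebra automorphisms of this ring.\<close>

definition completed_automorphism ::
  "('p, 'k::field) fun_space \<Rightarrow> 'p \<Rightarrow>
   ((nat \<Rightarrow> ('p \<Rightarrow> 'k) set set) \<Rightarrow> (nat \<Rightarrow> ('p \<Rightarrow> 'k) set set)) \<Rightarrow> bool" where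
  "completed_automorphism X x \<phi> \<longleftrightarrow> \<phi> \<in> ring_iso (completed_ring X x) (completed_ring X x) \<and>
     (\<forall>c. \<phi> (to_completed X x (const_germ X x c)) = to_completed X x (const_germ X x c))"

definition zero_locus :: "('a, 'b) ring_scheme \<Rightarrow> 'a set \<Rightarrow> 'a set set" where
  "zero_locus R J = {P. primeideal P R \<and> J \<subseteq> P}"

text \<open>The fixed points of the endomorphism of \<open>Spec R\<close> with comorphism \<open>\<phi>\<close>: the points that are
  mapped to themselves with trivial action on the residue field. This is the point set of the fixed
  point scheme, which is defined by the equations \<open>\<phi> a = a\<close>.\<close>

definition fixed_points :: "('a, 'b) ring_scheme \<Rightarrow> ('a \<Rightarrow> 'a) \<Rightarrow> 'a set set" where
  "fixed_points R \<phi> = {P. primeideal P R \<and> {a \<in> carrier R. \<phi> a \<in> P} = P \<and>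
     (\<forall>a\<in>carrier R. \<phi> a \<ominus>\<^bsub>R\<^esub> a \<in> P)}"

end

theory Submission
  imports Defs "HOL-Analysis.Abstract_Limits"
begin

text \<open>
  The Jacobian criterion provides a derivation \<open>\<delta>\<close> of the local ring with \<open>\<delta> u = 1\<close> and \<open>\<delta> v\<close> a unit that
  kills the equations of \<open>E\<close> and the remaining parameters. With \<open>k = v - u \<in> T(\<I>)\<close> the Taylor series
  \<open>\<phi>(a) = \<Sum>\<^sub>j k\<^sup>j \<delta>\<^sup>j(a) / j!\<close> converges in the completion; it is multiplicative by the Leibniz rule,
  sends \<open>u\<close> to \<open>v\<close> and fixes the other parameters. Its inverse is the Taylor series along \<open>\<delta> / \<delta> v\<close> with
  step \<open>u - v\<close>: the composition fixes generators of the cotangent space.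

  Since \<open>\<phi>(a)\<close> differs from its \<open>K\<close>-th Taylor polynomial by a multiple of \<open>k\<^sup>K\<close>, no closedness of
  ideals, hence no noetherian argument, is needed: \<open>k \<delta>\<close> maps \<open>\<H>(\<I>)\<close> to itself and
  \<open>k\<^sup>\<mu> \<in> \<D>\<^sup>\<mu>\<^sup>-\<^sup>1(\<I>) T(\<I>)\<^sup>\<mu>\<^sup>-\<^sup>1 \<subseteq> \<H>(\<I>)\<close> (for \<open>\<mu> > 0\<close>); taking \<open>K = 1\<close> shows \<open>\<phi>(a) - a \<in> (k)\<close>, so that
  \<open>V(T)\<close> is fixed.
\<close>

subsection \<open>Adic completions\<close>

text \<open>The series for \<open>\<phi>\<close> is the formal flow of \<delta> with its time
  parameter replaced by k. Substitution keeps it multiplicative for every k in the maximal ideal,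
  but it destroys the group law: \<delta> k need not vanish, so the series along \<delta> with step
  -k is in general not the inverse. The inverse has to send v to u and fix what \<delta> kills, so
  it is sought in the same form along a derivation with value 1 at v; a rescaling of \<delta> has
  this value precisely when \<delta> v is a unit. Hence one derivation must serve both tangent
  directions. If u does not occur in v to first order, \<delta> must take the value 1 at a further
  parameter occurring in v; transversality of v provides one that is not an equation of E, and the
  system of parameters is then corrected by subtracting u from it. The completion is handled by
  truncation: its n-th component sees only a Taylor polynomial with n terms modulo
  \<open>J^n\<close>, so each identity is proved as a congruence in the uncompleted ring, for all
  n.\<close>

locale adic = ideal J R + cring R for J and R (structure)
begin

lemma ideal_pow_ideal: "ideal (ideal_pow R J n) R"
  by (induction n) (auto simp: oneideal intro: ideal_prod_is_ideal is_ideal)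

lemma ideal_pow_carrier: "a \<in> ideal_pow R J n \<Longrightarrow> a \<in> carrier R"
  using ideal.Icarr[OF ideal_pow_ideal] .

lemma ideal_pow_add: "a \<in> ideal_pow R J n \<Longrightarrow> b \<in> ideal_pow R J n \<Longrightarrow> a \<oplus> b \<in> ideal_pow R J n"
  using additive_subgroup.a_closed[OF ideal.axioms(1)[OF ideal_pow_ideal]] .

lemma ideal_pow_minus: "a \<in> ideal_pow R J n \<Longrightarrow> b \<in> ideal_pow R J n \<Longrightarrow> a \<ominus> b \<in> ideal_pow R J n"
  unfolding a_minus_def
  by (meson additive_subgroup.a_closed additive_subgroup.a_inv_closed ideal.axioms(1) ideal_pow_ideal)

lemma ideal_pow_mult: "a \<in> ideal_pow R J n \<Longrightarrow> b \<in> carrier R \<Longrightarrow> a \<otimes> b \<in> ideal_pow R J n"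
  using ideal.I_r_closed[OF ideal_pow_ideal] .

lemma ideal_pow_mult_left: "a \<in> ideal_pow R J n \<Longrightarrow> b \<in> carrier R \<Longrightarrow> b \<otimes> a \<in> ideal_pow R J n"
  using ideal.I_l_closed[OF ideal_pow_ideal] .

lemma ideal_pow_SucI: "a \<in> J \<Longrightarrow> b \<in> ideal_pow R J n \<Longrightarrow> a \<otimes> b \<in> ideal_pow R J (Suc n)"
  by (simp add: ideal_prod.prod)

lemma ideal_pow_Suc_subset: "ideal_pow R J (Suc n) \<subseteq> ideal_pow R J n"
  using ideal_prod_inter[OF is_ideal ideal_pow_ideal] by auto

lemma ideal_pow_mono: "n \<le> m \<Longrightarrow> ideal_pow R J m \<subseteq> ideal_pow R J n"
  by (induction rule: dec_induct) (use ideal_pow_Suc_subset in blast)+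

lemma ideal_pow_one: "ideal_pow R J 1 = J"
  using ideal_prod_one[OF is_ideal] by simp

lemma nat_pow_mem_ideal_pow: "a \<in> J \<Longrightarrow> a [^] n \<in> ideal_pow R J n"
proof (induction n)
  case (Suc n)
  then show ?case
    using ideal_pow_SucI[of a "a [^] n" n] Icarr by (simp add: m_comm)
qed simp

abbreviation \<open>C \<equiv> completion R J\<close>

lemma coset_eq_iff:
  "a \<in> carrier R \<Longrightarrow> b \<in> carrier R \<Longrightarrow>
     ideal_pow R J n +> a = ideal_pow R J n +> b \<longleftrightarrow> a \<ominus> b \<in> ideal_pow R J n"
  using quotient_eq_iff_same_a_r_cos[OF ideal_pow_ideal] by blast

lemma coset_self: "a \<in> carrier R \<Longrightarrow> a \<in> ideal_pow R J n +> a"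
  by (simp add: abelian_subgroup.a_rcos_self abelian_subgroupI3 ideal_pow_ideal ideal.axioms(1) is_abelian_group)

lemma mem_coset: "a \<in> carrier R \<Longrightarrow> b \<in> ideal_pow R J n +> a \<Longrightarrow>
   b \<in> carrier R \<and> ideal_pow R J n +> a = ideal_pow R J n +> b"
  using abelian_subgroup.a_repr_independence'[OF abelian_subgroupI3[OF ideal.axioms(1)[OF ideal_pow_ideal] is_abelian_group]]
    abelian_subgroup.a_elemrcos_carrier[OF abelian_subgroupI3[OF ideal.axioms(1)[OF ideal_pow_ideal] is_abelian_group]]
  by blast

lemma coset_hom: "(+>) (ideal_pow R J n) \<in> ring_hom R (R Quot ideal_pow R J n)"
  by (rule ideal.rcos_ring_hom[OF ideal_pow_ideal])

lemma quot_cring: "cring (R Quot ideal_pow R J n)"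
  by (simp add: ideal.quotient_is_cring ideal_pow_ideal is_cring)

lemma mem_quot_carrier: "A \<in> carrier (R Quot ideal_pow R J n) \<longleftrightarrow> (\<exists>a\<in>carrier R. A = ideal_pow R J n +> a)"
  by (auto simp: FactRing_def A_RCOSETS_def')

lemma completion_carrier_component: "s \<in> carrier C \<Longrightarrow> s n \<in> carrier (R Quot ideal_pow R J n)"
  by (simp add: completion_def)

lemma completion_ex: "s \<in> carrier C \<Longrightarrow> \<exists>r. r \<in> s n"
  using completion_carrier_component[of s n] coset_self mem_quot_carrier by metis

lemma completion_mem:
  assumes "s \<in> carrier C" "r \<in> s n"
  shows "r \<in> carrier R" "s n = ideal_pow R J n +> r"
  using completion_carrier_component[OF assms(1), of n] assms(2) mem_coset mem_quot_carrier by metis+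

lemma completion_antimono: "s \<in> carrier C \<Longrightarrow> n \<le> m \<Longrightarrow> s m \<subseteq> s n"
  by (rule lift_Suc_antimono_le[of s]) (auto simp: completion_def)

text \<open>Elements of the completion are built from representatives \<open>r n\<close> that change
  by elements of \<open>J^n\<close> only; the transition condition of \<open>completion\<close>, an
  inclusion of cosets, reduces to this congruence.\<close>

lemma completionI:
  assumes "\<And>n. r n \<in> carrier R" "\<And>n. r (Suc n) \<ominus> r n \<in> ideal_pow R J n"
  shows "(\<lambda>n. ideal_pow R J n +> r n) \<in> carrier C"
proof -
  have "ideal_pow R J (Suc n) +> r (Suc n) \<subseteq> ideal_pow R J n +> r n" for n
  proof -
    have "ideal_pow R J n +> r n = ideal_pow R J n +> r (Suc n)"
      using assms coset_eq_iff by metis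
    then show ?thesis using ideal_pow_Suc_subset[of n] by (auto simp: a_r_coset_def')
  qed
  then show ?thesis using assms by (auto simp: completion_def mem_quot_carrier)
qed

lemma completion_add:
  assumes "s \<in> carrier C" "t \<in> carrier C" "a \<in> s n" "b \<in> t n"
  shows "(s \<oplus>\<^bsub>C\<^esub> t) n = ideal_pow R J n +> (a \<oplus> b)"
  using completion_mem[OF assms(1,3)] completion_mem[OF assms(2,4)] ring_hom_add[OF coset_hom]
  by (simp add: completion_def)

lemma completion_mult:
  assumes "s \<in> carrier C" "t \<in> carrier C" "a \<in> s n" "b \<in> t n"
  shows "(s \<otimes>\<^bsub>C\<^esub> t) n = ideal_pow R J n +> (a \<otimes> b)"
  using completion_mem[OF assms(1,3)] completion_mem[OF assms(2,4)] ring_hom_mult[OF coset_hom]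
  by (simp add: completion_def)

definition incl :: "'a \<Rightarrow> nat \<Rightarrow> 'a set" where
  "incl a = (\<lambda>n. ideal_pow R J n +> a)"

lemma incl_closed: "a \<in> carrier R \<Longrightarrow> incl a \<in> carrier C"
  unfolding incl_def
  by (rule completionI)
    (auto simp: r_neg minus_eq intro: additive_subgroup.zero_closed ideal.axioms(1)[OF ideal_pow_ideal])

lemma coset_zero: "ideal_pow R J n +> \<zero> = \<zero>\<^bsub>R Quot ideal_pow R J n\<^esub>"
  using ring_hom_zero[OF coset_hom] quot_cring ring_axioms by (meson cring.axioms(1))

lemma coset_one: "ideal_pow R J n +> \<one> = \<one>\<^bsub>R Quot ideal_pow R J n\<^esub>"
  using ring_hom_one[OF coset_hom] .

text \<open>The ring laws hold componentwise in the quotients. What needs work is closure: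
  compatibility of a sum or product is seen by computing component n also with the representatives
  of level n + 1.\<close>

lemma completion_cring: "cring C"
proof (rule cringI)
  interpret Q: cring "R Quot ideal_pow R J n" for n by (rule quot_cring)
  note component = completion_carrier_component
  have add: "s \<oplus>\<^bsub>C\<^esub> t \<in> carrier C" if s: "s \<in> carrier C" and t: "t \<in> carrier C" for s t
  proof -
    obtain a b where a: "\<And>n. a n \<in> s n" and b: "\<And>n. b n \<in> t n"
      using completion_ex[OF s] completion_ex[OF t] by metis
    have eq: "s \<oplus>\<^bsub>C\<^esub> t = (\<lambda>n. ideal_pow R J n +> (a n \<oplus> b n))"
      using completion_add[OF s t a b] by blast
    have "a (Suc n) \<oplus> b (Suc n) \<ominus> (a n \<oplus> b n) \<in> ideal_pow R J n" for n
    proof -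
      have *: "a (Suc n) \<in> s n" "b (Suc n) \<in> t n"
        using completion_antimono[OF s, of n "Suc n"] completion_antimono[OF t, of n "Suc n"] a b by auto
      have "(s \<oplus>\<^bsub>C\<^esub> t) n = ideal_pow R J n +> (a (Suc n) \<oplus> b (Suc n))"
        using completion_add[OF s t *] .
      then show ?thesis using eq a b completion_mem(1)[OF s] completion_mem(1)[OF t]
        by (metis (no_types, lifting) coset_eq_iff a_closed)
    qed
    then show ?thesis unfolding eq
      using a b completion_mem(1)[OF s] completion_mem(1)[OF t] by (intro completionI a_closed) blast+
  qed
  have mul: "s \<otimes>\<^bsub>C\<^esub> t \<in> carrier C" if s: "s \<in> carrier C" and t: "t \<in> carrier C" for s t
  proof -
    obtain a b where a: "\<And>n. a n \<in> s n" and b: "\<And>n. b n \<in> t n"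
      using completion_ex[OF s] completion_ex[OF t] by metis
    have eq: "s \<otimes>\<^bsub>C\<^esub> t = (\<lambda>n. ideal_pow R J n +> (a n \<otimes> b n))"
      using completion_mult[OF s t a b] by blast
    have "a (Suc n) \<otimes> b (Suc n) \<ominus> (a n \<otimes> b n) \<in> ideal_pow R J n" for n
    proof -
      have *: "a (Suc n) \<in> s n" "b (Suc n) \<in> t n"
        using completion_antimono[OF s, of n "Suc n"] completion_antimono[OF t, of n "Suc n"] a b by auto
      have "(s \<otimes>\<^bsub>C\<^esub> t) n = ideal_pow R J n +> (a (Suc n) \<otimes> b (Suc n))"
        using completion_mult[OF s t *] .
      then show ?thesis using eq a b completion_mem(1)[OF s] completion_mem(1)[OF t]
        by (metis (no_types, lifting) coset_eq_iff m_closed)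
    qed
    then show ?thesis unfolding eq
      using a b completion_mem(1)[OF s] completion_mem(1)[OF t] by (intro completionI m_closed) blast+
  qed
  have zero: "\<zero>\<^bsub>C\<^esub> = incl \<zero>" and one: "\<one>\<^bsub>C\<^esub> = incl \<one>"
    by (auto simp: completion_def incl_def coset_zero coset_one)
  show "abelian_group C"
  proof (rule abelian_groupI)
    \<comment> \<open>The negative of s is taken as its product with
      \<open>incl (\<ominus> \<one>)\<close>, so that closure under products already shows its
      compatibility.\<close>
    show "\<exists>t\<in>carrier C. t \<oplus>\<^bsub>C\<^esub> s = \<zero>\<^bsub>C\<^esub>" if s: "s \<in> carrier C" for s
    proof
      show "incl (\<ominus> \<one>) \<otimes>\<^bsub>C\<^esub> s \<in> carrier C" by (simp add: mul incl_closed s)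
      have "(incl (\<ominus> \<one>) \<otimes>\<^bsub>C\<^esub> s \<oplus>\<^bsub>C\<^esub> s) n = \<zero>\<^bsub>C\<^esub> n" for n
      proof -
        obtain a where a: "a \<in> s n" using completion_ex[OF s] by blast
        have ac: "a \<in> carrier R" using completion_mem(1)[OF s a] .
        have "\<ominus> \<one> \<in> incl (\<ominus> \<one>) n" by (simp add: incl_def coset_self)
        then have "(incl (\<ominus> \<one>) \<otimes>\<^bsub>C\<^esub> s) n = ideal_pow R J n +> (\<ominus> \<one> \<otimes> a)"
          by (intro completion_mult incl_closed s a) auto
        then have "\<ominus> \<one> \<otimes> a \<in> (incl (\<ominus> \<one>) \<otimes>\<^bsub>C\<^esub> s) n"
          using coset_self ac by simp
        then have "(incl (\<ominus> \<one>) \<otimes>\<^bsub>C\<^esub> s \<oplus>\<^bsub>C\<^esub> s) n = ideal_pow R J n +> (\<ominus> \<one> \<otimes> a \<oplus> a)"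
          by (intro completion_add mul incl_closed s a) auto
        also have "\<ominus> \<one> \<otimes> a \<oplus> a = \<zero>" using ac by algebra
        finally show ?thesis by (simp add: zero incl_def)
      qed
      then show "incl (\<ominus> \<one>) \<otimes>\<^bsub>C\<^esub> s \<oplus>\<^bsub>C\<^esub> s = \<zero>\<^bsub>C\<^esub>" by blast
    qed
    show "\<zero>\<^bsub>C\<^esub> \<in> carrier C" by (simp add: zero incl_closed)
    show "s \<oplus>\<^bsub>C\<^esub> t \<in> carrier C" if "s \<in> carrier C" "t \<in> carrier C" for s t
      by (rule add that)+
    show "s \<oplus>\<^bsub>C\<^esub> t \<oplus>\<^bsub>C\<^esub> w = s \<oplus>\<^bsub>C\<^esub> (t \<oplus>\<^bsub>C\<^esub> w)"
      if "s \<in> carrier C" "t \<in> carrier C" "w \<in> carrier C" for s t w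
      using that[THEN component] by (simp add: completion_def Q.a_assoc)
    show "s \<oplus>\<^bsub>C\<^esub> t = t \<oplus>\<^bsub>C\<^esub> s" if "s \<in> carrier C" "t \<in> carrier C" for s t
      using that[THEN component] by (simp add: completion_def Q.a_comm)
    show "\<zero>\<^bsub>C\<^esub> \<oplus>\<^bsub>C\<^esub> s = s" if "s \<in> carrier C" for s
      using that[THEN component] by (simp add: completion_def)
  qed
  show "comm_monoid C"
  proof (rule comm_monoidI)
    show "\<one>\<^bsub>C\<^esub> \<in> carrier C" by (simp add: one incl_closed)
    show "s \<otimes>\<^bsub>C\<^esub> t \<in> carrier C" if "s \<in> carrier C" "t \<in> carrier C" for s t
      by (rule mul that)+
    show "s \<otimes>\<^bsub>C\<^esub> t \<otimes>\<^bsub>C\<^esub> w = s \<otimes>\<^bsub>C\<^esub> (t \<otimes>\<^bsub>C\<^esub> w)"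
      if "s \<in> carrier C" "t \<in> carrier C" "w \<in> carrier C" for s t w
      using that[THEN component] by (simp add: completion_def Q.m_assoc)
    show "s \<otimes>\<^bsub>C\<^esub> t = t \<otimes>\<^bsub>C\<^esub> s" if "s \<in> carrier C" "t \<in> carrier C" for s t
      using that[THEN component] by (simp add: completion_def Q.m_comm)
    show "\<one>\<^bsub>C\<^esub> \<otimes>\<^bsub>C\<^esub> s = s" if "s \<in> carrier C" for s
      using that[THEN component] by (simp add: completion_def)
  qed
  show "(s \<oplus>\<^bsub>C\<^esub> t) \<otimes>\<^bsub>C\<^esub> w = s \<otimes>\<^bsub>C\<^esub> w \<oplus>\<^bsub>C\<^esub> t \<otimes>\<^bsub>C\<^esub> w"
    if "s \<in> carrier C" "t \<in> carrier C" "w \<in> carrier C" for s t w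
    using that[THEN component] by (simp add: completion_def Q.l_distr)
qed

lemma incl_hom: "incl \<in> ring_hom R C"
  using ring_hom_add[OF coset_hom] ring_hom_mult[OF coset_hom]
  by (intro ring_hom_memI incl_closed) (auto simp: incl_def completion_def coset_one)

end

subsection \<open>Taylor expansion along a derivation\<close>

text \<open>\<open>\<kappa>\<close> stands for the inclusion of the ground field, which supplies the
  denominators \<open>1 / fact n\<close>. The step h lies in J so that its powers tend to zero
  J-adically.\<close>

locale taylor_data = adic J R for J and R (structure) +
  fixes \<kappa> :: "'k::field_char_0 \<Rightarrow> 'a" and \<delta> :: "'a \<Rightarrow> 'a" and h :: 'a
  assumes const_closed: "\<kappa> c \<in> carrier R"
    and const_add: "\<kappa> (c + d) = \<kappa> c \<oplus> \<kappa> d"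
    and const_mult: "\<kappa> (c * d) = \<kappa> c \<otimes> \<kappa> d"
    and const_one: "\<kappa> 1 = \<one>"
    and deriv_closed: "a \<in> carrier R \<Longrightarrow> \<delta> a \<in> carrier R"
    and deriv_add: "a \<in> carrier R \<Longrightarrow> b \<in> carrier R \<Longrightarrow> \<delta> (a \<oplus> b) = \<delta> a \<oplus> \<delta> b"
    and deriv_mult: "a \<in> carrier R \<Longrightarrow> b \<in> carrier R \<Longrightarrow> \<delta> (a \<otimes> b) = \<delta> a \<otimes> b \<oplus> a \<otimes> \<delta> b"
    and deriv_const: "\<delta> (\<kappa> c) = \<zero>"
    and step_mem: "h \<in> J"
begin

lemma add_diff_cancel: "x \<in> carrier R \<Longrightarrow> y \<in> carrier R \<Longrightarrow> (x \<oplus> y) \<ominus> x = y"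
  by algebra

lemma additive_map_minus:
  assumes closed: "\<And>a. a \<in> carrier R \<Longrightarrow> f a \<in> carrier R"
    and add: "\<And>a b. a \<in> carrier R \<Longrightarrow> b \<in> carrier R \<Longrightarrow> f (a \<oplus> b) = f a \<oplus> f b"
    and c: "a \<in> carrier R" "b \<in> carrier R"
  shows "f (a \<ominus> b) = f a \<ominus> f b"
proof -
  have "a = b \<oplus> (a \<ominus> b)" using c by algebra
  then have "f a = f b \<oplus> f (a \<ominus> b)" using add[of b "a \<ominus> b"] c by simp
  then show ?thesis using closed c by (simp add: add_diff_cancel)
qed

lemma diff_self_mem: "x \<in> carrier R \<Longrightarrow> x \<ominus> x \<in> ideal_pow R J n"
  by (simp add: minus_eq r_neg additive_subgroup.zero_closed ideal.axioms(1) ideal_pow_ideal)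

section \<open>Truncated power series in the step element\<close>

lemma step_closed: "h \<in> carrier R"
  using Icarr step_mem .

text \<open>The sum of \<open>h [^] i \<otimes> a i\<close> over i < n, nested so that induction
  peels off the constant term and shifts the sequence. The index counts terms, so the degree is
  below n.\<close>

primrec horner :: "nat \<Rightarrow> (nat \<Rightarrow> 'a) \<Rightarrow> 'a" where
  "horner 0 a = \<zero>"
| "horner (Suc n) a = a 0 \<oplus> h \<otimes> horner n (\<lambda>i. a (Suc i))"

lemma horner_closed: "(\<And>i. a i \<in> carrier R) \<Longrightarrow> horner n a \<in> carrier R"
  by (induction n arbitrary: a) (auto simp: step_closed)

lemma horner_add:
  assumes "\<And>i. a i \<in> carrier R" "\<And>i. b i \<in> carrier R"
  shows "horner n (\<lambda>i. a i \<oplus> b i) = horner n a \<oplus> horner n b"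
  using assms
proof (induction n arbitrary: a b)
  case (Suc n)
  define A B where "A = horner n (\<lambda>i. a (Suc i))" and "B = horner n (\<lambda>i. b (Suc i))"
  have c: "h \<in> carrier R" "a 0 \<in> carrier R" "b 0 \<in> carrier R" "A \<in> carrier R" "B \<in> carrier R"
    unfolding A_def B_def using Suc.prems by (auto intro: horner_closed step_closed)
  have IH: "horner n (\<lambda>i. a (Suc i) \<oplus> b (Suc i)) = A \<oplus> B"
    unfolding A_def B_def by (rule Suc.IH) (use Suc.prems in auto)
  show ?case unfolding horner.simps IH A_def[symmetric] B_def[symmetric] using c by algebra
qed simp

lemma horner_scale:
  assumes "\<And>i. a i \<in> carrier R" "r \<in> carrier R"
  shows "horner n (\<lambda>i. r \<otimes> a i) = r \<otimes> horner n a"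
  using assms
proof (induction n arbitrary: a)
  case (Suc n)
  define A where "A = horner n (\<lambda>i. a (Suc i))"
  have c: "h \<in> carrier R" "a 0 \<in> carrier R" "r \<in> carrier R" "A \<in> carrier R"
    unfolding A_def using Suc.prems by (auto intro: horner_closed step_closed)
  have IH: "horner n (\<lambda>i. r \<otimes> a (Suc i)) = r \<otimes> A"
    unfolding A_def by (rule Suc.IH) (use Suc.prems in auto)
  show ?case unfolding horner.simps IH A_def[symmetric] using c by algebra
qed simp

lemma horner_split:
  assumes "\<And>i. a i \<in> carrier R"
  shows "horner (K + n) a = horner K a \<oplus> h [^] K \<otimes> horner n (\<lambda>i. a (K + i))"
  using assms
proof (induction K arbitrary: a)
  case 0
  then show ?case by (simp add: horner_closed)
next
  case (Suc K)
  define A B where "A = horner K (\<lambda>i. a (Suc i))" and "B = horner n (\<lambda>i. a (Suc (K + i)))"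
  have c: "h \<in> carrier R" "h [^] K \<in> carrier R" "a 0 \<in> carrier R" "A \<in> carrier R" "B \<in> carrier R"
    unfolding A_def B_def using Suc.prems by (auto intro: horner_closed step_closed)
  have IH: "horner (K + n) (\<lambda>i. a (Suc i)) = A \<oplus> h [^] K \<otimes> B"
    unfolding A_def B_def by (rule Suc.IH) (use Suc.prems in auto)
  show ?case unfolding horner.simps add_Suc IH nat_pow_Suc A_def[symmetric] B_def[symmetric] using c by algebra
qed

lemma horner_Suc_right:
  assumes "\<And>i. a i \<in> carrier R"
  shows "horner (Suc n) a = horner n a \<oplus> h [^] n \<otimes> a n"
  using horner_split[of a n 1, OF assms] assms[of n] step_closed by simp

text \<open>Membership is asked of the terms, not of the coefficients: a derivative of an element of
  the ideal returns to the ideal only after multiplication with the matching power of h.\<close>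

lemma horner_mem_ideal:
  assumes "ideal I R" "\<And>i. a i \<in> carrier R" "\<And>i. h [^] i \<otimes> a i \<in> I"
  shows "horner n a \<in> I"
proof (induction n)
  case (Suc n)
  then show ?case using assms additive_subgroup.a_closed[OF ideal.axioms(1)[OF assms(1)]]
    by (simp only: horner_Suc_right)
qed (use assms additive_subgroup.zero_closed[OF ideal.axioms(1)] in auto)

text \<open>The n-th coefficient of the Cauchy product; the recursion shifts only \<open>a\<close>,
  so that it matches the recursion of \<open>horner\<close>.\<close>

primrec conv :: "nat \<Rightarrow> (nat \<Rightarrow> 'a) \<Rightarrow> (nat \<Rightarrow> 'a) \<Rightarrow> 'a" where
  "conv 0 a b = a 0 \<otimes> b 0"
| "conv (Suc n) a b = a 0 \<otimes> b (Suc n) \<oplus> conv n (\<lambda>i. a (Suc i)) b"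

lemma conv_closed:
  "(\<And>i. a i \<in> carrier R) \<Longrightarrow> (\<And>i. b i \<in> carrier R) \<Longrightarrow> conv n a b \<in> carrier R"
  by (induction n arbitrary: a) auto

lemma horner_conv:
  assumes "\<And>i. a i \<in> carrier R" "\<And>i. b i \<in> carrier R"
  shows "horner (Suc n) (\<lambda>k. conv k a b) =
    a 0 \<otimes> horner (Suc n) b \<oplus> h \<otimes> horner n (\<lambda>k. conv k (\<lambda>i. a (Suc i)) b)"
proof -
  define B D where "B = horner n (\<lambda>i. b (Suc i))" and "D = horner n (\<lambda>k. conv k (\<lambda>i. a (Suc i)) b)"
  have c: "h \<in> carrier R" "a 0 \<in> carrier R" "b 0 \<in> carrier R" "B \<in> carrier R" "D \<in> carrier R"
    unfolding B_def D_def using assms by (auto intro!: horner_closed step_closed conv_closed)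
  have eq: "horner n (\<lambda>k. conv (Suc k) a b) = a 0 \<otimes> B \<oplus> D"
    unfolding conv.simps B_def D_def using assms
    by (subst horner_add) (auto intro!: conv_closed simp: horner_scale)
  show ?thesis unfolding horner.simps eq conv.simps(1) B_def[symmetric] D_def[symmetric] using c by algebra
qed

text \<open>Truncation drops exactly the terms of total degree at least n, and each of them carries
  a factor \<open>h [^] n\<close>.\<close>

lemma horner_mult:
  assumes "\<And>i. a i \<in> carrier R" "\<And>i. b i \<in> carrier R"
  shows "\<exists>r\<in>carrier R. horner n a \<otimes> horner n b = horner n (\<lambda>k. conv k a b) \<oplus> h [^] n \<otimes> r"
  using assms(1)
proof (induction n arbitrary: a)
  case 0
  then show ?case by (intro bexI[of _ \<zero>]) auto
next
  case (Suc n)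
  let ?a = "\<lambda>i. a (Suc i)"
  define A D where "A = horner n ?a" and "D = horner n (\<lambda>k. conv k ?a b)"
  obtain r where r: "r \<in> carrier R" "A \<otimes> horner n b = D \<oplus> h [^] n \<otimes> r"
    using Suc.IH[of ?a] Suc.prems by (auto simp: A_def D_def)
  have c: "h \<in> carrier R" "h [^] n \<in> carrier R" "a 0 \<in> carrier R" "b n \<in> carrier R"
    "A \<in> carrier R" "horner n b \<in> carrier R" "horner (Suc n) b \<in> carrier R" "D \<in> carrier R"
    unfolding A_def D_def using Suc.prems assms(2) by (auto intro!: horner_closed step_closed conv_closed simp del: horner.simps)
  define hb where "hb = horner (Suc n) b"
  have hb: "hb = horner n b \<oplus> h [^] n \<otimes> b n" "hb \<in> carrier R"
    unfolding hb_def using c assms(2) horner_Suc_right by auto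
  have "horner (Suc n) a \<otimes> hb = a 0 \<otimes> hb \<oplus> h \<otimes> (A \<otimes> hb)"
    unfolding horner.simps A_def[symmetric] using c hb(2) by algebra
  also have "A \<otimes> hb = A \<otimes> horner n b \<oplus> h [^] n \<otimes> (A \<otimes> b n)"
    unfolding hb(1) using c by algebra
  also have "a 0 \<otimes> hb \<oplus> h \<otimes> (A \<otimes> horner n b \<oplus> h [^] n \<otimes> (A \<otimes> b n)) =
    (a 0 \<otimes> hb \<oplus> h \<otimes> D) \<oplus> h [^] Suc n \<otimes> (r \<oplus> A \<otimes> b n)"
    unfolding r(2) nat_pow_Suc using c hb(2) r(1) by algebra
  also have "a 0 \<otimes> hb \<oplus> h \<otimes> D = horner (Suc n) (\<lambda>k. conv k a b)"
    unfolding hb_def D_def by (rule horner_conv[symmetric]) (use Suc.prems assms in auto)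
  finally show ?case unfolding hb_def using c r(1) by (intro bexI[of _ "r \<oplus> A \<otimes> b n"]) auto
qed

section \<open>Divided powers of the derivation and the Leibniz rule\<close>

lemma deriv_zero: "\<delta> \<zero> = \<zero>"
  using deriv_add[of \<zero> \<zero>] deriv_closed[of \<zero>] by (simp add: add.l_cancel_one)

lemma deriv_scale: "a \<in> carrier R \<Longrightarrow> \<delta> (\<kappa> c \<otimes> a) = \<kappa> c \<otimes> \<delta> a"
  by (simp add: deriv_mult const_closed deriv_const deriv_closed)

lemma deriv_minus: "a \<in> carrier R \<Longrightarrow> b \<in> carrier R \<Longrightarrow> \<delta> (a \<ominus> b) = \<delta> a \<ominus> \<delta> b"
  by (rule additive_map_minus) (auto simp: deriv_closed deriv_add)

lemma iter_deriv_closed: "a \<in> carrier R \<Longrightarrow> (\<delta> ^^ n) a \<in> carrier R"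
  by (induction n) (auto simp: deriv_closed)

lemma iter_deriv_add:
  "a \<in> carrier R \<Longrightarrow> b \<in> carrier R \<Longrightarrow> (\<delta> ^^ n) (a \<oplus> b) = (\<delta> ^^ n) a \<oplus> (\<delta> ^^ n) b"
  by (induction n) (auto simp: deriv_add iter_deriv_closed)

lemma iter_deriv_zero: "(\<delta> ^^ n) \<zero> = \<zero>"
  by (induction n) (auto simp: deriv_zero)

text \<open>The Leibniz rule for sequences satisfying the recurrence \<open>a' i = (i + 1) a (i + 1)\<close> of Taylor
  coefficients; the shift \<open>e\<close> makes the induction go through.\<close>

lemma deriv_conv:
  assumes "\<And>i. a i \<in> carrier R" "\<And>i. b i \<in> carrier R"
    and "\<And>i. \<delta> (a i) = \<kappa> (of_nat (Suc (i + e))) \<otimes> a (Suc i)"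
    and b: "\<And>i. \<delta> (b i) = \<kappa> (of_nat (Suc i)) \<otimes> b (Suc i)"
  shows "\<delta> (conv n a b) \<oplus> \<kappa> (of_nat e) \<otimes> (a 0 \<otimes> b (Suc n)) = \<kappa> (of_nat (Suc (n + e))) \<otimes> conv (Suc n) a b"
  using assms(1,3)
proof (induction n arbitrary: a e)
  case 0
  have "\<kappa> (of_nat (Suc e)) = \<one> \<oplus> \<kappa> (of_nat e)" using const_add[of 1 "of_nat e"] const_one by simp
  moreover have "a 0 \<in> carrier R" "a (Suc 0) \<in> carrier R" "b 0 \<in> carrier R" "b (Suc 0) \<in> carrier R"
     "\<kappa> (of_nat e) \<in> carrier R"
    by (auto simp: 0 assms(2) const_closed)
  ultimately show ?case by (simp add: deriv_mult 0(2) b const_one) algebra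
next
  case (Suc n)
  let ?a = "\<lambda>i. a (Suc i)"
  \<comment> \<open>Passing to the tail of \<open>a\<close> raises the shift by one. The boundary
    term of this instance is exactly \<open>\<delta> (a 0) \<otimes> b (Suc n)\<close>, the part of
    the product rule that the tail does not see.\<close>
  have IH: "\<delta> (conv n ?a b) \<oplus> \<kappa> (of_nat (Suc e)) \<otimes> (a 1 \<otimes> b (Suc n)) =
     \<kappa> (of_nat (Suc (n + Suc e))) \<otimes> conv (Suc n) ?a b"
    using Suc.IH[of ?a "Suc e"] Suc.prems by simp
  have e: "\<kappa> (of_nat (Suc e)) = \<one> \<oplus> \<kappa> (of_nat e)"
    "\<kappa> (of_nat (Suc (n + Suc e))) = \<kappa> (of_nat (Suc (Suc n))) \<oplus> \<kappa> (of_nat e)"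
    using const_add[of 1 "of_nat e"] const_one const_add[of "of_nat (Suc (Suc n))" "of_nat e"]
    by (simp_all add: algebra_simps)
  define cn where "cn = \<kappa> (of_nat (Suc (Suc n)))"
  define C where "C = conv (Suc n) ?a b"
  define D where "D = \<delta> (conv n ?a b)"
  define A1 where "A1 = a 1"
  define B1 where "B1 = b (Suc n)"
  define B2 where "B2 = b (Suc (Suc n))"
  have c: "a 0 \<in> carrier R" "A1 \<in> carrier R" "B1 \<in> carrier R" "B2 \<in> carrier R"
     "\<kappa> (of_nat e) \<in> carrier R" "cn \<in> carrier R" "C \<in> carrier R" "D \<in> carrier R"
    unfolding cn_def C_def D_def A1_def B1_def B2_def
    using Suc.prems assms(2) by (auto intro!: const_closed conv_closed deriv_closed simp del: conv.simps)
  have "\<delta> (conv (Suc n) a b) = \<delta> (a 0 \<otimes> B1) \<oplus> D"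
    unfolding conv.simps D_def B1_def using Suc.prems assms(2) by (intro deriv_add) (auto intro!: conv_closed)
  also have "\<delta> (a 0 \<otimes> B1) = (\<one> \<oplus> \<kappa> (of_nat e)) \<otimes> A1 \<otimes> B1 \<oplus> a 0 \<otimes> (cn \<otimes> B2)"
    using Suc.prems(2)[of 0] b[of "Suc n"] c e(1) unfolding B1_def B2_def A1_def cn_def
    by (simp add: deriv_mult)
  finally have 1: "\<delta> (conv (Suc n) a b) = (\<one> \<oplus> \<kappa> (of_nat e)) \<otimes> A1 \<otimes> B1 \<oplus> a 0 \<otimes> (cn \<otimes> B2) \<oplus> D" .
  have 2: "D \<oplus> (\<one> \<oplus> \<kappa> (of_nat e)) \<otimes> (A1 \<otimes> B1) = (cn \<oplus> \<kappa> (of_nat e)) \<otimes> C"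
    using IH unfolding e D_def[symmetric] A1_def[symmetric] B1_def[symmetric] C_def[symmetric] cn_def[symmetric] .
  have "\<delta> (conv (Suc n) a b) \<oplus> \<kappa> (of_nat e) \<otimes> (a 0 \<otimes> B2) =
     (D \<oplus> (\<one> \<oplus> \<kappa> (of_nat e)) \<otimes> (A1 \<otimes> B1)) \<oplus> (cn \<oplus> \<kappa> (of_nat e)) \<otimes> (a 0 \<otimes> B2)"
    unfolding 1 using c by algebra
  also have "\<dots> = (cn \<oplus> \<kappa> (of_nat e)) \<otimes> (a 0 \<otimes> B2 \<oplus> C)"
    unfolding 2 using c by algebra
  also have "a 0 \<otimes> B2 \<oplus> C = conv (Suc (Suc n)) a b" unfolding B2_def C_def by simp
  finally show ?case unfolding B2_def using e(2) by (simp add: cn_def)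
qed

text \<open>The divided power of \<delta>, the n-th iterate over n!; characteristic zero enters
  here.\<close>

definition coef :: "nat \<Rightarrow> 'a \<Rightarrow> 'a" where
  "coef n a = \<kappa> (1 / fact n) \<otimes> (\<delta> ^^ n) a"

lemma coef_closed: "a \<in> carrier R \<Longrightarrow> coef n a \<in> carrier R"
  by (simp add: coef_def const_closed iter_deriv_closed)

lemma coef_add: "a \<in> carrier R \<Longrightarrow> b \<in> carrier R \<Longrightarrow> coef n (a \<oplus> b) = coef n a \<oplus> coef n b"
  by (simp add: coef_def const_closed iter_deriv_closed iter_deriv_add r_distr)

lemma coef_0: "a \<in> carrier R \<Longrightarrow> coef 0 a = a"
  by (simp add: coef_def const_one)

lemma deriv_coef:
  assumes "a \<in> carrier R" shows "\<delta> (coef n a) = \<kappa> (of_nat (Suc n)) \<otimes> coef (Suc n) a"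
proof -
  have "\<kappa> (of_nat (Suc n)) \<otimes> \<kappa> (1 / fact (Suc n)) = \<kappa> (1 / fact n)"
    by (subst const_mult[symmetric]) (simp add: field_simps del: of_nat_Suc)
  then show ?thesis using assms
    by (simp add: coef_def deriv_scale iter_deriv_closed const_closed deriv_closed flip: m_assoc)
qed

lemma const_cancel:
  assumes "c \<noteq> 0" "a \<in> carrier R" "b \<in> carrier R" "\<kappa> c \<otimes> a = \<kappa> c \<otimes> b"
  shows "a = b"
proof -
  have "\<kappa> (1 / c) \<otimes> \<kappa> c = \<one>" using assms(1) by (simp flip: const_mult add: const_one)
  then show ?thesis using assms(2-) const_closed by (metis l_one m_assoc)
qed

text \<open>For divided powers the Leibniz rule has no binomial coefficients. Applying \<delta> to
  the rule of order n gives n + 1 times the rule of order n + 1, by \<open>deriv_conv\<close> with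
  shift 0, and n + 1 is invertible in the ground field.\<close>

lemma coef_mult:
  assumes "a \<in> carrier R" "b \<in> carrier R"
  shows "coef n (a \<otimes> b) = conv n (\<lambda>i. coef i a) (\<lambda>i. coef i b)"
proof (induction n)
  case (Suc n)
  define q where "q = conv (Suc n) (\<lambda>i. coef i a) (\<lambda>i. coef i b)"
  define p where "p = coef (Suc n) (a \<otimes> b)"
  define r where "r = coef 0 a \<otimes> coef (Suc n) b"
  have q: "q \<in> carrier R" and p: "p \<in> carrier R" and r: "r \<in> carrier R"
    unfolding q_def p_def r_def using assms by (auto intro!: conv_closed coef_closed simp del: conv.simps)
  have zero: "\<kappa> 0 = \<zero>"
    using const_add[of 0 0] const_closed[of 0] by simp
  have "\<delta> (conv n (\<lambda>i. coef i a) (\<lambda>i. coef i b)) \<oplus> \<kappa> (of_nat 0) \<otimes> r = \<kappa> (of_nat (Suc (n + 0))) \<otimes> q"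
    unfolding r_def q_def using assms
    by (intro deriv_conv) (simp_all add: coef_closed deriv_coef del: of_nat_Suc)
  then have "\<kappa> (of_nat (Suc n)) \<otimes> p \<oplus> \<zero> \<otimes> r = \<kappa> (of_nat (Suc n)) \<otimes> q"
    unfolding p_def deriv_coef[OF m_closed[OF assms], symmetric] Suc.IH of_nat_0 zero add_0_right .
  then have "\<kappa> (of_nat (Suc n)) \<otimes> p = \<kappa> (of_nat (Suc n)) \<otimes> q"
    using p r const_closed by (simp del: of_nat_Suc)
  then show ?case unfolding p_def[symmetric] q_def[symmetric]
    using p q by - (rule const_cancel[of "of_nat (Suc n)"], simp_all del: of_nat_Suc)
qed (use assms in \<open>simp add: coef_0\<close>)

section \<open>Taylor polynomials and the ideals they preserve\<close>

definition taylor :: "nat \<Rightarrow> 'a \<Rightarrow> 'a" where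
  "taylor n a = horner n (\<lambda>j. coef j a)"

lemma taylor_closed: "a \<in> carrier R \<Longrightarrow> taylor n a \<in> carrier R"
  by (auto simp: taylor_def intro: horner_closed coef_closed)

lemma taylor_add:
  "a \<in> carrier R \<Longrightarrow> b \<in> carrier R \<Longrightarrow> taylor n (a \<oplus> b) = taylor n a \<oplus> taylor n b"
  by (simp add: taylor_def coef_add horner_add coef_closed)

lemma taylor_minus:
  "a \<in> carrier R \<Longrightarrow> b \<in> carrier R \<Longrightarrow> taylor n (a \<ominus> b) = taylor n a \<ominus> taylor n b"
  by (rule additive_map_minus) (auto simp: taylor_closed taylor_add)

text \<open>By \<open>coef_mult\<close> the truncated product of two Taylor polynomials is the
  Taylor polynomial of the product, so the defect is a multiple of \<open>h [^] n\<close>.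
  Multiplicativity thus holds modulo \<open>J^n\<close>, which is all that component n of the
  completion records.\<close>

lemma taylor_mult:
  assumes "a \<in> carrier R" "b \<in> carrier R"
  shows "taylor n a \<otimes> taylor n b \<ominus> taylor n (a \<otimes> b) \<in> ideal_pow R J n"
proof -
  obtain r where r: "r \<in> carrier R" "taylor n a \<otimes> taylor n b = taylor n (a \<otimes> b) \<oplus> h [^] n \<otimes> r"
    using horner_mult[of "\<lambda>i. coef i a" "\<lambda>i. coef i b" n] assms
    by (auto simp: taylor_def coef_closed coef_mult)
  have "taylor n a \<otimes> taylor n b \<ominus> taylor n (a \<otimes> b) = h [^] n \<otimes> r"
    unfolding r(2) using r(1) step_closed taylor_closed[of "a \<otimes> b" n] assms
    by (simp add: add_diff_cancel taylor_closed)
  then show ?thesis using r(1) step_mem nat_pow_mem_ideal_pow ideal_pow_mult by simp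
qed

lemma taylor_deriv_zero:
  assumes "a \<in> carrier R" "\<delta> a = \<zero>" shows "taylor (Suc n) a = a"
proof -
  have "coef (Suc i) a = \<zero>" for i
    using assms const_closed by (simp add: coef_def funpow_swap1 iter_deriv_zero)
  moreover have "horner n (\<lambda>_. \<zero>) = \<zero>" using horner_scale[of "\<lambda>_. \<zero>" \<zero> n] by (simp add: horner_closed)
  ultimately show ?thesis using assms step_closed by (simp add: taylor_def coef_0)
qed

lemma taylor_const: "taylor (Suc n) (\<kappa> c) = \<kappa> c"
  by (simp add: taylor_deriv_zero const_closed deriv_const)

lemma taylor_deriv_one:
  assumes "a \<in> carrier R" "\<delta> a = \<one>" shows "taylor (Suc (Suc n)) a = a \<oplus> h"
proof -
  have "\<delta> \<one> = \<zero>" using deriv_const[of 1] const_one by simp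
  then have "coef (Suc (Suc i)) a = \<zero>" for i
    using assms const_closed by (simp add: coef_def funpow_swap1 iter_deriv_zero)
  moreover have "horner n (\<lambda>_. \<zero>) = \<zero>" using horner_scale[of "\<lambda>_. \<zero>" \<zero> n] by (simp add: horner_closed)
  moreover have "coef 1 a = \<one>" using assms by (simp add: coef_def const_one)
  ultimately show ?thesis using assms step_closed by (simp add: taylor_def coef_0)
qed

text \<open>The extra factor h avoids the exponent n - 1 of the power rule.\<close>

lemma step_deriv_pow: "h \<otimes> \<delta> (h [^] (n::nat)) = \<kappa> (of_nat n) \<otimes> h [^] n \<otimes> \<delta> h"
proof (induction n)
  case 0
  have "\<delta> \<one> = \<zero>" "\<kappa> 0 = \<zero>" using deriv_const[of 1] const_one const_add[of 0 0] const_closed[of 0] by simp_all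
  then show ?case using step_closed deriv_closed by simp
next
  case (Suc n)
  have c: "h \<in> carrier R" "\<delta> h \<in> carrier R" "h [^] n \<in> carrier R" "\<delta> (h [^] n) \<in> carrier R" "\<kappa> (of_nat n) \<in> carrier R"
    by (auto simp: step_closed deriv_closed const_closed)
  have "h \<otimes> \<delta> (h [^] Suc n) = h \<otimes> \<delta> (h [^] n) \<otimes> h \<oplus> h [^] n \<otimes> h \<otimes> \<delta> h"
    unfolding nat_pow_Suc deriv_mult[OF c(3,1)] using c by algebra
  also have "\<dots> = (\<kappa> (of_nat n) \<oplus> \<one>) \<otimes> (h [^] n \<otimes> h) \<otimes> \<delta> h"
    unfolding Suc using c by algebra
  also have "\<kappa> (of_nat n) \<oplus> \<one> = \<kappa> (of_nat (Suc n))"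
    by (simp add: const_add const_one a_comm const_closed)
  finally show ?case by simp
qed

text \<open>Multiplication by h does not commute with \<delta>, so iterating the stability
  assumption does not give the claim directly. By the product rule,
  \<open>h \<otimes> \<delta> (h [^] n \<otimes> d)\<close> differs from the wanted term of order n
  + 1 by a multiple of \<open>h [^] n \<otimes> d\<close>, which is in the ideal by
  induction.\<close>

lemma stable_iter_deriv:
  assumes I: "ideal I R" and stable: "\<And>a. a \<in> I \<Longrightarrow> h \<otimes> \<delta> a \<in> I" and a: "a \<in> I"
  shows "h [^] n \<otimes> (\<delta> ^^ n) a \<in> I"
proof (induction n)
  case 0
  then show ?case using a ideal.Icarr[OF I a] by simp
next
  case (Suc n)
  define d where "d = (\<delta> ^^ n) a"
  have c: "h \<in> carrier R" "\<delta> h \<in> carrier R" "h [^] n \<in> carrier R" "\<delta> (h [^] n) \<in> carrier R" "\<kappa> (of_nat n) \<in> carrier R"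
     "d \<in> carrier R" "\<delta> d \<in> carrier R"
    by (auto simp: step_closed deriv_closed const_closed iter_deriv_closed ideal.Icarr[OF I a] d_def)
  have 1: "h [^] n \<otimes> d \<in> I" using Suc d_def by simp
  have "h \<otimes> \<delta> (h [^] n \<otimes> d) = (h \<otimes> \<delta> (h [^] n)) \<otimes> d \<oplus> h [^] n \<otimes> h \<otimes> \<delta> d"
    unfolding deriv_mult[OF c(3,6)] using c by algebra
  also have "\<dots> = (\<kappa> (of_nat n) \<otimes> \<delta> h) \<otimes> (h [^] n \<otimes> d) \<oplus> h [^] n \<otimes> h \<otimes> \<delta> d"
    unfolding step_deriv_pow using c by algebra
  finally have "h [^] n \<otimes> h \<otimes> \<delta> d = h \<otimes> \<delta> (h [^] n \<otimes> d) \<ominus> (\<kappa> (of_nat n) \<otimes> \<delta> h) \<otimes> (h [^] n \<otimes> d)"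
    using c by (simp add: add_diff_cancel)
  moreover have "h \<otimes> \<delta> (h [^] n \<otimes> d) \<in> I" "(\<kappa> (of_nat n) \<otimes> \<delta> h) \<otimes> (h [^] n \<otimes> d) \<in> I"
    using stable[OF 1] ideal.I_l_closed[OF I 1] c by auto
  ultimately show ?case unfolding d_def
    using additive_subgroup.a_closed[OF ideal.axioms(1)[OF I]] additive_subgroup.a_inv_closed[OF ideal.axioms(1)[OF I]]
    by (simp add: a_minus_def)
qed

lemma scaled_coef_mem:
  assumes I: "ideal I R" and "a \<in> carrier R" "h [^] (i::nat) \<otimes> (\<delta> ^^ j) a \<in> I"
  shows "h [^] i \<otimes> coef j a \<in> I"
proof -
  have "h [^] i \<otimes> coef j a = \<kappa> (1 / fact j) \<otimes> (h [^] i \<otimes> (\<delta> ^^ j) a)"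
    unfolding coef_def using step_closed const_closed iter_deriv_closed[OF assms(2)]
    by (intro m_lcomm) auto
  then show ?thesis using ideal.I_l_closed[OF I assms(3)] const_closed by simp
qed

lemma taylor_stable:
  assumes I: "ideal I R" and stable: "\<And>a. a \<in> I \<Longrightarrow> h \<otimes> \<delta> a \<in> I" and a: "a \<in> I"
  shows "taylor n a \<in> I"
  unfolding taylor_def
  using ideal.Icarr[OF I a] stable_iter_deriv[OF assms]
  by (intro horner_mem_ideal I coef_closed scaled_coef_mem) auto

lemma deriv_ideal_pow: "a \<in> ideal_pow R J (Suc n) \<Longrightarrow> \<delta> a \<in> ideal_pow R J n"
proof (induction n arbitrary: a)
  case 0
  then show ?case using ideal_pow_carrier[of a 1] by (simp add: deriv_closed)
next
  case (Suc n)
  have "a \<in> ideal_prod R J (ideal_pow R J (Suc n))" using Suc.prems by simp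
  then show ?case
  proof (induction rule: ideal_prod.induct)
    case (prod i j)
    have c: "i \<in> carrier R" "j \<in> carrier R" using prod Icarr ideal_pow_carrier by blast+
    show ?case unfolding deriv_mult[OF c]
      using ideal_pow_mult_left[OF prod(2) deriv_closed[OF c(1)]]
        ideal_pow_SucI[OF prod(1) Suc.IH[OF prod(2)]] by (rule ideal_pow_add)
  next
    case (sum s t)
    have "s \<in> ideal_pow R J (Suc (Suc n))" "t \<in> ideal_pow R J (Suc (Suc n))" using sum.hyps by auto
    then show ?case using sum ideal_pow_add ideal_pow_carrier deriv_add by metis
  qed
qed

lemma iter_deriv_ideal_pow: "a \<in> ideal_pow R J (n + k) \<Longrightarrow> (\<delta> ^^ k) a \<in> ideal_pow R J n"
  by (induction k arbitrary: n a) (auto simp: funpow_swap1 deriv_ideal_pow simp del: ideal_pow.simps funpow.simps simp: funpow_Suc_right)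

text \<open>A derivation lowers the J-adic order by at most one, and the factor h restores
  it.\<close>

lemma ideal_pow_stable: "a \<in> ideal_pow R J n \<Longrightarrow> h \<otimes> \<delta> a \<in> ideal_pow R J n"
proof (cases n)
  case 0
  then show "a \<in> ideal_pow R J n \<Longrightarrow> h \<otimes> \<delta> a \<in> ideal_pow R J n" by (simp add: step_closed deriv_closed)
next
  case (Suc m)
  then show "a \<in> ideal_pow R J n \<Longrightarrow> h \<otimes> \<delta> a \<in> ideal_pow R J n"
    using ideal_pow_SucI[OF step_mem deriv_ideal_pow] by blast
qed

lemma taylor_ideal_pow: "a \<in> ideal_pow R J k \<Longrightarrow> taylor n a \<in> ideal_pow R J k"
  by (rule taylor_stable[OF ideal_pow_ideal ideal_pow_stable])

text \<open>Of the K + i derivatives in the i-th term, K lower the order from n + K to n; the other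
  i are compensated by \<open>h [^] i\<close>.\<close>

lemma taylor_remainder_mem:
  assumes "a \<in> ideal_pow R J (n + K)"
  shows "horner n (\<lambda>j. coef (K + j) a) \<in> ideal_pow R J n"
proof (rule horner_mem_ideal[OF ideal_pow_ideal])
  have a: "a \<in> carrier R" using assms ideal_pow_carrier by blast
  show "coef (K + i) a \<in> carrier R" for i using a by (rule coef_closed)
  have "h [^] i \<otimes> (\<delta> ^^ (K + i)) a \<in> ideal_pow R J n" for i
    using stable_iter_deriv[OF ideal_pow_ideal ideal_pow_stable iter_deriv_ideal_pow[OF assms], of i]
    by (simp add: funpow_add add.commute[of K i])
  then show "h [^] i \<otimes> coef (K + i) a \<in> ideal_pow R J n" for i
    by (intro scaled_coef_mem ideal_pow_ideal a)
qed

lemma taylor_Suc_diff: "a \<in> carrier R \<Longrightarrow> taylor (Suc n) a \<ominus> taylor n a \<in> ideal_pow R J n"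
proof -
  assume a: "a \<in> carrier R"
  have "taylor (Suc n) a \<ominus> taylor n a = h [^] n \<otimes> coef n a"
    using step_closed coef_closed[OF a] taylor_closed[OF a, of n]
    by (simp add: taylor_def horner_Suc_right[of "\<lambda>j. coef j a", OF coef_closed[OF a]]
         add_diff_cancel del: horner.simps)
  then show ?thesis using nat_pow_mem_ideal_pow[OF step_mem] coef_closed[OF a] ideal_pow_mult by simp
qed

lemma remainder_minus:
  assumes "a \<in> carrier R" "b \<in> carrier R"
  shows "horner n (\<lambda>j. coef (K + j) (a \<ominus> b)) = horner n (\<lambda>j. coef (K + j) a) \<ominus> horner n (\<lambda>j. coef (K + j) b)"
  using assms by (intro additive_map_minus[of "\<lambda>x. horner n (\<lambda>j. coef (K + j) x)"])
    (auto intro!: horner_closed coef_closed simp: coef_add horner_add coef_closed)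

section \<open>The Taylor map on the completion and its remainder\<close>

definition completed_map :: "(nat \<Rightarrow> 'a set) \<Rightarrow> nat \<Rightarrow> 'a set" where
  "completed_map s = (\<lambda>n. ideal_pow R J n +> taylor n (SOME r. r \<in> s n))"

text \<open>\<open>taylor n\<close> preserves \<open>J^n\<close>, so the representative picked by
  \<open>SOME\<close> in \<open>completed_map\<close> is immaterial.\<close>

lemma completed_map_eq:
  assumes s: "s \<in> carrier C" and r: "r \<in> s n"
  shows "completed_map s n = ideal_pow R J n +> taylor n r"
proof -
  let ?r = "SOME r. r \<in> s n"
  have r': "?r \<in> s n" using r by (rule someI)
  note c = completion_mem(1)[OF s r] completion_mem(1)[OF s r']
  have "?r \<ominus> r \<in> ideal_pow R J n"
    by (rule coset_eq_iff[OF c(2,1), THEN iffD1])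
       (rule trans[OF completion_mem(2)[OF s r', symmetric] completion_mem(2)[OF s r]])
  then have "taylor n ?r \<ominus> taylor n r \<in> ideal_pow R J n"
    using taylor_ideal_pow taylor_minus[OF c(2,1)] by metis
  then show ?thesis unfolding completed_map_def using coset_eq_iff taylor_closed c by blast
qed

lemma taylor_mem_completed_map:
  assumes s: "s \<in> carrier C" and r: "r \<in> s n"
  shows "taylor n r \<in> completed_map s n"
  using completed_map_eq[OF assms] coset_self taylor_closed completion_mem(1)[OF assms] by simp

lemma completed_map_closed:
  assumes s: "s \<in> carrier C"
  shows "completed_map s \<in> carrier C"
proof -
  obtain r where r: "\<And>n. r n \<in> s n" using completion_ex[OF s] by metis
  have c: "r n \<in> carrier R" for n using completion_mem(1)[OF s r] .
  have "taylor (Suc n) (r (Suc n)) \<ominus> taylor n (r n) \<in> ideal_pow R J n" for n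
  proof -
    have "r (Suc n) \<in> s n" using r completion_antimono[OF s, of n "Suc n"] by auto
    then have "ideal_pow R J n +> taylor n (r (Suc n)) = ideal_pow R J n +> taylor n (r n)"
      using completed_map_eq[OF s] r by metis
    then have "taylor n (r (Suc n)) \<ominus> taylor n (r n) \<in> ideal_pow R J n"
      using coset_eq_iff taylor_closed c by blast
    \<comment> \<open>From level n to n + 1 both the number of terms and the representative change;
      the two errors are estimated separately.\<close>
    then have "(taylor (Suc n) (r (Suc n)) \<ominus> taylor n (r (Suc n))) \<oplus> (taylor n (r (Suc n)) \<ominus> taylor n (r n)) \<in> ideal_pow R J n"
      by (intro ideal_pow_add taylor_Suc_diff c)
    also have "(taylor (Suc n) (r (Suc n)) \<ominus> taylor n (r (Suc n))) \<oplus> (taylor n (r (Suc n)) \<ominus> taylor n (r n))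
       = taylor (Suc n) (r (Suc n)) \<ominus> taylor n (r n)"
      using taylor_closed[OF c] by algebra
    finally show ?thesis .
  qed
  then have "(\<lambda>n. ideal_pow R J n +> taylor n (r n)) \<in> carrier C"
    by (intro completionI taylor_closed c)
  moreover have "completed_map s = (\<lambda>n. ideal_pow R J n +> taylor n (r n))"
    using completed_map_eq[OF s r] by blast
  ultimately show ?thesis by simp
qed

lemma completed_map_hom: "completed_map \<in> ring_hom C C"
proof (rule ring_hom_memI)
  fix s t assume s: "s \<in> carrier C" and t: "t \<in> carrier C"
  interpret C: cring C by (rule completion_cring)
  show "completed_map s \<in> carrier C" using completed_map_closed[OF s] .
  have *: "completed_map (s \<otimes>\<^bsub>C\<^esub> t) n = (completed_map s \<otimes>\<^bsub>C\<^esub> completed_map t) n \<and>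
     completed_map (s \<oplus>\<^bsub>C\<^esub> t) n = (completed_map s \<oplus>\<^bsub>C\<^esub> completed_map t) n" for n
  proof -
    obtain a b where a: "a \<in> s n" and b: "b \<in> t n" using completion_ex s t by blast
    have c: "a \<in> carrier R" "b \<in> carrier R" using completion_mem(1) s t a b by blast+
    have m: "a \<otimes> b \<in> (s \<otimes>\<^bsub>C\<^esub> t) n" "a \<oplus> b \<in> (s \<oplus>\<^bsub>C\<^esub> t) n"
      using completion_mult[OF s t a b] completion_add[OF s t a b] coset_self c by auto
    have "completed_map (s \<otimes>\<^bsub>C\<^esub> t) n = ideal_pow R J n +> (taylor n a \<otimes> taylor n b)"
      using completed_map_eq[OF C.m_closed[OF s t] m(1)] taylor_mult[OF c, of n] coset_eq_iff taylor_closed c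
      by (metis m_closed)
    moreover have "completed_map (s \<oplus>\<^bsub>C\<^esub> t) n = ideal_pow R J n +> (taylor n a \<oplus> taylor n b)"
      using completed_map_eq[OF C.a_closed[OF s t] m(2)] taylor_add[OF c] by simp
    ultimately show ?thesis
      using completion_mult[OF completed_map_closed[OF s] completed_map_closed[OF t]
          taylor_mem_completed_map[OF s a] taylor_mem_completed_map[OF t b]]
        completion_add[OF completed_map_closed[OF s] completed_map_closed[OF t]
          taylor_mem_completed_map[OF s a] taylor_mem_completed_map[OF t b]] by simp
  qed
  then show "completed_map (s \<otimes>\<^bsub>C\<^esub> t) = completed_map s \<otimes>\<^bsub>C\<^esub> completed_map t" by blast
  from * show "completed_map (s \<oplus>\<^bsub>C\<^esub> t) = completed_map s \<oplus>\<^bsub>C\<^esub> completed_map t" by blast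
next
  \<comment> \<open>At level 0 the Taylor polynomial of \<one> is \<zero>, which is harmless modulo
    \<open>J^0\<close>, the whole ring.\<close>
  have "completed_map (incl \<one>) n = incl \<one> n" for n
  proof (cases n)
    case 0
    have "taylor 0 \<one> \<ominus> \<one> \<in> ideal_pow R J 0" by (simp add: taylor_closed)
    then show ?thesis using completed_map_eq[OF incl_closed, of \<one> \<one> 0] coset_self coset_eq_iff 0 taylor_closed
      by (simp add: incl_def del: ideal_pow.simps)
  next
    case (Suc m)
    have "taylor n \<one> = \<one>" using taylor_const[of m 1] const_one Suc by simp
    then show ?thesis using completed_map_eq[OF incl_closed, of \<one> \<one> n] coset_self by (simp add: incl_def)
  qed
  moreover have "\<one>\<^bsub>C\<^esub> = incl \<one>" using ring_hom_one[OF incl_hom] by simp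
  ultimately show "completed_map \<one>\<^bsub>C\<^esub> = \<one>\<^bsub>C\<^esub>" by auto
qed

lemma completed_map_incl:
  assumes "a \<in> carrier R"
  shows "completed_map (incl a) n = ideal_pow R J n +> taylor n a"
  using completed_map_eq[OF incl_closed[OF assms]] coset_self[OF assms] by (simp add: incl_def)

lemma completed_map_incl_cong:
  assumes "a \<in> carrier R" "b \<in> carrier R" "\<And>n. taylor n a \<ominus> b \<in> ideal_pow R J n"
  shows "completed_map (incl a) = incl b"
proof
  fix n show "completed_map (incl a) n = incl b n"
    unfolding completed_map_incl[OF assms(1)] unfolding incl_def using assms by (intro coset_eq_iff[THEN iffD2] taylor_closed)
qed

lemma taylor_fixed:
  assumes "a \<in> carrier R" "\<delta> a = \<zero>"
  shows "taylor n a \<ominus> a \<in> ideal_pow R J n"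
proof (cases n)
  case (Suc m)
  then show ?thesis using taylor_deriv_zero[OF assms, of m] diff_self_mem[OF assms(1), of n] by simp
qed (use assms in \<open>simp add: taylor_closed\<close>)

lemma taylor_shift:
  assumes "a \<in> J" "\<delta> a = \<one>"
  shows "taylor n a \<ominus> (a \<oplus> h) \<in> ideal_pow R J n"
proof -
  have c: "a \<in> carrier R" "h \<in> carrier R" using assms step_closed Icarr by auto
  consider "n = 0" | "n = 1" | m where "n = Suc (Suc m)" by (metis One_nat_def not0_implies_Suc)
  then show ?thesis
  proof cases
    case 1 then show ?thesis using c by (simp add: taylor_closed)
  next
    \<comment> \<open>A polynomial with one term does not yet contain the shift, but h lies in
      J.\<close>
    case 2
    have "taylor 1 a = a" using c by (simp add: taylor_def coef_0)
    moreover have "a \<ominus> (a \<oplus> h) = \<ominus> h" using c by algebra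
    ultimately show ?thesis using 2 additive_subgroup.a_inv_closed[OF ideal.axioms(1)[OF is_ideal] step_mem]
      by (simp only: ideal_pow_one)
  next
    case 3
    then show ?thesis using taylor_deriv_one[OF c(1) assms(2), of m] diff_self_mem[of "a \<oplus> h" n] c by simp
  qed
qed

lemma completed_map_fixed: "a \<in> carrier R \<Longrightarrow> \<delta> a = \<zero> \<Longrightarrow> completed_map (incl a) = incl a"
  by (intro completed_map_incl_cong taylor_fixed)

lemma completed_map_shift: "a \<in> J \<Longrightarrow> \<delta> a = \<one> \<Longrightarrow> completed_map (incl a) = incl (a \<oplus> h)"
  by (intro completed_map_incl_cong taylor_shift a_closed Icarr step_closed)

text \<open>The tail after K terms is \<open>h [^] K\<close> times a series beginning with K-fold
  derivatives. These cost K orders, so modulo \<open>J^n\<close> that series is determined by a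
  representative of level \<open>n + K\<close>. The quotient \<open>b\<close> is a single element of
  the completion that serves all levels and all representatives.\<close>

lemma completed_map_expansion:
  assumes s: "s \<in> carrier C"
  shows "\<exists>b\<in>carrier C. \<forall>n. \<forall>r\<in>s (n + K). \<exists>q\<in>b n.
           completed_map s n = ideal_pow R J n +> (taylor K r \<oplus> h [^] K \<otimes> q)"
proof -
  define rem where "rem n x = horner n (\<lambda>j. coef (K + j) x)" for n x
  have rem_closed: "rem n x \<in> carrier R" if "x \<in> carrier R" for n x
    unfolding rem_def using that by (intro horner_closed coef_closed)
  obtain r where r: "\<And>n. r n \<in> s n" using completion_ex[OF s] by metis
  have c: "r n \<in> carrier R" for n using completion_mem(1)[OF s r] .
  have close: "rem n x \<ominus> rem n y \<in> ideal_pow R J n" if "x \<in> s (n + K)" "y \<in> s (n + K)" for n x y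
  proof -
    have "x \<in> carrier R" "y \<in> carrier R" "x \<ominus> y \<in> ideal_pow R J (n + K)"
      using completion_mem[OF s that(1)] completion_mem[OF s that(2)] coset_eq_iff by metis+
    then show ?thesis using taylor_remainder_mem remainder_minus unfolding rem_def by metis
  qed
  define b where "b = (\<lambda>n. ideal_pow R J n +> rem n (r (n + K)))"
  have "b \<in> carrier C" unfolding b_def
  proof (rule completionI)
    fix n
    show "rem n (r (n + K)) \<in> carrier R" using rem_closed c .
    let ?x = "r (Suc n + K)"
    have x: "?x \<in> s (n + K)" using r completion_antimono[OF s, of "n + K" "Suc n + K"] by auto
    have "rem (Suc n) ?x \<ominus> rem n ?x = h [^] n \<otimes> coef (K + n) ?x"
      unfolding rem_def horner_Suc_right[of "\<lambda>j. coef (K + j) ?x", OF coef_closed[OF c]]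
      by (rule add_diff_cancel) (auto intro!: horner_closed coef_closed c step_closed)
    then have "rem (Suc n) ?x \<ominus> rem n ?x \<in> ideal_pow R J n"
      using nat_pow_mem_ideal_pow[OF step_mem] coef_closed[OF c] ideal_pow_mult by simp
    then have "(rem (Suc n) ?x \<ominus> rem n ?x) \<oplus> (rem n ?x \<ominus> rem n (r (n + K))) \<in> ideal_pow R J n"
      by (rule ideal_pow_add) (rule close[OF x r])
    also have "(rem (Suc n) ?x \<ominus> rem n ?x) \<oplus> (rem n ?x \<ominus> rem n (r (n + K))) = rem (Suc n) ?x \<ominus> rem n (r (n + K))"
      using rem_closed[OF c, of "Suc n"] rem_closed[OF c, of n] by algebra
    finally show "rem (Suc n) ?x \<ominus> rem n (r (n + K)) \<in> ideal_pow R J n" .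
  qed
  moreover have "\<exists>q\<in>b n. completed_map s n = ideal_pow R J n +> (taylor K x \<oplus> h [^] K \<otimes> q)"
    if x: "x \<in> s (n + K)" for n x
  proof
    have xc: "x \<in> carrier R" using completion_mem(1)[OF s x] .
    have "b n = ideal_pow R J n +> rem n x"
      unfolding b_def using close[OF r x] coset_eq_iff rem_closed c xc by blast
    then show "rem n x \<in> b n" using coset_self rem_closed xc by simp
    have "taylor (n + K) x \<in> completed_map s n"
      using completion_antimono[OF completed_map_closed[OF s], of n "n + K"] taylor_mem_completed_map[OF s x] by auto
    then have "completed_map s n = ideal_pow R J n +> taylor (K + n) x"
      using completion_mem(2)[OF completed_map_closed[OF s]] by (simp add: add.commute)
    also have "taylor (K + n) x = taylor K x \<oplus> h [^] K \<otimes> rem n x"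
      unfolding taylor_def rem_def by (rule horner_split) (rule coef_closed[OF xc])
    finally show "completed_map s n = ideal_pow R J n +> (taylor K x \<oplus> h [^] K \<otimes> rem n x)" .
  qed
  ultimately show ?thesis by blast
qed

text \<open>A Taylor polynomial with one term is the representative itself, so the leading part is
  s; the formula therefore holds on the whole completion, not only for elements
  \<open>incl a\<close>.\<close>

lemma completed_map_diff:
  assumes s: "s \<in> carrier C"
  shows "\<exists>b\<in>carrier C. completed_map s = s \<oplus>\<^bsub>C\<^esub> incl h \<otimes>\<^bsub>C\<^esub> b"
proof -
  interpret C: cring C by (rule completion_cring)
  obtain b where b: "b \<in> carrier C" "\<And>n r. r \<in> s (n + 1) \<Longrightarrow>
      \<exists>q\<in>b n. completed_map s n = ideal_pow R J n +> (taylor 1 r \<oplus> h [^] (1::nat) \<otimes> q)"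
    using completed_map_expansion[OF s, of 1] by blast
  have "completed_map s n = (s \<oplus>\<^bsub>C\<^esub> incl h \<otimes>\<^bsub>C\<^esub> b) n" for n
  proof -
    obtain r where r: "r \<in> s (n + 1)" using completion_ex[OF s] by blast
    then have rn: "r \<in> s n" using completion_antimono[OF s, of n "n + 1"] by auto
    have rc: "r \<in> carrier R" using completion_mem(1)[OF s rn] .
    obtain q where q: "q \<in> b n" "completed_map s n = ideal_pow R J n +> (taylor 1 r \<oplus> h [^] (1::nat) \<otimes> q)"
      using b(2)[OF r] by blast
    have qc: "q \<in> carrier R" using completion_mem(1)[OF b(1) q(1)] .
    have "h \<in> incl h n" using coset_self step_closed by (simp add: incl_def)
    then have "(incl h \<otimes>\<^bsub>C\<^esub> b) n = ideal_pow R J n +> (h \<otimes> q)"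
      by (intro completion_mult incl_closed step_closed b q)
    then have "h \<otimes> q \<in> (incl h \<otimes>\<^bsub>C\<^esub> b) n" using coset_self step_closed qc by simp
    then have "(s \<oplus>\<^bsub>C\<^esub> incl h \<otimes>\<^bsub>C\<^esub> b) n = ideal_pow R J n +> (r \<oplus> h \<otimes> q)"
      using s b(1) rn by (intro completion_add C.m_closed incl_closed step_closed)
    moreover have "taylor 1 r = r" using rc by (simp add: taylor_def coef_0 step_closed)
    ultimately show ?thesis using q(2) step_closed by simp
  qed
  then show ?thesis using b(1) by blast
qed

text \<open>For \<open>incl a\<close> the representative a serves at every level, so the leading
  part comes from one element of the ring, whose membership in an ideal can be tested before
  completing.\<close>

lemma completed_map_incl_expansion:
  assumes a: "a \<in> carrier R"
  shows "\<exists>b\<in>carrier C. completed_map (incl a) = incl (taylor K a) \<oplus>\<^bsub>C\<^esub> incl (h [^] K) \<otimes>\<^bsub>C\<^esub> b"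
proof -
  interpret C: cring C by (rule completion_cring)
  obtain b where b: "b \<in> carrier C" "\<And>n r. r \<in> incl a (n + K) \<Longrightarrow>
      \<exists>q\<in>b n. completed_map (incl a) n = ideal_pow R J n +> (taylor K r \<oplus> h [^] K \<otimes> q)"
    using completed_map_expansion[OF incl_closed[OF a], of K] by blast
  have mem: "x \<in> incl x n" if "x \<in> carrier R" for x n using coset_self that by (simp add: incl_def)
  have "completed_map (incl a) n = (incl (taylor K a) \<oplus>\<^bsub>C\<^esub> incl (h [^] K) \<otimes>\<^bsub>C\<^esub> b) n" for n
  proof -
    obtain q where q: "q \<in> b n" "completed_map (incl a) n = ideal_pow R J n +> (taylor K a \<oplus> h [^] K \<otimes> q)"
      using b(2)[OF mem[OF a]] by blast
    have qc: "q \<in> carrier R" using completion_mem(1)[OF b(1) q(1)] .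
    have "(incl (h [^] K) \<otimes>\<^bsub>C\<^esub> b) n = ideal_pow R J n +> (h [^] K \<otimes> q)"
      by (intro completion_mult incl_closed step_closed b q mem nat_pow_closed)
    then have "h [^] K \<otimes> q \<in> (incl (h [^] K) \<otimes>\<^bsub>C\<^esub> b) n" using coset_self step_closed qc by simp
    then have "(incl (taylor K a) \<oplus>\<^bsub>C\<^esub> incl (h [^] K) \<otimes>\<^bsub>C\<^esub> b) n = ideal_pow R J n +> (taylor K a \<oplus> h [^] K \<otimes> q)"
      using b(1) by (intro completion_add C.m_closed incl_closed step_closed nat_pow_closed taylor_closed mem a)
    then show ?thesis using q(2) by simp
  qed
  then show ?thesis using b(1) by blast
qed

end

subsection \<open>Automorphisms of the completion and ideals\<close>

lemma (in ring) hom_maps_generated_ideal: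
  assumes "f \<in> ring_hom R R" "A \<subseteq> carrier R" "\<And>a. a \<in> A \<Longrightarrow> f a \<in> Idl A" "s \<in> Idl A"
  shows "f s \<in> Idl A"
proof -
  interpret f: ring_hom_ring R R f
    using assms(1) by (simp add: ring_hom_ringI2 ring_axioms)
  have "ideal {r \<in> carrier R. f r \<in> Idl A} R"
    using f.ideal_vimage[OF genideal_ideal[OF assms(2)]] .
  then have "Idl A \<subseteq> {r \<in> carrier R. f r \<in> Idl A}"
    by (rule genideal_minimal) (use assms(2,3) in auto)
  then show ?thesis using assms(4) by auto
qed

text \<open>Stability under f yields one inclusion only; the other one writes s as
  \<open>f (g s)\<close> and uses stability under g.\<close>

lemma (in ring) automorphism_generated_ideal:
  assumes "f \<in> ring_hom R R" "g \<in> ring_hom R R" "A \<subseteq> carrier R"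
    and "\<And>s. s \<in> carrier R \<Longrightarrow> f (g s) = s"
    and "\<And>a. a \<in> A \<Longrightarrow> f a \<in> Idl A" "\<And>a. a \<in> A \<Longrightarrow> g a \<in> Idl A"
  shows "f ` (Idl A) = Idl A"
proof
  show "f ` (Idl A) \<subseteq> Idl A" using hom_maps_generated_ideal assms by blast
  show "Idl A \<subseteq> f ` (Idl A)"
  proof
    fix s assume s: "s \<in> Idl A"
    then have "s \<in> carrier R" using ideal.Icarr[OF genideal_ideal[OF assms(3)]] by blast
    then have "s = f (g s)" using assms(4) by simp
    moreover have "g s \<in> Idl A" using hom_maps_generated_ideal[OF assms(2,3)] assms(6) s by blast
    ultimately show "s \<in> f ` (Idl A)" by blast
  qed
qed

text \<open>\<open>S\<close> generates the cotangent space \<open>J / J\<^sup>2\<close> if \<open>J\<close> is contained in this set.\<close>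

inductive_set cotangent_span :: "('a, 'b) ring_scheme \<Rightarrow> 'a set \<Rightarrow> ('k \<Rightarrow> 'a) \<Rightarrow> 'a set \<Rightarrow> 'a set"
  for R (structure) and J \<kappa> S where
  square: "a \<in> ideal_pow R J 2 \<Longrightarrow> a \<in> cotangent_span R J \<kappa> S"
| step: "a \<in> cotangent_span R J \<kappa> S \<Longrightarrow> g \<in> S \<Longrightarrow> \<kappa> c \<otimes> g \<oplus> a \<in> cotangent_span R J \<kappa> S"

context adic
begin

text \<open>A multiplicative map that fixes the constants and generators of \<open>J / J\<^sup>2\<close> is the identity:
  if it is so modulo \<open>J\<^sup>k\<close>, then by multiplicativity it is so on \<open>J\<^sup>2\<close> modulo \<open>J\<^sup>k\<^sup>+\<^sup>1\<close>.\<close>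

lemma eq_identity_mod_ideal_pow:
  fixes \<kappa> :: "'k \<Rightarrow> 'a"
  assumes closed: "\<And>a. a \<in> carrier R \<Longrightarrow> \<theta> a \<in> carrier R"
    and J: "\<And>a. a \<in> J \<Longrightarrow> \<theta> a \<in> J"
    and add: "\<And>a b. a \<in> carrier R \<Longrightarrow> b \<in> carrier R \<Longrightarrow> \<theta> (a \<oplus> b) = \<theta> a \<oplus> \<theta> b"
    and mult: "\<And>a b. a \<in> carrier R \<Longrightarrow> b \<in> carrier R \<Longrightarrow> \<theta> (a \<otimes> b) \<ominus> \<theta> a \<otimes> \<theta> b \<in> ideal_pow R J n"
    and const: "\<And>c. \<kappa> c \<in> carrier R" "\<And>c. \<theta> (\<kappa> c) \<ominus> \<kappa> c \<in> ideal_pow R J n"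
    and gen: "S \<subseteq> carrier R" "\<And>g. g \<in> S \<Longrightarrow> \<theta> g \<ominus> g \<in> ideal_pow R J n"
    and residue: "\<And>a. a \<in> carrier R \<Longrightarrow> \<exists>c. a \<ominus> \<kappa> c \<in> J"
    and span: "J \<subseteq> cotangent_span R J \<kappa> S"
    and a: "a \<in> carrier R"
  shows "\<theta> a \<ominus> a \<in> ideal_pow R J n"
proof -
  have "\<forall>a\<in>carrier R. \<theta> a \<ominus> a \<in> ideal_pow R J k" if "k \<le> n" for k
    using that
  proof (induction k)
    case 0
    then show ?case using closed by simp
  next
    case (Suc k)
    have IH: "\<theta> a \<ominus> a \<in> ideal_pow R J k" if "a \<in> carrier R" for a using Suc that by simp
    have top: "a \<in> ideal_pow R J n \<Longrightarrow> a \<in> ideal_pow R J (Suc k)" for a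
      using ideal_pow_mono[OF Suc.prems] by blast
    \<comment> \<open>The error at a product is the multiplicativity defect plus
      \<open>\<theta> a \<otimes> (\<theta> b \<ominus> b)\<close> plus
      \<open>b \<otimes> (\<theta> a \<ominus> a)\<close>. For a and b in J, each of the last two
      terms has one factor in J and one in \<open>J^k\<close>, which gains an order.\<close>
    have prod_rule: "\<theta> (a \<otimes> b) \<ominus> a \<otimes> b \<in> ideal_pow R J (Suc k)"
      if c: "a \<in> carrier R" "b \<in> carrier R"
        and m: "\<theta> a \<otimes> (\<theta> b \<ominus> b) \<in> ideal_pow R J (Suc k)" "b \<otimes> (\<theta> a \<ominus> a) \<in> ideal_pow R J (Suc k)" for a b
    proof -
      have "(\<theta> (a \<otimes> b) \<ominus> \<theta> a \<otimes> \<theta> b) \<oplus> (\<theta> a \<otimes> (\<theta> b \<ominus> b) \<oplus> b \<otimes> (\<theta> a \<ominus> a)) \<in> ideal_pow R J (Suc k)"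
        by (intro ideal_pow_add top[OF mult] c m)
      moreover have "(\<theta> (a \<otimes> b) \<ominus> \<theta> a \<otimes> \<theta> b) \<oplus> (\<theta> a \<otimes> (\<theta> b \<ominus> b) \<oplus> b \<otimes> (\<theta> a \<ominus> a)) = \<theta> (a \<otimes> b) \<ominus> a \<otimes> b"
        using c closed[OF c(1)] closed[OF c(2)] closed[of "a \<otimes> b"] by simp algebra
      ultimately show ?thesis by simp
    qed
    have sum_rule: "\<theta> (a \<oplus> b) \<ominus> (a \<oplus> b) \<in> ideal_pow R J (Suc k)"
      if c: "a \<in> carrier R" "b \<in> carrier R"
        and m: "\<theta> a \<ominus> a \<in> ideal_pow R J (Suc k)" "\<theta> b \<ominus> b \<in> ideal_pow R J (Suc k)" for a b
    proof -
      have "(\<theta> a \<ominus> a) \<oplus> (\<theta> b \<ominus> b) = \<theta> (a \<oplus> b) \<ominus> (a \<oplus> b)"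
        unfolding add[OF c] using c closed[OF c(1)] closed[OF c(2)] by algebra
      then show ?thesis using ideal_pow_add[OF m] by simp
    qed
    have square_case: "a \<in> carrier R \<and> \<theta> a \<ominus> a \<in> ideal_pow R J (Suc k)" if "a \<in> ideal_pow R J 2" for a
    proof -
      have "a \<in> ideal_prod R J J" using that ideal_prod_one[OF is_ideal] by (simp add: numeral_2_eq_2)
      then show ?thesis
      proof (induction rule: ideal_prod.induct)
        case (prod i j)
        then have c: "i \<in> carrier R" "j \<in> carrier R" using Icarr by auto
        show ?case using c prod_rule[OF c ideal_pow_SucI[OF J[OF prod(1)] IH[OF c(2)]] ideal_pow_SucI[OF prod(2) IH[OF c(1)]]]
          by simp
      next
        case (sum s t)
        then show ?case using sum_rule by simp
      qed
    qed
    have J_case: "a \<in> carrier R \<and> \<theta> a \<ominus> a \<in> ideal_pow R J (Suc k)" if "a \<in> cotangent_span R J \<kappa> S" for a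
      using that
    proof (induction rule: cotangent_span.induct)
      case (square a)
      then show ?case by (rule square_case)
    next
      case (step a g c)
      have g: "g \<in> carrier R" using gen(1) step by blast
      \<comment> \<open>Constants and generators are fixed modulo \<open>J^n\<close> from the start,
        so here no factor in J is required.\<close>
      have "\<theta> (\<kappa> c \<otimes> g) \<ominus> \<kappa> c \<otimes> g \<in> ideal_pow R J (Suc k)"
        by (rule prod_rule) (use step g const gen closed top ideal_pow_mult_left in auto)
      then show ?case using sum_rule[of "\<kappa> c \<otimes> g" a] step g const by simp
    qed
    show ?case
    proof
      fix a assume a: "a \<in> carrier R"
      obtain c where c: "a \<ominus> \<kappa> c \<in> J" using residue[OF a] by blast
      have "(a \<ominus> \<kappa> c) \<oplus> \<kappa> c = a" using a const(1)[of c] by algebra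
      then show "\<theta> a \<ominus> a \<in> ideal_pow R J (Suc k)"
        using sum_rule[of "a \<ominus> \<kappa> c" "\<kappa> c"] J_case[of "a \<ominus> \<kappa> c"] c span const top by auto
    qed
  qed
  then show ?thesis using a by blast
qed

text \<open>At level n the composite is given by two Taylor polynomials with n terms each. It is
  additive, and multiplicative modulo \<open>J^n\<close>, so
  \<open>eq_identity_mod_ideal_pow\<close> applies at each level and only the elements of S have to
  be checked.\<close>

lemma completed_map_inverse:
  fixes \<kappa> :: "'k::field_char_0 \<Rightarrow> 'a"
  assumes "taylor_data J R \<kappa> \<delta> h" "taylor_data J R \<kappa> \<delta>' h'"
    and gen: "S \<subseteq> carrier R"
      "\<And>g n. g \<in> S \<Longrightarrow> taylor_data.taylor R \<kappa> \<delta>' h' n (taylor_data.taylor R \<kappa> \<delta> h n g) \<ominus> g \<in> ideal_pow R J n"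
    and residue: "\<And>a. a \<in> carrier R \<Longrightarrow> \<exists>c. a \<ominus> \<kappa> c \<in> J"
    and span: "J \<subseteq> cotangent_span R J \<kappa> S"
    and s: "s \<in> carrier C"
  shows "taylor_data.completed_map J R \<kappa> \<delta>' h' (taylor_data.completed_map J R \<kappa> \<delta> h s) = s"
proof
  interpret A: taylor_data J R \<kappa> \<delta> h by fact
  interpret B: taylor_data J R \<kappa> \<delta>' h' by fact
  fix n
  obtain r where r: "r \<in> s n" using completion_ex[OF s] by blast
  have rc: "r \<in> carrier R" using completion_mem(1)[OF s r] .
  define \<theta> where "\<theta> a = B.taylor n (A.taylor n a)" for a
  have "\<theta> r \<ominus> r \<in> ideal_pow R J n"
  proof (rule eq_identity_mod_ideal_pow[where S = S and \<kappa> = \<kappa>])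
    show closed: "\<theta> a \<in> carrier R" if "a \<in> carrier R" for a
      unfolding \<theta>_def using that by (intro A.taylor_closed B.taylor_closed)
    show "\<theta> a \<in> J" if "a \<in> J" for a
      using that A.taylor_ideal_pow[of _ 1] B.taylor_ideal_pow[of _ 1] unfolding \<theta>_def by (simp only: ideal_pow_one)
    show "\<theta> (a \<oplus> b) = \<theta> a \<oplus> \<theta> b" if "a \<in> carrier R" "b \<in> carrier R" for a b
      unfolding \<theta>_def using that by (simp add: A.taylor_add B.taylor_add A.taylor_closed)
    show "\<theta> (a \<otimes> b) \<ominus> \<theta> a \<otimes> \<theta> b \<in> ideal_pow R J n" if ab: "a \<in> carrier R" "b \<in> carrier R" for a b
    proof -
      define x y where "x = A.taylor n a" and "y = A.taylor n b"
      have xy: "x \<in> carrier R" "y \<in> carrier R" unfolding x_def y_def using ab by (intro A.taylor_closed; simp)+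
      have c: "A.taylor n (a \<otimes> b) \<in> carrier R" "x \<otimes> y \<in> carrier R" using ab xy by (auto intro: A.taylor_closed)
      have "x \<otimes> y \<ominus> A.taylor n (a \<otimes> b) \<in> ideal_pow R J n"
        unfolding x_def y_def by (rule A.taylor_mult[OF ab])
      then have "B.taylor n (x \<otimes> y) \<ominus> \<theta> (a \<otimes> b) \<in> ideal_pow R J n"
        unfolding \<theta>_def using B.taylor_ideal_pow B.taylor_minus[OF c(2,1)] by metis
      moreover have "\<theta> a \<otimes> \<theta> b \<ominus> B.taylor n (x \<otimes> y) \<in> ideal_pow R J n"
        unfolding \<theta>_def x_def[symmetric] y_def[symmetric] by (rule B.taylor_mult[OF xy])
      ultimately have "\<ominus> ((B.taylor n (x \<otimes> y) \<ominus> \<theta> (a \<otimes> b)) \<oplus> (\<theta> a \<otimes> \<theta> b \<ominus> B.taylor n (x \<otimes> y))) \<in> ideal_pow R J n"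
        by (meson additive_subgroup.a_inv_closed ideal.axioms(1) ideal_pow_add ideal_pow_ideal)
      moreover have "\<ominus> ((B.taylor n (x \<otimes> y) \<ominus> \<theta> (a \<otimes> b)) \<oplus> (\<theta> a \<otimes> \<theta> b \<ominus> B.taylor n (x \<otimes> y)))
          = \<theta> (a \<otimes> b) \<ominus> \<theta> a \<otimes> \<theta> b"
        using B.taylor_closed[OF c(2), of n] closed[OF m_closed[OF ab]] closed[OF ab(1)] closed[OF ab(2)] by algebra
      ultimately show ?thesis by simp
    qed
    show "\<theta> (\<kappa> c) \<ominus> \<kappa> c \<in> ideal_pow R J n" for c
    proof (cases n)
      case 0 then show ?thesis using closed A.const_closed by simp
    next
      case (Suc m)
      then have "\<theta> (\<kappa> c) = \<kappa> c" unfolding \<theta>_def by (simp only: A.taylor_const B.taylor_const)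
      then show ?thesis by (simp only: A.diff_self_mem A.const_closed)
    qed
    show "\<theta> g \<ominus> g \<in> ideal_pow R J n" if "g \<in> S" for g unfolding \<theta>_def by (rule gen(2)[OF that])
  qed (use A.const_closed gen(1) residue span rc in auto)
  then have "ideal_pow R J n +> \<theta> r = ideal_pow R J n +> r"
    using coset_eq_iff rc A.taylor_closed B.taylor_closed \<theta>_def by simp
  then show "B.completed_map (A.completed_map s) n = s n"
    using B.completed_map_eq[OF A.completed_map_closed[OF s] A.taylor_mem_completed_map[OF s r]]
      completion_mem(2)[OF s r] by (simp add: \<theta>_def)
qed

end

context taylor_data
begin

lemma completed_map_stable_ideal:
  assumes I: "ideal I R" and stable: "\<And>a. a \<in> I \<Longrightarrow> h \<otimes> \<delta> a \<in> I"
    and pow: "h [^] (K::nat) \<in> I" and a: "a \<in> I"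
  shows "completed_map (incl a) \<in> Idl\<^bsub>C\<^esub> (incl ` I)"
proof -
  interpret C: cring C by (rule completion_cring)
  have sub: "incl ` I \<subseteq> carrier C" using incl_closed ideal.Icarr[OF I] by auto
  note gen = C.genideal_ideal[OF sub]
  note self = C.genideal_self[OF sub]
  obtain b where b: "b \<in> carrier C" "completed_map (incl a) = incl (taylor K a) \<oplus>\<^bsub>C\<^esub> incl (h [^] K) \<otimes>\<^bsub>C\<^esub> b"
    using completed_map_incl_expansion[OF ideal.Icarr[OF I a]] by blast
  show ?thesis unfolding b(2)
    using self taylor_stable[OF I stable a] pow ideal.I_r_closed[OF gen _ b(1)]
    by (intro additive_subgroup.a_closed[OF ideal.axioms(1)[OF gen]]) auto
qed

text \<open>The abstract form of the homogenized ideal: \<open>I i\<close> plays the role of \<open>\<D>\<^sup>i(\<I>)\<close>.\<close>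

lemma homogenized_stable:
  fixes I :: "nat \<Rightarrow> 'a set" and N :: nat
  defines "T \<equiv> I N"
  defines "H \<equiv> Idl (\<Union>i\<in>{..N}. ideal_prod R (I i) (ideal_pow R T i))"
  assumes I: "\<And>i. ideal (I i) R" and deriv: "\<And>i a. a \<in> I i \<Longrightarrow> \<delta> a \<in> I (Suc i)"
    and h: "h \<in> T"
  shows "ideal H R" "a \<in> H \<Longrightarrow> h \<otimes> \<delta> a \<in> H" "h [^] Suc N \<in> H"
proof -
  \<comment> \<open>The locale is reused with T in place of J, for its facts on powers of an
    ideal.\<close>
  interpret T: adic T R using I is_cring unfolding T_def adic_def by blast
  have gens: "(\<Union>i\<in>{..N}. ideal_prod R (I i) (ideal_pow R T i)) \<subseteq> carrier R"
    using ideal_prod_in_carrier[OF I T.ideal_pow_ideal] by blast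
  show H: "ideal H R" unfolding H_def by (rule genideal_ideal[OF gens])
  have mem: "x \<otimes> y \<in> H" if "i \<le> N" "x \<in> I i" "y \<in> ideal_pow R T i" for i x y
    using genideal_self[OF gens] ideal_prod.prod[OF that(2,3)] that(1) unfolding H_def by blast
  have add: "x \<oplus> y \<in> H" if "x \<in> H" "y \<in> H" for x y
    using that additive_subgroup.a_closed[OF ideal.axioms(1)[OF H]] by blast
  \<comment> \<open>\<open>h \<otimes> \<delta> t\<close> is in T because h is, whatever
    \<open>\<delta> t\<close> may be; hence no power of T is lost.\<close>
  have T_pow: "h \<otimes> \<delta> x \<in> ideal_pow R T i" if "x \<in> ideal_pow R T i" for i x
    using that
  proof (induction i arbitrary: x)
    case 0
    then show ?case using step_closed deriv_closed by simp
  next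
    case (Suc i)
    have "x \<in> ideal_prod R T (ideal_pow R T i)" using Suc.prems by simp
    then show ?case
    proof (induction rule: ideal_prod.induct)
      case (prod t y)
      have c: "t \<in> carrier R" "y \<in> carrier R" using prod T.Icarr T.ideal_pow_carrier by blast+
      have "(h \<otimes> \<delta> t) \<otimes> y \<oplus> t \<otimes> (h \<otimes> \<delta> y) \<in> ideal_pow R T (Suc i)"
        using T.I_r_closed[OF h deriv_closed[OF c(1)]] Suc.IH[OF prod(2)] prod
        by (intro T.ideal_pow_add T.ideal_pow_SucI)
      moreover have "(h \<otimes> \<delta> t) \<otimes> y \<oplus> t \<otimes> (h \<otimes> \<delta> y) = h \<otimes> \<delta> (t \<otimes> y)"
        unfolding deriv_mult[OF c] using c step_closed deriv_closed[OF c(1)] deriv_closed[OF c(2)] by algebra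
      ultimately show ?case by simp
    next
      case (sum s t)
      have c: "s \<in> carrier R" "t \<in> carrier R"
        using sum ideal_prod_in_carrier[OF T.is_ideal T.ideal_pow_ideal] by blast+
      then show ?case using sum T.ideal_pow_add step_closed deriv_closed by (simp add: deriv_add r_distr del: ideal_pow.simps)
    qed
  qed
  have gen: "h \<otimes> \<delta> x \<in> H" if "i \<le> N" "x \<in> ideal_prod R (I i) (ideal_pow R T i)" for i x
    using that(2)
  proof (induction rule: ideal_prod.induct)
    case (prod a b)
    have c: "a \<in> carrier R" "b \<in> carrier R" using prod ideal.Icarr[OF I] T.ideal_pow_carrier by blast+
    \<comment> \<open>Absorbing h into b raises the exponent of T, which matches the move of
      \<open>\<delta> a\<close> from \<open>I i\<close> to \<open>I (Suc i)\<close>.\<close>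
    have hb: "h \<otimes> b \<in> ideal_pow R T (Suc i)" using T.ideal_pow_SucI[OF h prod(2)] .
    have "\<delta> a \<otimes> (h \<otimes> b) \<in> H"
    proof (cases "i = N")
      case False
      then show ?thesis using mem[OF _ deriv[OF prod(1)] hb] that(1) by simp
    next
      case True
      \<comment> \<open>There is no summand of index N + 1, but h is itself an element of
        \<open>I N\<close>, so \<open>h \<otimes> b\<close> already lies in the last
        summand.\<close>
      have "h \<otimes> b \<in> H" using mem[of N h b] h prod(2) True unfolding T_def by simp
      then show ?thesis using ideal.I_l_closed[OF H _ deriv_closed[OF c(1)]] by simp
    qed
    then have "\<delta> a \<otimes> (h \<otimes> b) \<oplus> a \<otimes> (h \<otimes> \<delta> b) \<in> H"
      by (intro add mem[OF that(1) prod(1)] T_pow prod)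
    moreover have "\<delta> a \<otimes> (h \<otimes> b) \<oplus> a \<otimes> (h \<otimes> \<delta> b) = h \<otimes> \<delta> (a \<otimes> b)"
      unfolding deriv_mult[OF c] using c step_closed deriv_closed[OF c(1)] deriv_closed[OF c(2)] by algebra
    ultimately show ?case by simp
  next
    case (sum s t)
    have c: "s \<in> carrier R" "t \<in> carrier R"
      using sum ideal_prod_in_carrier[OF I T.ideal_pow_ideal] by blast+
    then show ?case using sum add step_closed deriv_closed by (simp add: deriv_add r_distr)
  qed
  \<comment> \<open>By the product rule these elements form an ideal, so stability has to be known
    on generators only.\<close>
  have "ideal {x \<in> H. h \<otimes> \<delta> x \<in> H} R"
  proof (rule idealI)
    show "subgroup {x \<in> H. h \<otimes> \<delta> x \<in> H} (add_monoid R)"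
    proof (rule add.subgroupI)
      show "{x \<in> H. h \<otimes> \<delta> x \<in> H} \<subseteq> carrier R" using ideal.Icarr[OF H] by blast
      have "\<zero> \<in> {x \<in> H. h \<otimes> \<delta> x \<in> H}"
        using additive_subgroup.zero_closed[OF ideal.axioms(1)[OF H]] deriv_zero step_closed by simp
      then show "{x \<in> H. h \<otimes> \<delta> x \<in> H} \<noteq> {}" by blast
    next
      fix x assume x: "x \<in> {x \<in> H. h \<otimes> \<delta> x \<in> H}"
      have xc: "x \<in> carrier R" using x ideal.Icarr[OF H] by blast
      have "\<delta> (\<ominus> x) = \<ominus> \<delta> x" using deriv_minus[of \<zero> x] xc deriv_closed[OF xc] deriv_zero by (simp add: minus_eq)
      then have "h \<otimes> \<delta> (\<ominus> x) = \<ominus> (h \<otimes> \<delta> x)" using step_closed deriv_closed[OF xc] by (simp add: r_minus)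
      then show "\<ominus> x \<in> {x \<in> H. h \<otimes> \<delta> x \<in> H}"
        using x additive_subgroup.a_inv_closed[OF ideal.axioms(1)[OF H]] by simp
    next
      fix x y assume xy: "x \<in> {x \<in> H. h \<otimes> \<delta> x \<in> H}" "y \<in> {x \<in> H. h \<otimes> \<delta> x \<in> H}"
      then have "x \<in> carrier R" "y \<in> carrier R" using ideal.Icarr[OF H] by blast+
      then show "x \<oplus> y \<in> {x \<in> H. h \<otimes> \<delta> x \<in> H}"
        using xy add step_closed deriv_closed by (simp add: deriv_add r_distr)
    qed
  next
    fix x y assume x: "x \<in> {x \<in> H. h \<otimes> \<delta> x \<in> H}" and y: "y \<in> carrier R"
    have xc: "x \<in> carrier R" using x ideal.Icarr[OF H] by blast
    have "x \<otimes> (h \<otimes> \<delta> y) \<oplus> (h \<otimes> \<delta> x) \<otimes> y \<in> H"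
      using x y deriv_closed step_closed ideal.I_r_closed[OF H] by (intro add) auto
    moreover have "x \<otimes> (h \<otimes> \<delta> y) \<oplus> (h \<otimes> \<delta> x) \<otimes> y = h \<otimes> \<delta> (x \<otimes> y)"
      unfolding deriv_mult[OF xc y] using xc y step_closed deriv_closed[OF xc] deriv_closed[OF y] by algebra
    ultimately show "x \<otimes> y \<in> {x \<in> H. h \<otimes> \<delta> x \<in> H}" using x y ideal.I_r_closed[OF H] by simp
    then show "y \<otimes> x \<in> {x \<in> H. h \<otimes> \<delta> x \<in> H}" using xc y by (simp add: m_comm)
  qed (rule ring_axioms)
  then have "H \<subseteq> {x \<in> H. h \<otimes> \<delta> x \<in> H}"
    unfolding H_def by (rule genideal_minimal) (use gen genideal_self[OF gens] in \<open>auto simp: H_def\<close>)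
  then show "a \<in> H \<Longrightarrow> h \<otimes> \<delta> a \<in> H" by blast
  have "h \<otimes> h [^] N \<in> H" using mem[of N h "h [^] N"] h T.nat_pow_mem_ideal_pow[OF h] unfolding T_def by simp
  then show "h [^] Suc N \<in> H" using step_closed by (simp add: m_comm)
qed

end

subsection \<open>Local rings in terms of functions\<close>

locale pointed_space =
  fixes X :: "('p, 'k::field) fun_space" and x :: 'p
  assumes sheaf: "sheaf_of_functions X" and point: "x \<in> topspace (topol X)"
begin

abbreviation near :: "'p filter" where "near \<equiv> nhdsin (topol X) x"
abbreviation F :: "('p \<Rightarrow> 'k) set" where "F \<equiv> carrier (functions_near X x)"
abbreviation L where "L \<equiv> local_ring X x"
abbreviation \<mm> where "\<mm> \<equiv> max_ideal X x"

lemma eventually_near: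
  "eventually P near \<longleftrightarrow> (\<exists>U. openin (topol X) U \<and> x \<in> U \<and> (\<forall>z\<in>U. P z))"
  using point by (simp add: eventually_nhdsin)

lemma near_at_point: "eventually P near \<Longrightarrow> P x"
  by (auto simp: eventually_near)

lemma F_iff: "f \<in> F \<longleftrightarrow> (\<exists>U. openin (topol X) U \<and> x \<in> U \<and> f \<in> reg X U)"
  by (simp add: functions_near_def)

lemma F_I: "openin (topol X) U \<Longrightarrow> x \<in> U \<Longrightarrow> f \<in> reg X U \<Longrightarrow> f \<in> F"
  by (auto simp: F_iff)

lemma reg_restrict: "f \<in> reg X U \<Longrightarrow> openin (topol X) U \<Longrightarrow> openin (topol X) V \<Longrightarrow> V \<subseteq> U \<Longrightarrow> f \<in> reg X V"
  using sheaf unfolding sheaf_of_functions_def by blast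

lemma reg_cong:
  assumes "openin (topol X) U" "f \<in> reg X U" "\<And>z. z \<in> U \<Longrightarrow> g z = f z"
  shows "g \<in> reg X U"
proof -
  have "\<forall>y\<in>U. \<exists>V f. openin (topol X) V \<and> y \<in> V \<and> V \<subseteq> U \<and> f \<in> reg X V \<and> (\<forall>z\<in>V. g z = f z)"
    using assms by blast
  then show ?thesis using sheaf assms(1) unfolding sheaf_of_functions_def by blast
qed

lemma F_cong:
  assumes "f \<in> F" "eventually (\<lambda>z. g z = f z) near"
  shows "g \<in> F"
proof -
  obtain U V where U: "openin (topol X) U" "x \<in> U" "f \<in> reg X U"
    and V: "openin (topol X) V" "x \<in> V" "\<forall>z\<in>V. g z = f z"
    using assms unfolding F_iff eventually_near by blast
  have UV: "openin (topol X) (U \<inter> V)" using U V by (simp add: openin_Int)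
  have "g \<in> reg X (U \<inter> V)"
    by (rule reg_cong[OF UV reg_restrict[OF U(3,1) UV]]) (use V in auto)
  then show ?thesis using U(2) V(2) by (simp add: F_I[OF UV])
qed

lemma F_const: "(\<lambda>_. c) \<in> F"
proof -
  have "(\<lambda>_. c) \<in> reg X (topspace (topol X))"
    using sheaf by (simp add: sheaf_of_functions_def)
  then show ?thesis unfolding F_iff using point by (intro exI[of _ "topspace (topol X)"]) simp
qed

lemma F_add_mult:
  assumes "f \<in> F" "g \<in> F"
  shows "(\<lambda>z. f z + g z) \<in> F" "(\<lambda>z. f z * g z) \<in> F"
proof -
  obtain U V where U: "openin (topol X) U" "x \<in> U" "f \<in> reg X U"
    and V: "openin (topol X) V" "x \<in> V" "g \<in> reg X V"
    using assms unfolding F_iff by blast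
  have UV: "openin (topol X) (U \<inter> V)" using U V by (simp add: openin_Int)
  have "f \<in> reg X (U \<inter> V)" "g \<in> reg X (U \<inter> V)"
    using reg_restrict[OF U(3,1) UV] reg_restrict[OF V(3,1) UV] by auto
  then have "(\<lambda>z. f z + g z) \<in> reg X (U \<inter> V)" "(\<lambda>z. f z * g z) \<in> reg X (U \<inter> V)"
    using sheaf[unfolded sheaf_of_functions_def, THEN spec, THEN mp, OF UV, THEN conjunct2, THEN conjunct1]
    by blast+
  then show "(\<lambda>z. f z + g z) \<in> F" "(\<lambda>z. f z * g z) \<in> F"
    using U(2) V(2) by (simp_all add: F_I[OF UV])
qed

lemmas F_add = F_add_mult(1) and F_mult = F_add_mult(2)

lemma F_uminus: "f \<in> F \<Longrightarrow> (\<lambda>z. - f z) \<in> F"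
  using F_mult[OF F_const[of "-1"], of f] by simp

lemma F_diff: "f \<in> F \<Longrightarrow> g \<in> F \<Longrightarrow> (\<lambda>z. f z - g z) \<in> F"
  using F_add[OF _ F_uminus, of f g] by simp

lemma F_sum: "(\<And>i. i \<in> A \<Longrightarrow> f i \<in> F) \<Longrightarrow> (\<lambda>z. \<Sum>i\<in>A. f i z) \<in> F"
proof (induction A rule: infinite_finite_induct)
  case (insert i A)
  then show ?case using F_add[of "f i" "\<lambda>z. \<Sum>i\<in>A. f i z"] by simp
qed (auto intro: F_const)

lemma zero_near_iff: "f \<in> zero_near X x \<longleftrightarrow> eventually (\<lambda>z. f z = 0) near"
  by (simp add: zero_near_def eventually_near)

lemma functions_near_cring: "cring (functions_near X x)"
proof (rule cringI)
  show "abelian_group (functions_near X x)"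
  proof (rule abelian_groupI)
    fix f assume "f \<in> F"
    then show "\<exists>g\<in>F. g \<oplus>\<^bsub>functions_near X x\<^esub> f = \<zero>\<^bsub>functions_near X x\<^esub>"
      using F_uminus[of f] by (intro bexI[of _ "\<lambda>z. - f z"]) (auto simp: functions_near_def)
  qed (use F_add F_const in \<open>auto simp: functions_near_def add_ac\<close>)
  show "comm_monoid (functions_near X x)"
    by (rule comm_monoidI) (use F_mult F_const in \<open>auto simp: functions_near_def mult_ac\<close>)
qed (auto simp: functions_near_def algebra_simps)

lemma zero_near_ideal: "ideal (zero_near X x) (functions_near X x)"
proof -
  interpret N: cring "functions_near X x" by (rule functions_near_cring)
  have sub: "zero_near X x \<subseteq> F"
    using F_cong[OF F_const[of 0]] by (auto simp: zero_near_iff)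
  show ?thesis
  proof (rule idealI[OF N.ring_axioms])
    show "subgroup (zero_near X x) (add_monoid (functions_near X x))"
    proof (rule N.add.subgroupI)
      show "zero_near X x \<noteq> {}" using zero_near_iff[of "\<lambda>_. 0"] by auto
      fix f g assume "f \<in> zero_near X x" "g \<in> zero_near X x"
      then show "f \<oplus>\<^bsub>functions_near X x\<^esub> g \<in> zero_near X x"
        unfolding zero_near_iff by eventually_elim (simp add: functions_near_def)
    next
      fix f assume f: "f \<in> zero_near X x"
      have "\<ominus>\<^bsub>functions_near X x\<^esub> f = (\<lambda>z. - f z)"
        by (rule N.minus_equality) (use f sub F_uminus in \<open>auto simp: functions_near_def\<close>)
      then show "\<ominus>\<^bsub>functions_near X x\<^esub> f \<in> zero_near X x" using f by (simp add: zero_near_iff)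
    qed (use sub in auto)
  qed (auto simp: zero_near_iff functions_near_def elim!: eventually_mono)
qed

sublocale L: cring L
  unfolding local_ring_def by (rule ideal.quotient_is_cring[OF zero_near_ideal functions_near_cring])

lemma germ_hom: "germ X x \<in> ring_hom (functions_near X x) L"
  using ideal.rcos_ring_hom[OF zero_near_ideal] by (simp add: germ_def[abs_def] local_ring_def)

lemma germ_closed: "f \<in> F \<Longrightarrow> germ X x f \<in> carrier L"
  using ring_hom_closed[OF germ_hom] .

lemma germ_add: "f \<in> F \<Longrightarrow> g \<in> F \<Longrightarrow> germ X x f \<oplus>\<^bsub>L\<^esub> germ X x g = germ X x (\<lambda>z. f z + g z)"
  using ring_hom_add[OF germ_hom, of f g] by (simp add: functions_near_def)

lemma germ_mult: "f \<in> F \<Longrightarrow> g \<in> F \<Longrightarrow> germ X x f \<otimes>\<^bsub>L\<^esub> germ X x g = germ X x (\<lambda>z. f z * g z)"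
  using ring_hom_mult[OF germ_hom, of f g] by (simp add: functions_near_def)

lemma germ_one: "\<one>\<^bsub>L\<^esub> = germ X x (\<lambda>_. 1)"
  using ring_hom_one[OF germ_hom] by (simp add: functions_near_def)

lemma germ_zero: "\<zero>\<^bsub>L\<^esub> = germ X x (\<lambda>_. 0)"
  using ring_hom_zero[OF germ_hom cring.axioms(1)[OF functions_near_cring] L.ring_axioms]
  by (simp add: functions_near_def)

lemma germ_uminus:
  assumes "f \<in> F" shows "\<ominus>\<^bsub>L\<^esub> germ X x f = germ X x (\<lambda>z. - f z)"
  by (rule L.minus_equality)
    (use germ_add[OF F_uminus[OF assms] assms] germ_closed assms F_uminus in \<open>auto simp: germ_zero\<close>)

lemma germ_diff: "f \<in> F \<Longrightarrow> g \<in> F \<Longrightarrow> germ X x f \<ominus>\<^bsub>L\<^esub> germ X x g = germ X x (\<lambda>z. f z - g z)"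
  using germ_add[of f "\<lambda>z. - g z"] by (simp add: a_minus_def germ_uminus F_uminus)

lemma germ_sum:
  "(\<And>i. i < n \<Longrightarrow> f i \<in> F) \<Longrightarrow> (\<Oplus>\<^bsub>L\<^esub>i\<in>{..<n::nat}. germ X x (f i)) = germ X x (\<lambda>z. \<Sum>i<n. f i z)"
proof (induction n)
  case 0
  then show ?case by (simp add: germ_zero)
next
  case (Suc n)
  then have "(\<Oplus>\<^bsub>L\<^esub>i\<in>insert n {..<n}. germ X x (f i)) = germ X x (f n) \<oplus>\<^bsub>L\<^esub> germ X x (\<lambda>z. \<Sum>i<n. f i z)"
    by (subst L.finsum_insert) (auto intro: germ_closed)
  moreover have "(\<lambda>z. \<Sum>i<n. f i z) \<in> F" using Suc.prems by (intro F_sum) simp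
  ultimately show ?case using germ_add[of "f n" "\<lambda>z. \<Sum>i<n. f i z"] Suc.prems by (simp add: lessThan_Suc)
qed

text \<open>This turns identities between germs into pointwise identities near x, which are then
  settled by field arithmetic.\<close>

lemma germ_eq_iff:
  assumes "f \<in> F" "g \<in> F" shows "germ X x f = germ X x g \<longleftrightarrow> eventually (\<lambda>z. f z = g z) near"
proof -
  interpret N: cring "functions_near X x" by (rule functions_near_cring)
  have "\<ominus>\<^bsub>functions_near X x\<^esub> g = (\<lambda>z. - g z)"
    by (rule N.minus_equality) (use assms F_uminus in \<open>auto simp: functions_near_def\<close>)
  then have "f \<ominus>\<^bsub>functions_near X x\<^esub> g = (\<lambda>z. f z - g z)" by (simp add: a_minus_def) (simp add: functions_near_def)
  then show ?thesis
    using N.quotient_eq_iff_same_a_r_cos[OF zero_near_ideal assms] by (simp add: germ_def zero_near_iff)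
qed

lemma local_ring_cases:
  assumes "a \<in> carrier L" obtains f where "f \<in> F" "a = germ X x f"
  using assms unfolding local_ring_def germ_def by (auto simp: FactRing_def A_RCOSETS_def')

lemma germ_mem_max_ideal:
  assumes "f \<in> F" shows "germ X x f \<in> \<mm> \<longleftrightarrow> f x = 0"
proof
  assume "germ X x f \<in> \<mm>"
  then obtain g where g: "g \<in> F" "g x = 0" "germ X x f = germ X x g" by (auto simp: max_ideal_def)
  then show "f x = 0" using near_at_point germ_eq_iff[OF assms g(1)] by fastforce
qed (use assms in \<open>auto simp: max_ideal_def\<close>)

lemma max_ideal_ideal: "ideal \<mm> L"
proof (rule idealI[OF L.ring_axioms])
  have sub: "\<mm> \<subseteq> carrier L" by (auto simp: max_ideal_def germ_closed)
  show "subgroup \<mm> (add_monoid L)"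
  proof (rule L.add.subgroupI[OF sub])
    show "\<mm> \<noteq> {}" using F_const[of 0] by (auto simp: max_ideal_def)
    fix a assume a: "a \<in> \<mm>"
    then obtain f where f: "f \<in> F" "a = germ X x f" "f x = 0" by (auto simp: max_ideal_def)
    then show "\<ominus>\<^bsub>L\<^esub> a \<in> \<mm>" by (simp add: germ_uminus germ_mem_max_ideal F_uminus)
    fix b assume "b \<in> \<mm>"
    then obtain g where "g \<in> F" "b = germ X x g" "g x = 0" by (auto simp: max_ideal_def)
    then show "a \<oplus>\<^bsub>L\<^esub> b \<in> \<mm>" using f by (simp add: germ_add germ_mem_max_ideal F_add)
  qed
  fix a b assume a: "a \<in> \<mm>" and b: "b \<in> carrier L"
  obtain f where f: "f \<in> F" "a = germ X x f" "f x = 0" using a by (auto simp: max_ideal_def)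
  obtain g where g: "g \<in> F" "b = germ X x g" using b by (rule local_ring_cases)
  from f g show "a \<otimes>\<^bsub>L\<^esub> b \<in> \<mm>" "b \<otimes>\<^bsub>L\<^esub> a \<in> \<mm>" by (auto simp: germ_mult germ_mem_max_ideal F_mult)
qed

sublocale m: adic \<mm> L
  using max_ideal_ideal L.cring_axioms by (simp add: adic_def)

lemma const_germ_residue:
  assumes "a \<in> carrier L" shows "\<exists>c. a \<ominus>\<^bsub>L\<^esub> const_germ X x c \<in> \<mm>"
proof -
  obtain f where f: "f \<in> F" "a = germ X x f" using assms by (rule local_ring_cases)
  then have "a \<ominus>\<^bsub>L\<^esub> const_germ X x (f x) \<in> \<mm>"
    by (simp add: germ_diff F_const germ_mem_max_ideal F_diff)
  then show ?thesis by blast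
qed

section \<open>The cotangent space: functions modulo the square of the maximal ideal\<close>

definition M2 :: "('p \<Rightarrow> 'k) set" where
  "M2 = {f \<in> F. germ X x f \<in> ideal_pow L \<mm> 2}"

lemma M2_cong: "f \<in> M2 \<Longrightarrow> eventually (\<lambda>z. g z = f z) near \<Longrightarrow> g \<in> M2"
  using F_cong germ_eq_iff by (metis (mono_tags, lifting) M2_def mem_Collect_eq)

lemma M2_add: "f \<in> M2 \<Longrightarrow> g \<in> M2 \<Longrightarrow> (\<lambda>z. f z + g z) \<in> M2"
  unfolding M2_def using m.ideal_pow_add by (auto simp: F_add simp flip: germ_add)

lemma M2_mult: "f \<in> M2 \<Longrightarrow> g \<in> F \<Longrightarrow> (\<lambda>z. f z * g z) \<in> M2"
  unfolding M2_def using m.ideal_pow_mult germ_closed by (auto simp: F_mult simp flip: germ_mult)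

lemma M2_scale: "f \<in> M2 \<Longrightarrow> (\<lambda>z. c * f z) \<in> M2"
  using M2_mult[OF _ F_const[of c], of f] by (simp add: mult.commute)

lemma M2_diff: "f \<in> M2 \<Longrightarrow> g \<in> M2 \<Longrightarrow> (\<lambda>z. f z - g z) \<in> M2"
  using M2_add[OF _ M2_scale[of g "-1"], of f] by simp

lemma M2_zero: "eventually (\<lambda>z. f z = 0) near \<Longrightarrow> f \<in> M2"
  using M2_cong[of "\<lambda>_. 0" f] additive_subgroup.zero_closed[OF ideal.axioms(1)[OF m.ideal_pow_ideal]]
  by (simp add: M2_def F_const flip: germ_zero)

lemma M2_sum: "(\<And>i. i \<in> A \<Longrightarrow> f i \<in> M2) \<Longrightarrow> (\<lambda>z. \<Sum>i\<in>A. f i z) \<in> M2"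
proof (induction A rule: infinite_finite_induct)
  case (insert i A)
  then show ?case using M2_add[of "f i" "\<lambda>z. \<Sum>i\<in>A. f i z"] by simp
qed (auto intro: M2_zero)

lemma M2_prod:
  assumes "f \<in> F" "g \<in> F" "f x = 0" "g x = 0" shows "(\<lambda>z. f z * g z) \<in> M2"
proof -
  have "germ X x f \<otimes>\<^bsub>L\<^esub> germ X x g \<in> ideal_pow L \<mm> (Suc 1)"
    using assms germ_mem_max_ideal by (intro m.ideal_pow_SucI) (auto simp only: m.ideal_pow_one)
  then show ?thesis using assms unfolding M2_def by (simp add: germ_mult F_mult numeral_2_eq_2)
qed

lemma local_parameters_functions:
  assumes "local_parameters X x ts"
  obtains t where "\<And>i. i < length ts \<Longrightarrow> t i \<in> F" "\<And>i. i < length ts \<Longrightarrow> t i x = 0"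
    "\<And>i. i < length ts \<Longrightarrow> ts ! i = germ X x (t i)"
proof -
  have "\<forall>i. \<exists>f. i < length ts \<longrightarrow> f \<in> F \<and> f x = 0 \<and> ts ! i = germ X x f"
    using assms nth_mem unfolding local_parameters_def max_ideal_def by blast
  then show ?thesis using that by metis
qed

context
  fixes ts t
  assumes params: "local_parameters X x ts"
    and tF: "\<And>i. i < length ts \<Longrightarrow> t i \<in> F"
    and t0: "\<And>i. i < length ts \<Longrightarrow> t i x = 0"
    and tgerm: "\<And>i. i < length ts \<Longrightarrow> ts ! i = germ X x (t i)"
begin

lemma parameter_combination:
  assumes "f \<in> F"
  shows "germ X x f \<ominus>\<^bsub>L\<^esub> (\<Oplus>\<^bsub>L\<^esub>i\<in>{..<length ts}. const_germ X x (c ! i) \<otimes>\<^bsub>L\<^esub> ts ! i) \<in> ideal_pow L \<mm> 2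
     \<longleftrightarrow> (\<lambda>z. f z - (\<Sum>i<length ts. c ! i * t i z)) \<in> M2"
proof -
  have "(\<Oplus>\<^bsub>L\<^esub>i\<in>{..<length ts}. const_germ X x (c ! i) \<otimes>\<^bsub>L\<^esub> ts ! i) =
      (\<Oplus>\<^bsub>L\<^esub>i\<in>{..<length ts}. germ X x (\<lambda>z. c ! i * t i z))"
    using tF F_mult by (intro L.finsum_cong') (auto simp: tgerm germ_mult F_const intro!: germ_closed)
  also have "\<dots> = germ X x (\<lambda>z. \<Sum>i<length ts. c ! i * t i z)"
    using tF F_mult F_const by (intro germ_sum) auto
  finally have "(\<Oplus>\<^bsub>L\<^esub>i\<in>{..<length ts}. const_germ X x (c ! i) \<otimes>\<^bsub>L\<^esub> ts ! i) =
      germ X x (\<lambda>z. \<Sum>i<length ts. c ! i * t i z)" .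
  moreover have "(\<lambda>z. \<Sum>i<length ts. c ! i * t i z) \<in> F"
    using tF F_mult F_const by (intro F_sum) auto
  ultimately show ?thesis
    using assms by (simp add: germ_diff M2_def F_diff)
qed

lemma parameters_span:
  assumes "f \<in> F" "f x = 0"
  shows "\<exists>c. (\<lambda>z. f z - (\<Sum>i<length ts. c i * t i z)) \<in> M2"
proof -
  have "germ X x f \<in> \<mm>" using assms germ_mem_max_ideal by simp
  then obtain c where "germ X x f \<ominus>\<^bsub>L\<^esub> (\<Oplus>\<^bsub>L\<^esub>i\<in>{..<length ts}. const_germ X x (c ! i) \<otimes>\<^bsub>L\<^esub> ts ! i) \<in> ideal_pow L \<mm> 2"
    using params unfolding local_parameters_def by blast
  then show ?thesis using parameter_combination[OF assms(1)] by (intro exI[of _ "\<lambda>i. c ! i"]) simp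
qed

text \<open>The zero germ has a unique expansion in the parameters; both c and the zero vector
  provide one.\<close>

lemma parameters_independent:
  assumes "(\<lambda>z. \<Sum>i<length ts. c i * t i z) \<in> M2" "i < length ts"
  shows "c i = 0"
proof -
  have z: "germ X x (\<lambda>_. 0) \<in> \<mm>" using germ_mem_max_ideal F_const by simp
  define P where "P c \<longleftrightarrow> length c = length ts \<and> germ X x (\<lambda>_. 0) \<ominus>\<^bsub>L\<^esub> (\<Oplus>\<^bsub>L\<^esub>i\<in>{..<length ts}. const_germ X x (c ! i) \<otimes>\<^bsub>L\<^esub> ts ! i) \<in> ideal_pow L \<mm> 2" for c
  have uniq: "\<exists>!c. P c"
    using params z unfolding local_parameters_def P_def by blast
  have "P (map c [0..<length ts])"
    unfolding P_def parameter_combination[OF F_const] using M2_diff[OF M2_zero assms(1), of "\<lambda>_. 0"] by simp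
  moreover have "P (replicate (length ts) 0)"
    unfolding P_def parameter_combination[OF F_const] by (simp add: M2_zero)
  ultimately have "map c [0..<length ts] = replicate (length ts) 0" using uniq by blast
  then have "map c [0..<length ts] ! i = replicate (length ts) 0 ! i" by simp
  then show ?thesis using assms(2) by simp
qed

end

text \<open>Gaussian elimination over the local ring.\<close>

lemma solve_near:
  fixes N m :: nat
  assumes inverse: "\<And>f. f \<in> F \<Longrightarrow> f x \<noteq> 0 \<Longrightarrow> (\<lambda>z. inverse (f z)) \<in> F \<and> eventually (\<lambda>z. f z \<noteq> 0) near"
    and "\<And>s l. s < N \<Longrightarrow> l < m \<Longrightarrow> A s l \<in> F" "\<And>s. s < N \<Longrightarrow> b s \<in> F"
    and "\<And>c s. (\<And>l. l < m \<Longrightarrow> (\<Sum>s<N. c s * A s l x) = 0) \<Longrightarrow> s < N \<Longrightarrow> c s = 0"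
  shows "\<exists>w. (\<forall>l<m. w l \<in> F) \<and> eventually (\<lambda>z. \<forall>s<N. (\<Sum>l<m. A s l z * w l z) = b s z) near"
  using assms(2-)
proof (induction N arbitrary: A b)
  case 0
  then show ?case by (intro exI[of _ "\<lambda>_ _. 0"]) (auto simp: F_const)
next
  case (Suc N)
  \<comment> \<open>Otherwise the vector concentrated at row N would be a nontrivial relation
    between the rows at x.\<close>
  have "\<exists>k<m. A N k x \<noteq> 0"
  proof (rule ccontr)
    assume "\<not> (\<exists>k<m. A N k x \<noteq> 0)"
    then have "(\<Sum>s<Suc N. (if s = N then 1 else 0) * A s l x) = 0" if "l < m" for l
      using that by simp
    then have "(if N = N then 1 else 0) = (0::'k)" using Suc.prems(3)[of "\<lambda>s. if s = N then 1 else 0" N] by blast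
    then show False by simp
  qed
  then obtain k where k: "k < m" "A N k x \<noteq> 0" by blast
  \<comment> \<open>Independence is known at x only; since the pivot is nonzero there, it is a unit
    near x, and elimination works over the local ring.\<close>
  define i where "i = (\<lambda>z. inverse (A N k z))"
  have i: "i \<in> F" "eventually (\<lambda>z. A N k z \<noteq> 0) near"
    unfolding i_def using inverse[OF Suc.prems(1)[OF _ k(1)] k(2)] by auto
  define A' where "A' s l = (\<lambda>z. A s l z - A s k z * i z * A N l z)" for s l
  define b' where "b' s = (\<lambda>z. b s z - A s k z * i z * b N z)" for s
  have "\<exists>w. (\<forall>l<m. w l \<in> F) \<and> eventually (\<lambda>z. \<forall>s<N. (\<Sum>l<m. A' s l z * w l z) = b' s z) near"
  proof (rule Suc.IH)
    show "A' s l \<in> F" if "s < N" "l < m" for s l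
      unfolding A'_def using that k i Suc.prems by (intro F_diff F_mult) auto
    show "b' s \<in> F" if "s < N" for s
      unfolding b'_def using that k i Suc.prems by (intro F_diff F_mult) auto
    fix c s assume c: "\<And>l. l < m \<Longrightarrow> (\<Sum>s<N. c s * A' s l x) = 0" and s: "s < N"
    \<comment> \<open>A relation between the reduced rows becomes one between the original rows once
      row N receives this coefficient.\<close>
    define c' where "c' s = (if s < N then c s else - (\<Sum>s<N. c s * A s k x * i x))" for s
    have "(\<Sum>s<Suc N. c' s * A s l x) = 0" if l: "l < m" for l
    proof -
      have "(\<Sum>s<Suc N. c' s * A s l x) = (\<Sum>s<N. c s * A' s l x)"
        by (simp add: c'_def A'_def right_diff_distrib sum_subtractf sum_distrib_right mult.assoc)
      then show ?thesis using c[OF l] by simp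
    qed
    then have "c' s = 0" using Suc.prems(3)[of c' s] s by simp
    then show "c s = 0" using s by (simp add: c'_def)
  qed
  then obtain w where w: "\<And>l. l < m \<Longrightarrow> w l \<in> F"
    "eventually (\<lambda>z. \<forall>s<N. (\<Sum>l<m. A' s l z * w l z) = b' s z) near" by blast
  \<comment> \<open>The change of the k-th unknown that makes equation N hold; column k of the
    reduced system is zero near x, so the other equations survive.\<close>
  define e where "e = (\<lambda>z. i z * (b N z - (\<Sum>l<m. A N l z * w l z)))"
  define w' where "w' l = (\<lambda>z. w l z + (if l = k then e z else 0))" for l
  have e: "e \<in> F" unfolding e_def using i w Suc.prems by (intro F_mult F_diff F_sum) auto
  have "w' l \<in> F" if "l < m" for l
    unfolding w'_def using F_add[OF w(1)[OF that] e] w(1)[OF that] by (cases "l = k") simp_all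
  moreover have "eventually (\<lambda>z. \<forall>s<Suc N. (\<Sum>l<m. A s l z * w' l z) = b s z) near"
    using w(2) i(2)
  proof eventually_elim
    case (elim z)
    have expand: "(\<Sum>l<m. A s l z * w' l z) = (\<Sum>l<m. A s l z * w l z) + A s k z * e z" for s
      using k(1) by (simp add: w'_def distrib_left sum.distrib if_distrib[of "\<lambda>y. _ * y"] cong: if_cong)
    have iz: "A N k z * i z = 1" using elim by (simp add: i_def)
    show ?case
    proof (intro allI impI)
      fix s assume "s < Suc N"
      then consider "s = N" | "s < N" by linarith
      then show "(\<Sum>l<m. A s l z * w' l z) = b s z"
      proof cases
        case 1
        then show ?thesis unfolding expand e_def using iz by (simp flip: mult.assoc)
      next
        case 2
        have "(\<Sum>l<m. A s l z * w l z) = (\<Sum>l<m. A' s l z * w l z) + A s k z * i z * (\<Sum>l<m. A N l z * w l z)"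
          by (simp add: A'_def left_diff_distrib sum_subtractf sum_distrib_left mult.assoc)
        moreover have "(\<Sum>l<m. A' s l z * w l z) = b s z - A s k z * i z * b N z"
          using elim 2 by (simp add: b'_def)
        ultimately show ?thesis unfolding expand e_def by (simp only:) (simp add: algebra_simps)
      qed
    qed
  qed
  ultimately show ?case by blast
qed

end

subsection \<open>Polynomial functions and partial derivatives\<close>

text \<open>This gives existence for the description in \<open>partial\<close>. Uniqueness, used in
  \<open>partial_eq\<close>, holds because a polynomial over an infinite field is determined by its
  values.\<close>

lemma polys_restrict_line:
  assumes "p \<in> polys m" shows "\<exists>q. \<forall>t. poly q t = p (a(i := t))"
  using assms
proof induction
  case (const c)
  then show ?case by (intro exI[of _ "[:c:]"]) simp
next
  case (coord l)
  then show ?case by (cases "l = i") (auto intro: exI[of _ "[:0, 1:]"] exI[of _ "[:a l:]"])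
next
  case (add p q)
  then obtain p' q' where "\<forall>t. poly p' t = p (a(i := t))" "\<forall>t. poly q' t = q (a(i := t))" by blast
  then have "\<forall>t. poly (p' + q') t = p (a(i := t)) + q (a(i := t))" by (simp only: poly_add) simp
  then show ?case by blast
next
  case (mult p q)
  then obtain p' q' where "\<forall>t. poly p' t = p (a(i := t))" "\<forall>t. poly q' t = q (a(i := t))" by blast
  then have "\<forall>t. poly (p' * q') t = p (a(i := t)) * q (a(i := t))" by (simp only: poly_mult) simp
  then show ?case by blast
qed

lemma partial_eq:
  fixes p :: "(nat \<Rightarrow> 'k::field_char_0) \<Rightarrow> 'k"
  assumes "\<forall>t. poly q t = p (a(i := t))"
  shows "partial i p a = poly (pderiv q) (a i)"
proof -
  have "(THE q. \<forall>t. poly q t = p (a(i := t))) = q"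
  proof (rule the_equality)
    fix q' assume "\<forall>t. poly q' t = p (a(i := t))"
    then have "poly q' = poly q" using assms by auto
    then show "q' = q" by (simp add: poly_eq_poly_eq_iff)
  qed (rule assms)
  then show ?thesis by (simp add: partial_def)
qed

lemma partial_const: "partial i (\<lambda>_. c) a = (0 :: 'k::field_char_0)"
  by (subst partial_eq[of "[:c:]"]) simp_all

lemma partial_coord: "partial i (\<lambda>a. a l) a = (if l = i then 1 else 0 :: 'k::field_char_0)"
proof (cases "l = i")
  case True
  then show ?thesis by (subst partial_eq[of "[:0, 1:]"]) (simp_all add: pderiv_pCons)
next
  case False
  then show ?thesis by (subst partial_eq[of "[:a l:]"]) simp_all
qed

lemma partial_add:
  fixes p :: "(nat \<Rightarrow> 'k::field_char_0) \<Rightarrow> 'k"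
  assumes "p \<in> polys m" "q \<in> polys m"
  shows "partial i (\<lambda>a. p a + q a) a = partial i p a + partial i q a"
proof -
  obtain p' q' where *: "\<forall>t. poly p' t = p (a(i := t))" "\<forall>t. poly q' t = q (a(i := t))"
    using polys_restrict_line assms by metis
  show ?thesis
    unfolding partial_eq[OF *(1)] partial_eq[OF *(2)]
    by (subst partial_eq[of "p' + q'"]) (simp_all add: * pderiv_add)
qed

lemma partial_mult:
  fixes p :: "(nat \<Rightarrow> 'k::field_char_0) \<Rightarrow> 'k"
  assumes "p \<in> polys m" "q \<in> polys m"
  shows "partial i (\<lambda>a. p a * q a) a = partial i p a * q a + p a * partial i q a"
proof -
  obtain p' q' where *: "\<forall>t. poly p' t = p (a(i := t))" "\<forall>t. poly q' t = q (a(i := t))"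
    using polys_restrict_line assms by metis
  have "poly p' (a i) = p a" "poly q' (a i) = q a" using * by auto
  then show ?thesis
    unfolding partial_eq[OF *(1)] partial_eq[OF *(2)]
    by (subst partial_eq[of "p' * q'"]) (simp_all add: * pderiv_mult)
qed

lemma polys_uminus: "p \<in> polys m \<Longrightarrow> (\<lambda>a. - p a) \<in> polys m"
  using polys.mult[OF polys.const[of "-1"], of p] by simp

lemma polys_diff: "p \<in> polys m \<Longrightarrow> q \<in> polys m \<Longrightarrow> (\<lambda>a. p a - q a) \<in> polys m"
  using polys.add[OF _ polys_uminus, of p m q] by simp

lemma partial_uminus:
  fixes p :: "(nat \<Rightarrow> 'k::field_char_0) \<Rightarrow> 'k"
  assumes "p \<in> polys m" shows "partial i (\<lambda>a. - p a) a = - partial i p a"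
  using partial_mult[OF polys.const[of "-1"] assms, of i a] by (simp add: partial_const)

lemma partial_diff:
  fixes p :: "(nat \<Rightarrow> 'k::field_char_0) \<Rightarrow> 'k"
  assumes "p \<in> polys m" "q \<in> polys m"
  shows "partial i (\<lambda>a. p a - q a) a = partial i p a - partial i q a"
  using partial_add[OF assms(1) polys_uminus[OF assms(2)], of i a] partial_uminus[OF assms(2)] by simp

lemma polys_sum: "(\<And>j. j \<in> A \<Longrightarrow> p j \<in> polys m) \<Longrightarrow> (\<lambda>a. \<Sum>j\<in>A. p j a) \<in> polys m"
proof (induction A rule: infinite_finite_induct)
  case (insert i A)
  then show ?case using polys.add[of "p i" m "\<lambda>a. \<Sum>j\<in>A. p j a"] by simp
qed (auto intro: polys.const)

lemma partial_sum:
  fixes p :: "'j \<Rightarrow> (nat \<Rightarrow> 'k::field_char_0) \<Rightarrow> 'k"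
  shows "(\<And>j. j \<in> A \<Longrightarrow> p j \<in> polys m) \<Longrightarrow> partial i (\<lambda>a. \<Sum>j\<in>A. p j a) a = (\<Sum>j\<in>A. partial i (p j) a)"
proof (induction A rule: infinite_finite_induct)
  case (insert j A)
  then show ?case using partial_add[of "p j" m "\<lambda>a. \<Sum>j\<in>A. p j a"] polys_sum[of A p m] by simp
qed (simp_all add: partial_const)

lemma partial_polys:
  fixes p :: "(nat \<Rightarrow> 'k::field_char_0) \<Rightarrow> 'k"
  assumes "p \<in> polys m" shows "partial i p \<in> polys m"
  using assms
proof induction
  case (const c)
  have "partial i (\<lambda>_. c) = (\<lambda>_. 0)" by (rule ext) (rule partial_const)
  then show ?case by (simp add: polys.const)
next
  case (coord l)
  have "partial i (\<lambda>a. a l) = (\<lambda>_. if l = i then 1 else 0 :: 'k)" by (rule ext) (rule partial_coord)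
  then show ?case by (simp only: polys.const)
next
  case (add p q)
  have "partial i (\<lambda>a. p a + q a) = (\<lambda>a. partial i p a + partial i q a)"
    by (rule ext) (rule partial_add[OF add(1,2)])
  then show ?case using add by (simp add: polys.add)
next
  case (mult p q)
  have "partial i (\<lambda>a. p a * q a) = (\<lambda>a. partial i p a * q a + p a * partial i q a)"
    by (rule ext) (rule partial_mult[OF mult(1,2)])
  then show ?case using mult by (simp add: polys.add polys.mult)
qed

subsection \<open>The Zariski topology\<close>

lemma topspace_zariski: "topspace (zariski m) = affine_space m"
proof -
  have "{a \<in> (affine_space m :: (nat \<Rightarrow> 'k::field) set). (\<lambda>_. 1 :: 'k) a \<noteq> 0} \<in> {{a \<in> affine_space m. p a \<noteq> 0} | p. p \<in> polys m}"
    by (rule CollectI, intro exI[of _ "\<lambda>_. 1"] conjI refl polys.const)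
  then have "\<Union> {{a \<in> affine_space m. p a \<noteq> 0} | p. p \<in> polys m} = (affine_space m :: (nat \<Rightarrow> 'k::field) set)"
    by auto
  then show ?thesis by (simp add: zariski_def)
qed

lemma openin_zariski_nonzero: "p \<in> polys m \<Longrightarrow> openin (zariski m) {a \<in> affine_space m. p a \<noteq> 0}"
  unfolding zariski_def by (rule topology_generated_by_Basis) blast

text \<open>Products of polynomials make the nonvanishing sets stable under finite intersections, so
  the generating family is already a basis.\<close>

lemma zariski_basis:
  assumes "openin (zariski m) W" "w \<in> W"
  shows "\<exists>s\<in>polys m. s w \<noteq> 0 \<and> (\<forall>a\<in>affine_space m. s a \<noteq> 0 \<longrightarrow> a \<in> W)"
proof -
  have "generate_topology_on {{a \<in> affine_space m. p a \<noteq> 0} | p. p \<in> polys m} W"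
    using assms(1) by (simp add: zariski_def openin_topology_generated_by_iff)
  then show ?thesis using assms(2)
  proof (induction arbitrary: w)
    case (Int A B)
    obtain s where "s \<in> polys m" "s w \<noteq> 0" "\<forall>a\<in>affine_space m. s a \<noteq> 0 \<longrightarrow> a \<in> A"
      using Int.IH(1)[of w] Int.prems by blast
    moreover obtain t where "t \<in> polys m" "t w \<noteq> 0" "\<forall>a\<in>affine_space m. t a \<noteq> 0 \<longrightarrow> a \<in> B"
      using Int.IH(2)[of w] Int.prems by blast
    ultimately show ?case by (intro bexI[of _ "\<lambda>a. s a * t a"]) (auto intro: polys.mult)
  next
    case (UN K)
    then obtain k where "k \<in> K" "w \<in> k" by blast
    then show ?case using UN.IH[of k w] by blast
  qed auto
qed

text \<open>The witnesses of \<open>smooth_at\<close>, fixed once. In this locale h is the chart,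
  not the step of a Taylor expansion.\<close>

locale smooth_chart = pointed_space X x for X :: "('p, 'k::field_char_0) fun_space" and x +
  fixes U :: "'p set" and m :: nat and Z :: "(nat \<Rightarrow> 'k) set" and h :: "'p \<Rightarrow> nat \<Rightarrow> 'k"
    and r :: nat and f :: "nat \<Rightarrow> (nat \<Rightarrow> 'k) \<Rightarrow> 'k"
  assumes point_U: "x \<in> U" and chart: "affine_chart X U m Z h"
    and f_polys: "\<And>j. j < r \<Longrightarrow> f j \<in> polys m"
    and vanishing_ideal: "{p \<in> polys m. \<forall>a\<in>Z. p a = 0} =
       {\<lambda>a. \<Sum>j<r. q j a * f j a | q. \<forall>j<r. q j \<in> polys m}"
    and jacobian: "\<And>c j. (\<And>i. i < m \<Longrightarrow> (\<Sum>j<r. c j * partial i (f j) (h x)) = 0) \<Longrightarrow> j < r \<Longrightarrow> c j = 0"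
begin

abbreviation TZ where "TZ \<equiv> subtopology (zariski m) Z"

lemma open_U: "openin (topol X) U" and closed_Z: "closedin (zariski m) Z"
  and iso: "space_iso (open_subspace X U) (affine_set m Z) h"
  using chart by (auto simp: affine_chart_def)

lemma Z_affine: "Z \<subseteq> affine_space m"
  using closedin_subset[OF closed_Z] by (simp add: topspace_zariski)

lemma topspace_Z: "topspace TZ = Z"
  using Z_affine by (auto simp: topspace_zariski)

lemma topspace_U: "topspace (subtopology (topol X) U) = U"
  using openin_subset[OF open_U] by auto

lemma homeo: "homeomorphic_map (subtopology (topol X) U) TZ h"
  using iso by (simp add: space_iso_def open_subspace_def affine_set_def)

lemma h_Z: "z \<in> U \<Longrightarrow> h z \<in> Z"
  using homeomorphic_imp_surjective_map[OF homeo] topspace_U topspace_Z by blast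

lemma h_inj: "inj_on h U"
  using homeomorphic_imp_injective_map[OF homeo] topspace_U by simp

lemma near_U: "eventually (\<lambda>z. z \<in> U) near"
  using open_U point_U by (auto simp: eventually_near)

lemma open_pullback: "openin TZ V \<Longrightarrow> openin (topol X) {z \<in> U. h z \<in> V}"
  using openin_continuous_map_preimage[OF homeomorphic_imp_continuous_map[OF homeo], of V]
  by (simp only: topspace_U openin_open_subtopology[OF open_U])

lemma near_pullback: "openin TZ V \<Longrightarrow> h x \<in> V \<Longrightarrow> eventually (\<lambda>z. h z \<in> V) near"
  using open_pullback[of V] point_U unfolding eventually_near by (intro exI[of _ "{z \<in> U. h z \<in> V}"]) auto

lemma open_nonzero: "s \<in> polys m \<Longrightarrow> openin TZ {a \<in> Z. s a \<noteq> 0}"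
  unfolding openin_subtopology using Z_affine
  by (intro exI[of _ "{a \<in> affine_space m. s a \<noteq> 0}"] conjI openin_zariski_nonzero) auto

lemma near_nonzero:
  assumes "s \<in> polys m" "s (h x) \<noteq> 0" shows "eventually (\<lambda>z. s (h z) \<noteq> 0) near"
  using near_pullback[OF open_nonzero[OF assms(1)]] assms h_Z[OF point_U] by (auto elim: eventually_mono)

text \<open>A polynomial s that vanishes outside the neighbourhood makes vanishing near x global on
  Z, and s is a unit at x. This is the link to the ideal of Z, which is described by global
  generators.\<close>

lemma vanishing_near:
  assumes "eventually (\<lambda>z. g (h z) = 0) near"
  shows "\<exists>s\<in>polys m. s (h x) \<noteq> 0 \<and> (\<forall>a\<in>Z. s a * g a = 0)"
proof -
  obtain W where W: "openin (topol X) W" "x \<in> W" "\<And>z. z \<in> W \<Longrightarrow> g (h z) = 0"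
    using assms unfolding eventually_near by blast
  have "openin (subtopology (topol X) U) (W \<inter> U)"
    using W(1) by (auto simp: openin_subtopology)
  then have "openin TZ (h ` (W \<inter> U))"
    using homeomorphic_imp_open_map[OF homeo] by (simp add: open_map_def)
  then obtain T where T: "openin (zariski m) T" "h ` (W \<inter> U) = T \<inter> Z" by (auto simp: openin_subtopology)
  have "h x \<in> T" using T(2) W(2) point_U by blast
  then obtain s where s: "s \<in> polys m" "s (h x) \<noteq> 0" "\<forall>a\<in>affine_space m. s a \<noteq> 0 \<longrightarrow> a \<in> T"
    using zariski_basis[OF T(1)] by blast
  have "s a * g a = 0" if a: "a \<in> Z" for a
  proof (cases "s a = 0")
    case False
    then have "a \<in> T \<inter> Z" using a s(3) Z_affine by blast
    then show ?thesis using T(2) W(3) by (metis IntD1 imageE mult_zero_right)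
  qed simp
  then show ?thesis using s by blast
qed

lemma reg_affine_iff:
  "openin TZ V \<Longrightarrow> g \<in> reg (affine_set m Z) V \<longleftrightarrow> (\<lambda>z. g (h z)) \<in> reg X {z \<in> U. h z \<in> V}"
  using iso unfolding space_iso_def by (simp add: open_subspace_def affine_set_def topspace_U del: topspace_subtopology)

lemma fraction_F:
  assumes "p \<in> polys m" "q \<in> polys m" "q (h x) \<noteq> 0"
  shows "(\<lambda>z. p (h z) / q (h z)) \<in> F"
proof (rule F_I)
  let ?V = "{a \<in> Z. q a \<noteq> 0}"
  show "openin (topol X) {z \<in> U. h z \<in> ?V}" by (rule open_pullback[OF open_nonzero[OF assms(2)]])
  show "x \<in> {z \<in> U. h z \<in> ?V}" using point_U h_Z assms by simp
  show "(\<lambda>z. p (h z) / q (h z)) \<in> reg X {z \<in> U. h z \<in> ?V}"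
  proof -
    have "\<exists>V' p' q'. openin TZ V' \<and> w \<in> V' \<and> V' \<subseteq> ?V \<and> p' \<in> polys m \<and> q' \<in> polys m \<and>
        (\<forall>a\<in>V'. q' a \<noteq> 0 \<and> p a / q a = p' a / q' a)" if "w \<in> ?V" for w
      by (rule exI[of _ ?V], rule exI[of _ p], rule exI[of _ q])
         (use that assms(1,2) open_nonzero[OF assms(2)] in auto)
    then have "(\<lambda>a. p a / q a) \<in> reg (affine_set m Z) ?V"
      unfolding affine_set_def by simp
    then show ?thesis by (rule reg_affine_iff[OF open_nonzero[OF assms(2)], THEN iffD1])
  qed
qed

lemma poly_F: "p \<in> polys m \<Longrightarrow> (\<lambda>z. p (h z)) \<in> F"
  using fraction_F[of p, OF _ polys.const[of 1]] by simp

text \<open>A relation, because p and q are not unique; that derivatives do not depend on the choice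
  is \<open>derivative_unique\<close>.\<close>

definition fraction :: "('p \<Rightarrow> 'k) \<Rightarrow> ((nat \<Rightarrow> 'k) \<Rightarrow> 'k) \<Rightarrow> ((nat \<Rightarrow> 'k) \<Rightarrow> 'k) \<Rightarrow> bool" where
  "fraction g p q \<longleftrightarrow> p \<in> polys m \<and> q \<in> polys m \<and> q (h x) \<noteq> 0 \<and> eventually (\<lambda>z. g z = p (h z) / q (h z)) near"

lemma fraction_exists:
  assumes "g \<in> F" shows "\<exists>p q. fraction g p q"
proof -
  obtain W where W: "openin (topol X) W" "x \<in> W" "g \<in> reg X W"
    using assms by (auto simp: F_iff)
  have WU: "openin (topol X) (W \<inter> U)" using W(1) open_U by (simp add: openin_Int)
  \<comment> \<open>The function is carried to Z by the inverse of the chart; there regular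
    functions are locally quotients of polynomials by definition.\<close>
  define g' where "g' = (\<lambda>a. g (inv_into U h a))"
  define V where "V = h ` (W \<inter> U)"
  have g': "g' (h z) = g z" if "z \<in> U" for z using that h_inj by (simp add: g'_def)
  have V: "{z \<in> U. h z \<in> V} = W \<inter> U" using h_inj unfolding V_def inj_on_def by blast
  have "openin (subtopology (topol X) U) (W \<inter> U)"
    using W(1) by (auto simp: openin_subtopology)
  then have openV: "openin TZ V"
    using homeomorphic_imp_open_map[OF homeo] by (simp add: open_map_def V_def)
  have "(\<lambda>z. g' (h z)) \<in> reg X (W \<inter> U)"
    by (rule reg_cong[OF WU reg_restrict[OF W(3,1) WU]]) (use g' in auto)
  then have "g' \<in> reg (affine_set m Z) V"
    using reg_affine_iff[OF openV] V by simp
  moreover have "h x \<in> V" using W(2) point_U by (simp add: V_def)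
  ultimately obtain V' p q where V': "openin TZ V'" "h x \<in> V'" "p \<in> polys m" "q \<in> polys m"
    "\<And>a. a \<in> V' \<Longrightarrow> q a \<noteq> 0 \<and> g' a = p a / q a" by (fastforce simp: affine_set_def)
  have "eventually (\<lambda>z. g z = p (h z) / q (h z)) near"
    using near_pullback[OF V'(1,2)] near_U by eventually_elim (use V'(5) g' in metis)
  then show ?thesis using V' unfolding fraction_def by blast
qed

lemma F_inverse:
  assumes "g \<in> F" "g x \<noteq> 0"
  shows "(\<lambda>z. inverse (g z)) \<in> F \<and> eventually (\<lambda>z. g z \<noteq> 0) near"
proof -
  obtain p q where pq: "p \<in> polys m" "q \<in> polys m" "q (h x) \<noteq> 0" "eventually (\<lambda>z. g z = p (h z) / q (h z)) near"
    using fraction_exists[OF assms(1)] by (auto simp: fraction_def)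
  have px: "p (h x) \<noteq> 0" using near_at_point[OF pq(4)] assms(2) by auto
  have "(\<lambda>z. inverse (g z)) \<in> F"
    by (rule F_cong[OF fraction_F[OF pq(2,1) px]]) (use pq(4) in eventually_elim, simp)
  moreover have "eventually (\<lambda>z. g z \<noteq> 0) near"
    using pq(4) near_nonzero[OF pq(1) px] near_nonzero[OF pq(2,3)] by eventually_elim simp
  ultimately show ?thesis by blast
qed

subsection \<open>Derivations from vector fields along the chart\<close>

lemma f_vanishes:
  assumes "j < r" "a \<in> Z" shows "f j a = 0"
proof -
  have "f j = (\<lambda>a. \<Sum>i<r. (if i = j then 1 else 0) * f i a)"
    using assms(1) by (simp add: if_distrib[of "\<lambda>y. y * _"] cong: if_cong)
  then have "f j \<in> {p \<in> polys m. \<forall>a\<in>Z. p a = 0}"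
    unfolding vanishing_ideal by (intro CollectI exI[of _ "\<lambda>i _. if i = j then 1 else 0"]) (auto intro: polys.const)
  then show ?thesis using assms(2) by blast
qed

text \<open>The l-th partial derivative of p / q by the quotient rule, pulled back along the
  chart.\<close>

definition grad :: "((nat \<Rightarrow> 'k) \<Rightarrow> 'k) \<Rightarrow> ((nat \<Rightarrow> 'k) \<Rightarrow> 'k) \<Rightarrow> nat \<Rightarrow> 'p \<Rightarrow> 'k" where
  "grad p q l = (\<lambda>z. (partial l p (h z) * q (h z) - p (h z) * partial l q (h z)) / (q (h z) * q (h z)))"

lemma grad_F: "p \<in> polys m \<Longrightarrow> q \<in> polys m \<Longrightarrow> q (h x) \<noteq> 0 \<Longrightarrow> grad p q l \<in> F"
  unfolding grad_def
  using fraction_F[of "\<lambda>a. partial l p a * q a - p a * partial l q a" "\<lambda>a. q a * q a"]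
  by (simp add: polys_diff polys.mult partial_polys)

definition along :: "(nat \<Rightarrow> 'p \<Rightarrow> 'k) \<Rightarrow> ((nat \<Rightarrow> 'k) \<Rightarrow> 'k) \<Rightarrow> 'p \<Rightarrow> 'k" where
  "along w p z = (\<Sum>l<m. w l z * partial l p (h z))"

lemma along_mult:
  "p \<in> polys m \<Longrightarrow> q \<in> polys m \<Longrightarrow> along w (\<lambda>a. p a * q a) z = along w p z * q (h z) + p (h z) * along w q z"
  by (simp add: along_def partial_mult distrib_left sum.distrib sum_distrib_left sum_distrib_right mult_ac)

lemma along_add:
  "p \<in> polys m \<Longrightarrow> q \<in> polys m \<Longrightarrow> along w (\<lambda>a. p a + q a) z = along w p z + along w q z"
  by (simp add: along_def partial_add distrib_left sum.distrib)

lemma along_diff: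
  "p \<in> polys m \<Longrightarrow> q \<in> polys m \<Longrightarrow> along w (\<lambda>a. p a - q a) z = along w p z - along w q z"
  by (simp add: along_def partial_diff right_diff_distrib sum_subtractf)

lemma along_sum:
  assumes "\<And>j. j \<in> A \<Longrightarrow> p j \<in> polys m"
  shows "along w (\<lambda>a. \<Sum>j\<in>A. p j a) z = (\<Sum>j\<in>A. along w (p j) z)"
proof -
  have "along w (\<lambda>a. \<Sum>j\<in>A. p j a) z = (\<Sum>l<m. \<Sum>j\<in>A. w l z * partial l (p j) (h z))"
    by (simp add: along_def partial_sum[of A p m, OF assms] sum_distrib_left)
  also have "\<dots> = (\<Sum>j\<in>A. along w (p j) z)" unfolding along_def by (rule sum.swap)
  finally show ?thesis .
qed

lemma sum_grad:
  "(\<Sum>l<m. w l z * grad p q l z) = (along w p z * q (h z) - p (h z) * along w q z) / (q (h z) * q (h z))"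
  by (simp add: grad_def along_def sum_divide_distrib[symmetric] right_diff_distrib sum_subtractf
      sum_distrib_left sum_distrib_right mult_ac)

context
  fixes w :: "nat \<Rightarrow> 'p \<Rightarrow> 'k"
  assumes w_F: "\<And>l. l < m \<Longrightarrow> w l \<in> F"
    and tangent: "eventually (\<lambda>z. \<forall>j<r. along w (f j) z = 0) near"
begin

text \<open>After multiplication by s, the polynomial lies in the ideal of Z and is a combination of
  the \<open>f j\<close>. Its derivative along w vanishes near x because the \<open>f j\<close> and
  their derivatives do; the product rule leaves s times the derivative of g, and s is a unit at x.
  Thus a tangent field acts on germs of functions on X.\<close>

lemma tangent_vanishing:
  assumes g: "g \<in> polys m" and zero: "eventually (\<lambda>z. g (h z) = 0) near"
  shows "eventually (\<lambda>z. along w g z = 0) near"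
proof -
  obtain s where s: "s \<in> polys m" "s (h x) \<noteq> 0" "\<forall>a\<in>Z. s a * g a = 0"
    using vanishing_near[OF zero] by blast
  have "(\<lambda>a. s a * g a) \<in> {p \<in> polys m. \<forall>a\<in>Z. p a = 0}" using s g polys.mult by blast
  then obtain q where q: "(\<lambda>a. s a * g a) = (\<lambda>a. \<Sum>j<r. q j a * f j a)" "\<forall>j<r. q j \<in> polys m"
    unfolding vanishing_ideal by blast
  show ?thesis using near_nonzero[OF s(1,2)] near_U tangent zero
  proof eventually_elim
    case (elim z)
    have "along w (\<lambda>a. s a * g a) z = (\<Sum>j<r. along w (q j) z * f j (h z) + q j (h z) * along w (f j) z)"
      unfolding q(1) using q(2) f_polys by (subst along_sum) (auto simp: polys.mult along_mult)
    also have "\<dots> = 0" using elim f_vanishes h_Z by simp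
    finally show ?case using along_mult[OF s(1) g, of w z] elim by simp
  qed
qed

lemma derivative_unique:
  assumes "fraction g p q" "fraction g p' q'"
  shows "eventually (\<lambda>z. (\<Sum>l<m. w l z * grad p q l z) = (\<Sum>l<m. w l z * grad p' q' l z)) near"
proof -
  note pq = assms[unfolded fraction_def]
  define G where "G = (\<lambda>a. p a * q' a - p' a * q a)"
  have "eventually (\<lambda>z. q (h z) \<noteq> 0) near" "eventually (\<lambda>z. q' (h z) \<noteq> 0) near"
    "eventually (\<lambda>z. g z = p (h z) / q (h z)) near" "eventually (\<lambda>z. g z = p' (h z) / q' (h z)) near"
    using pq near_nonzero by blast+
  note ev = this
  have eq: "eventually (\<lambda>z. p (h z) * q' (h z) = p' (h z) * q (h z)) near"
    using ev by eventually_elim (auto simp: field_simps)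
  have G: "G \<in> polys m" unfolding G_def using pq by (auto intro: polys_diff polys.mult)
  have "eventually (\<lambda>z. along w G z = 0) near"
    by (rule tangent_vanishing[OF G]) (use eq in eventually_elim, simp add: G_def)
  then show ?thesis using eq ev
  proof eventually_elim
    case (elim z)
    define P Q P' Q' where "P = p (h z)" and "Q = q (h z)" and "P' = p' (h z)" and "Q' = q' (h z)"
    define a b a' b' where "a = along w p z" and "b = along w q z" and "a' = along w p' z" and "b' = along w q' z"
    have "along w G z = a * Q' + P * b' - (a' * Q + P' * b)"
      unfolding G_def P_def Q_def P'_def Q'_def a_def b_def a'_def b'_def using pq
      by (subst along_diff) (auto simp: along_mult polys.mult)
    then have 1: "a * Q' + P * b' = a' * Q + P' * b" using elim by simp
    have 2: "P * Q' = P' * Q" "Q \<noteq> 0" "Q' \<noteq> 0" using elim unfolding P_def Q_def P'_def Q'_def by auto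
    \<comment> \<open>The difference of the two quotient rule expressions is a combination of two
      known relations: equality of the fractions, and its derivative along w.\<close>
    have "(a * Q - P * b) * (Q' * Q') - (a' * Q' - P' * b') * (Q * Q) =
       (a * Q' + P * b' - (a' * Q + P' * b)) * Q * Q' - (b * Q' + b' * Q) * (P * Q' - P' * Q)"
      by (simp add: algebra_simps)
    then have "(a * Q - P * b) * (Q' * Q') = (a' * Q' - P' * b') * (Q * Q)" using 1 2(1) by simp
    then have "(a * Q - P * b) / (Q * Q) = (a' * Q' - P' * b') / (Q' * Q')" using 2 by (simp add: frac_eq_eq)
    then show ?case unfolding sum_grad P_def Q_def P'_def Q'_def a_def b_def a'_def b'_def .
  qed
qed

definition vector_field :: "('p \<Rightarrow> 'k) set \<Rightarrow> ('p \<Rightarrow> 'k) set" where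
  "vector_field a = (let g = SOME g. g \<in> F \<and> a = germ X x g; (p, q) = SOME (p, q). fraction g p q
     in germ X x (\<lambda>z. \<Sum>l<m. w l z * grad p q l z))"

lemma derivative_F: "fraction g p q \<Longrightarrow> (\<lambda>z. \<Sum>l<m. w l z * grad p q l z) \<in> F"
  by (intro F_sum F_mult w_F grad_F) (auto simp: fraction_def)

lemma vector_field_germ:
  assumes g: "g \<in> F" and frac: "fraction g p q"
  shows "vector_field (germ X x g) = germ X x (\<lambda>z. \<Sum>l<m. w l z * grad p q l z)"
proof -
  define g' where "g' = (SOME g'. g' \<in> F \<and> germ X x g = germ X x g')"
  have g': "g' \<in> F \<and> germ X x g = germ X x g'" unfolding g'_def by (rule someI[of _ g]) (use g in simp)
  then have ev: "eventually (\<lambda>z. g z = g' z) near" using germ_eq_iff[OF g, of g'] by blast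
  obtain p' q' where pq': "(p', q') = (SOME (p, q). fraction g' p q)" by (metis surj_pair)
  have "\<exists>pq. case pq of (p, q) \<Rightarrow> fraction g' p q" using fraction_exists g' by auto
  then have frac': "fraction g' p' q'" using someI_ex pq' by (metis (mono_tags, lifting) case_prodD)
  have "eventually (\<lambda>z. g z = p' (h z) / q' (h z)) near"
    using ev frac'[unfolded fraction_def, THEN conjunct2, THEN conjunct2, THEN conjunct2] by eventually_elim simp
  then have "fraction g p' q'" using frac' unfolding fraction_def by blast
  then have "germ X x (\<lambda>z. \<Sum>l<m. w l z * grad p' q' l z) = germ X x (\<lambda>z. \<Sum>l<m. w l z * grad p q l z)"
    using derivative_unique[OF _ frac] frac derivative_F by (subst germ_eq_iff) auto
  then show ?thesis
    unfolding vector_field_def Let_def g'_def[symmetric] pq'[symmetric] by simp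
qed

lemma vector_field_derivation: "derivation X x vector_field"
  unfolding derivation_def Let_def
proof (intro conjI ballI allI funcsetI)
  fix a assume "a \<in> carrier L"
  then obtain g where g: "g \<in> F" "a = germ X x g" by (rule local_ring_cases)
  obtain p q where pq: "fraction g p q" using fraction_exists[OF g(1)] by blast
  show "vector_field a \<in> carrier L"
    unfolding g(2) vector_field_germ[OF g(1) pq] by (rule germ_closed[OF derivative_F[OF pq]])
  fix b assume "b \<in> carrier L"
  then obtain g' where g': "g' \<in> F" "b = germ X x g'" by (rule local_ring_cases)
  obtain p' q' where pq': "fraction g' p' q'" using fraction_exists[OF g'(1)] by blast
  note polys = pq[unfolded fraction_def] pq'[unfolded fraction_def]
  have ev: "eventually (\<lambda>z. q (h z) \<noteq> 0) near" "eventually (\<lambda>z. q' (h z) \<noteq> 0) near"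
    "eventually (\<lambda>z. g z = p (h z) / q (h z)) near" "eventually (\<lambda>z. g' z = p' (h z) / q' (h z)) near"
    using polys near_nonzero by blast+
  have sum: "fraction (\<lambda>z. g z + g' z) (\<lambda>a. p a * q' a + p' a * q a) (\<lambda>a. q a * q' a)"
  proof -
    have "eventually (\<lambda>z. g z + g' z = (p (h z) * q' (h z) + p' (h z) * q (h z)) / (q (h z) * q' (h z))) near"
      using ev by eventually_elim (simp add: field_simps)
    then show ?thesis using polys by (auto simp: fraction_def intro: polys.mult polys.add)
  qed
  have prod: "fraction (\<lambda>z. g z * g' z) (\<lambda>a. p a * p' a) (\<lambda>a. q a * q' a)"
  proof -
    have "eventually (\<lambda>z. g z * g' z = (p (h z) * p' (h z)) / (q (h z) * q' (h z))) near"
      using ev by eventually_elim simp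
    then show ?thesis using polys by (auto simp: fraction_def intro: polys.mult)
  qed
  note dF = derivative_F[OF pq] derivative_F[OF pq']
  show "vector_field (a \<oplus>\<^bsub>L\<^esub> b) = vector_field a \<oplus>\<^bsub>L\<^esub> vector_field b"
  proof -
    have "eventually (\<lambda>z. (\<Sum>l<m. w l z * grad (\<lambda>a. p a * q' a + p' a * q a) (\<lambda>a. q a * q' a) l z) =
       (\<Sum>l<m. w l z * grad p q l z) + (\<Sum>l<m. w l z * grad p' q' l z)) near"
      using ev(1,2) unfolding sum_grad
      by eventually_elim (use polys in \<open>simp add: along_add along_mult polys.mult field_simps\<close>)
    then show ?thesis
      unfolding g(2) g'(2) germ_add[OF g(1) g'(1)] vector_field_germ[OF g(1) pq] vector_field_germ[OF g'(1) pq']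
        vector_field_germ[OF F_add[OF g(1) g'(1)] sum] germ_add[OF dF]
      by (subst germ_eq_iff[OF derivative_F[OF sum] F_add[OF dF]])
  qed
  show "vector_field (a \<otimes>\<^bsub>L\<^esub> b) = vector_field a \<otimes>\<^bsub>L\<^esub> b \<oplus>\<^bsub>L\<^esub> a \<otimes>\<^bsub>L\<^esub> vector_field b"
  proof -
    have "eventually (\<lambda>z. (\<Sum>l<m. w l z * grad (\<lambda>a. p a * p' a) (\<lambda>a. q a * q' a) l z) =
       (\<Sum>l<m. w l z * grad p q l z) * g' z + g z * (\<Sum>l<m. w l z * grad p' q' l z)) near"
      using ev
    proof eventually_elim
      case (elim z)
      show ?case unfolding sum_grad elim(3,4) using elim(1,2) polys
        by (simp add: along_mult polys.mult field_simps)
    qed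
    then show ?thesis
      unfolding g(2) g'(2) germ_mult[OF g(1) g'(1)] vector_field_germ[OF g(1) pq] vector_field_germ[OF g'(1) pq']
        vector_field_germ[OF F_mult[OF g(1) g'(1)] prod] germ_mult[OF dF(1) g'(1)] germ_mult[OF g(1) dF(2)]
        germ_add[OF F_mult[OF dF(1) g'(1)] F_mult[OF g(1) dF(2)]]
      by (subst germ_eq_iff[OF derivative_F[OF prod] F_add[OF F_mult[OF dF(1) g'(1)] F_mult[OF g(1) dF(2)]]])
  qed
next
  fix c
  have "fraction (\<lambda>_. c) (\<lambda>_. c) (\<lambda>_. 1)" by (simp add: fraction_def polys.const)
  from vector_field_germ[OF F_const this] show "vector_field (const_germ X x c) = \<zero>\<^bsub>L\<^esub>"
    by (simp add: grad_def partial_const germ_zero)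
qed

end

end

lemma sum_lessThan_add:
  fixes f :: "nat \<Rightarrow> 'a::comm_monoid_add"
  shows "(\<Sum>i<m + n. f i) = (\<Sum>i<m. f i) + (\<Sum>i<n. f (m + i))"
  by (induction n) (simp_all add: add.assoc)

subsection \<open>Existence of derivations with prescribed values\<close>

context smooth_chart
begin

definition lin :: "((nat \<Rightarrow> 'k) \<Rightarrow> 'k) \<Rightarrow> 'p \<Rightarrow> 'k" where
  "lin p z = (\<Sum>i<m. partial i p (h x) * (h z i - h x i))"

lemma coord_F: "i < m \<Longrightarrow> (\<lambda>z. h z i - h x i) \<in> F"
  by (intro F_diff F_const poly_F[OF polys.coord])

lemma lin_F: "lin p \<in> F"
  unfolding lin_def by (intro F_sum F_mult F_const coord_F) simp

lemma lin_point: "lin p x = 0"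
  by (simp add: lin_def)

lemma first_order_expansion:
  assumes "p \<in> polys m" shows "(\<lambda>z. p (h z) - p (h x) - lin p z) \<in> M2"
  using assms
proof induction
  case (const c)
  then show ?case by (intro M2_zero) (simp add: lin_def partial_const)
next
  case (coord l)
  then show ?case
    by (intro M2_zero) (simp add: lin_def partial_coord if_distrib[of "\<lambda>y. y * _"] cong: if_cong)
next
  case (add p q)
  have "lin (\<lambda>a. p a + q a) z = lin p z + lin q z" for z
    using add by (simp add: lin_def partial_add distrib_right sum.distrib)
  then show ?case using M2_add[OF add.IH] by (simp add: algebra_simps)
next
  case (mult p q)
  define P where "P z = p (h z) - p (h x) - lin p z" for z
  define Q where "Q z = q (h z) - q (h x) - lin q z" for z
  have lin: "lin (\<lambda>a. p a * q a) z = lin p z * q (h x) + p (h x) * lin q z" for z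
    unfolding lin_def partial_mult[OF mult.hyps] sum_distrib_left sum_distrib_right sum.distrib[symmetric]
    by (intro sum.cong refl) (simp add: algebra_simps)
  \<comment> \<open>The remainder of a product in terms of the remainders P and Q of its factors;
    the last summand is a product of two linear parts, both zero at x.\<close>
  have "(\<lambda>z. P z * q (h z) + (Q z * (lin p z + p (h x)) + lin p z * lin q z)) \<in> M2"
    using mult.IH mult.hyps unfolding P_def Q_def
    by (intro M2_add M2_mult M2_prod poly_F F_add F_const lin_F lin_point)
  moreover have "P z * q (h z) + (Q z * (lin p z + p (h x)) + lin p z * lin q z) =
      p (h z) * q (h z) - p (h x) * q (h x) - lin (\<lambda>a. p a * q a) z" for z
    unfolding lin P_def Q_def by (simp add: algebra_simps)
  ultimately show ?case by simp
qed

lemma fraction_expansion: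
  assumes frac: "fraction g p q" and "g x = 0"
  shows "(\<lambda>z. g z - (\<Sum>l<m. grad p q l x * (h z l - h x l))) \<in> M2"
proof -
  have pq: "p \<in> polys m" "q \<in> polys m" "q (h x) \<noteq> 0" "eventually (\<lambda>z. g z = p (h z) / q (h z)) near"
    using frac by (auto simp: fraction_def)
  have p0: "p (h x) = 0" using near_at_point[OF pq(4)] assms(2) pq(3) by simp
  have inv: "(\<lambda>z. 1 / q (h z)) \<in> F" using fraction_F[OF polys.const[of 1] pq(2,3)] .
  have lin: "(\<Sum>l<m. grad p q l x * (h z l - h x l)) = lin p z * (1 / q (h x))" for z
    using p0 pq(3) by (simp add: lin_def grad_def sum_divide_distrib)
  \<comment> \<open>Replacing 1 / q by its value at x costs a product of two functions vanishing at
    x.\<close>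
  have "(\<lambda>z. (p (h z) - p (h x) - lin p z) * (1 / q (h z)) + lin p z * (1 / q (h z) - 1 / q (h x))) \<in> M2"
    by (intro M2_add M2_mult M2_prod first_order_expansion pq inv lin_F F_diff F_const lin_point) simp
  then show ?thesis unfolding lin
    by (rule M2_cong) (use pq(4) in eventually_elim, simp add: p0 algebra_simps diff_divide_distrib)
qed

lemma lin_equation_M2:
  assumes "j < r" shows "lin (f j) \<in> M2"
proof -
  have "(\<lambda>z. 0 - (f j (h z) - f j (h x) - lin (f j) z)) \<in> M2"
    by (intro M2_diff M2_zero first_order_expansion f_polys assms) simp
  then show ?thesis
    by (rule M2_cong) (use near_U in eventually_elim, simp add: f_vanishes[OF assms] h_Z point_U)
qed

text \<open>Contracted with the coordinate differences, the relation becomes one between the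
  parameters modulo the square of the maximal ideal, since there the linear parts of the
  \<open>f j\<close> disappear. So all \<open>d i\<close> vanish, and the Jacobian criterion then
  gives the same for the \<open>c j\<close>.\<close>

lemma rows_independent:
  assumes params: "local_parameters X x ts"
    and t: "\<And>i. i < length ts \<Longrightarrow> t i \<in> F" "\<And>i. i < length ts \<Longrightarrow> t i x = 0"
      "\<And>i. i < length ts \<Longrightarrow> ts ! i = germ X x (t i)"
    and frac: "\<And>i. i < length ts \<Longrightarrow> fraction (t i) (P i) (Q i)"
    and zero: "\<And>l. l < m \<Longrightarrow> (\<Sum>j<r. c j * partial l (f j) (h x)) + (\<Sum>i<length ts. d i * grad (P i) (Q i) l x) = 0"
  shows "j < r \<Longrightarrow> c j = 0" "i < length ts \<Longrightarrow> d i = 0"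
proof -
  let ?n = "length ts"
  have "(\<lambda>z. (\<Sum>i<?n. d i * (t i z - (\<Sum>l<m. grad (P i) (Q i) l x * (h z l - h x l)))) - (\<Sum>j<r. c j * lin (f j) z)) \<in> M2"
    by (intro M2_diff M2_sum M2_scale fraction_expansion frac t lin_equation_M2) auto
  moreover have "(\<Sum>i<?n. d i * (t i z - (\<Sum>l<m. grad (P i) (Q i) l x * (h z l - h x l)))) - (\<Sum>j<r. c j * lin (f j) z)
     = (\<Sum>i<?n. d i * t i z)" for z
  proof -
    have 1: "(\<Sum>i<?n. d i * (\<Sum>l<m. grad (P i) (Q i) l x * (h z l - h x l))) =
        (\<Sum>l<m. (\<Sum>i<?n. d i * grad (P i) (Q i) l x) * (h z l - h x l))"
      unfolding sum_distrib_left sum_distrib_right by (subst sum.swap) (simp add: mult.assoc)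
    have 2: "(\<Sum>j<r. c j * lin (f j) z) = (\<Sum>l<m. (\<Sum>j<r. c j * partial l (f j) (h x)) * (h z l - h x l))"
      unfolding lin_def sum_distrib_left sum_distrib_right by (subst sum.swap) (simp add: mult.assoc)
    have "(\<Sum>i<?n. d i * (\<Sum>l<m. grad (P i) (Q i) l x * (h z l - h x l))) + (\<Sum>j<r. c j * lin (f j) z) = 0"
      unfolding 1 2 sum.distrib[symmetric] distrib_right[symmetric]
      using zero by (intro sum.neutral) (simp add: add.commute)
    moreover have "(\<Sum>i<?n. d i * (t i z - B i)) = (\<Sum>i<?n. d i * t i z) - (\<Sum>i<?n. d i * B i)" for B
      by (simp add: right_diff_distrib sum_subtractf)
    ultimately show ?thesis by (simp only: diff_diff_eq) simp
  qed
  ultimately have "(\<lambda>z. \<Sum>i<?n. d i * t i z) \<in> M2" by simp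
  then have d: "d i = 0" if "i < ?n" for i using parameters_independent[OF params t] that by blast
  then show "i < ?n \<Longrightarrow> d i = 0" .
  show "j < r \<Longrightarrow> c j = 0" using jacobian[of c j] zero d by simp
qed

text \<open>The unknown is a vector field on affine space near x. The first r equations make it
  tangent to Z, the others prescribe its values on the parameters; \<open>rows_independent\<close>
  makes the system solvable.\<close>

lemma derivation_with_values:
  assumes params: "local_parameters X x ts"
  shows "\<exists>\<delta>. derivation X x \<delta> \<and> (\<forall>i<length ts. \<delta> (ts ! i) = const_germ X x (b i))"
proof -
  let ?n = "length ts"
  obtain t where t: "\<And>i. i < ?n \<Longrightarrow> t i \<in> F" "\<And>i. i < ?n \<Longrightarrow> t i x = 0"
    "\<And>i. i < ?n \<Longrightarrow> ts ! i = germ X x (t i)" using local_parameters_functions[OF params] by blast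
  have "\<forall>i. \<exists>P Q. i < ?n \<longrightarrow> fraction (t i) P Q" using fraction_exists t(1) by blast
  then obtain P Q where frac: "\<And>i. i < ?n \<Longrightarrow> fraction (t i) (P i) (Q i)" by metis
  define A where "A s l = (if s < r then (\<lambda>z. partial l (f s) (h z)) else grad (P (s - r)) (Q (s - r)) l)" for s l
  define b' where "b' s = (\<lambda>_ :: 'p. if s < r then 0 else b (s - r))" for s
  have "\<exists>w. (\<forall>l<m. w l \<in> F) \<and> eventually (\<lambda>z. \<forall>s<r + ?n. (\<Sum>l<m. A s l z * w l z) = b' s z) near"
  proof (rule solve_near[OF F_inverse])
    show "A s l \<in> F" if "s < r + ?n" "l < m" for s l
    proof (cases "s < r")
      case True
      then show ?thesis by (simp add: A_def poly_F partial_polys f_polys)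
    next
      case False
      then have "fraction (t (s - r)) (P (s - r)) (Q (s - r))" using that by (intro frac) simp
      then show ?thesis using False by (simp add: A_def grad_F fraction_def)
    qed
    show "b' s \<in> F" for s by (simp add: b'_def F_const)
    fix c s assume c: "\<And>l. l < m \<Longrightarrow> (\<Sum>s<r + ?n. c s * A s l x) = 0" and s: "s < r + ?n"
    have "(\<Sum>j<r. c j * partial l (f j) (h x)) + (\<Sum>i<?n. c (r + i) * grad (P i) (Q i) l x) = 0" if "l < m" for l
      using c[OF that] by (simp add: sum_lessThan_add A_def)
    note ind = rows_independent[OF params t frac this]
    show "c s = 0"
    proof (cases "s < r")
      case False
      then have "c (r + (s - r)) = 0" using s by (intro ind(2)) simp_all
      then show ?thesis using False by simp
    qed (rule ind(1))
  qed auto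
  then obtain w where w: "\<And>l. l < m \<Longrightarrow> w l \<in> F"
    "eventually (\<lambda>z. \<forall>s<r + ?n. (\<Sum>l<m. A s l z * w l z) = b' s z) near" by blast
  have tangent: "eventually (\<lambda>z. \<forall>j<r. along w (f j) z = 0) near"
    using w(2)
  proof eventually_elim
    case (elim z)
    show ?case
    proof (intro allI impI)
      fix j assume "j < r"
      then show "along w (f j) z = 0" using elim[rule_format, of j] by (simp add: A_def b'_def along_def mult.commute)
    qed
  qed
  have "vector_field w (ts ! i) = const_germ X x (b i)" if i: "i < ?n" for i
  proof -
    have ev: "eventually (\<lambda>z. (\<Sum>l<m. w l z * grad (P i) (Q i) l z) = b i) near"
      using w(2)
    proof eventually_elim
      case (elim z)
      show ?case using elim[rule_format, of "r + i"] i by (simp add: A_def b'_def mult.commute)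
    qed
    have "vector_field w (ts ! i) = germ X x (\<lambda>z. \<Sum>l<m. w l z * grad (P i) (Q i) l z)"
      unfolding t(3)[OF i] by (rule vector_field_germ) (use w(1) tangent t(1) frac i in auto)
    also have "\<dots> = const_germ X x (b i)"
      using ev germ_eq_iff[OF derivative_F[OF _ tangent frac[OF i]] F_const] w(1) by blast
    finally show ?thesis .
  qed
  then show ?thesis using vector_field_derivation[OF w(1) tangent] by blast
qed

end

section \<open>The automorphism defined by a derivation and a pair of parameters\<close>

context adic
begin

text \<open>The inverse is the Taylor map along \<omega> \<delta>, which has value 1 at v, with step
  \<open>u \<ominus> v\<close>. One composite is checked on u and S, the other on v and S; hence the
  two spanning assumptions.\<close>

lemma taylor_automorphism:
  fixes \<kappa> :: "'k::field_char_0 \<Rightarrow> 'a"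
  assumes td: "taylor_data J R \<kappa> \<delta> (v \<ominus> u)" and u: "u \<in> J" "\<delta> u = \<one>" and v: "v \<in> J"
    and \<omega>: "\<omega> \<in> carrier R" "\<omega> \<otimes> \<delta> v = \<one>"
    and S: "S \<subseteq> carrier R" "\<And>g. g \<in> S \<Longrightarrow> \<delta> g = \<zero>"
    and span: "J \<subseteq> cotangent_span R J \<kappa> (insert u S)" "J \<subseteq> cotangent_span R J \<kappa> (insert v S)"
    and residue: "\<And>a. a \<in> carrier R \<Longrightarrow> \<exists>c. a \<ominus> \<kappa> c \<in> J"
  obtains \<phi> where "\<phi> \<in> ring_iso C C" "\<And>c. \<phi> (incl (\<kappa> c)) = incl (\<kappa> c)" "\<phi> (incl u) = incl v"
    "\<And>s. s \<in> carrier C \<Longrightarrow> \<exists>b\<in>carrier C. \<phi> s = s \<oplus>\<^bsub>C\<^esub> incl (v \<ominus> u) \<otimes>\<^bsub>C\<^esub> b"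
    "\<And>e. e \<in> carrier R \<Longrightarrow> \<delta> e = \<zero> \<Longrightarrow> \<phi> ` (Idl\<^bsub>C\<^esub> (incl ` (PIdl e))) = Idl\<^bsub>C\<^esub> (incl ` (PIdl e))"
    "\<And>H K. ideal H R \<Longrightarrow> (\<And>a. a \<in> H \<Longrightarrow> (v \<ominus> u) \<otimes> \<delta> a \<in> H) \<Longrightarrow> (v \<ominus> u) [^] (K::nat) \<in> H \<Longrightarrow>
        \<phi> ` (Idl\<^bsub>C\<^esub> (incl ` H)) = Idl\<^bsub>C\<^esub> (incl ` H)"
proof -
  interpret A: taylor_data J R \<kappa> \<delta> "v \<ominus> u" by (rule td)
  interpret C: cring C by (rule completion_cring)
  define \<delta>' where "\<delta>' a = \<omega> \<otimes> \<delta> a" for a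
  have uv: "u \<in> carrier R" "v \<in> carrier R" using u v Icarr by auto
  have h': "u \<ominus> v = \<ominus> (v \<ominus> u)" using uv by algebra
  interpret B: taylor_data J R \<kappa> \<delta>' "u \<ominus> v"
  proof
    show "u \<ominus> v \<in> J" using ideal_pow_minus[of u 1 v, unfolded ideal_pow_one] u v by simp
    show "\<delta>' (a \<otimes> b) = \<delta>' a \<otimes> b \<oplus> a \<otimes> \<delta>' b" if "a \<in> carrier R" "b \<in> carrier R" for a b
      unfolding \<delta>'_def A.deriv_mult[OF that] using that \<omega>(1) A.deriv_closed[OF that(1)] A.deriv_closed[OF that(2)] by algebra
  qed (use \<omega>(1) in \<open>auto simp: \<delta>'_def A.const_closed A.const_add A.const_mult A.const_one A.deriv_closed A.deriv_add A.deriv_const r_distr\<close>)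
  have \<delta>'v: "\<delta>' v = \<one>" and \<delta>'0: "\<delta> a = \<zero> \<Longrightarrow> \<delta>' a = \<zero>" for a
    using \<omega> by (auto simp: \<delta>'_def)
  have sums: "u \<oplus> (v \<ominus> u) = v" "v \<oplus> (u \<ominus> v) = u" using uv by algebra+
  have closed: "A.taylor n a \<in> carrier R" "B.taylor n a \<in> carrier R" if "a \<in> carrier R" for n a
    using that by (auto intro: A.taylor_closed B.taylor_closed)
  have trans: "a \<ominus> c \<in> ideal_pow R J n"
    if "a \<ominus> b \<in> ideal_pow R J n" "b \<ominus> c \<in> ideal_pow R J n" "a \<in> carrier R" "b \<in> carrier R" "c \<in> carrier R" for a b c n
  proof -
    have "(a \<ominus> b) \<oplus> (b \<ominus> c) = a \<ominus> c" using that by algebra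
    then show ?thesis using ideal_pow_add[OF that(1,2)] by simp
  qed
  have B_cong: "B.taylor n a \<ominus> c \<in> ideal_pow R J n"
    if "a \<ominus> b \<in> ideal_pow R J n" "B.taylor n b \<ominus> c \<in> ideal_pow R J n" "a \<in> carrier R" "b \<in> carrier R" "c \<in> carrier R" for a b c n
    using B.taylor_ideal_pow[OF that(1), of n] unfolding B.taylor_minus[OF that(3,4)]
    by (rule trans[OF _ that(2)]) (use that closed in simp_all)
  have A_cong: "A.taylor n a \<ominus> c \<in> ideal_pow R J n"
    if "a \<ominus> b \<in> ideal_pow R J n" "A.taylor n b \<ominus> c \<in> ideal_pow R J n" "a \<in> carrier R" "b \<in> carrier R" "c \<in> carrier R" for a b c n
    using A.taylor_ideal_pow[OF that(1), of n] unfolding A.taylor_minus[OF that(3,4)]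
    by (rule trans[OF _ that(2)]) (use that closed in simp_all)
  have BA: "B.completed_map (A.completed_map s) = s" if "s \<in> carrier C" for s
  proof (rule completed_map_inverse[OF A.taylor_data_axioms B.taylor_data_axioms _ _ residue span(1) that])
    fix g n assume "g \<in> insert u S"
    then consider "g = u" | "g \<in> S" by blast
    then show "B.taylor n (A.taylor n g) \<ominus> g \<in> ideal_pow R J n"
    proof cases
      case 1
      show ?thesis unfolding 1
        by (rule B_cong[OF A.taylor_shift[OF u, unfolded sums] B.taylor_shift[OF v \<delta>'v, unfolded sums]])
           (use uv closed in auto)
    next
      case 2
      then have g: "g \<in> carrier R" "\<delta> g = \<zero>" using S by auto
      show ?thesis
        by (rule B_cong[OF A.taylor_fixed[OF g] B.taylor_fixed[OF g(1) \<delta>'0[OF g(2)]]]) (use g closed in auto)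
    qed
  qed (use S uv in auto)
  have AB: "A.completed_map (B.completed_map s) = s" if "s \<in> carrier C" for s
  proof (rule completed_map_inverse[OF B.taylor_data_axioms A.taylor_data_axioms _ _ residue span(2) that])
    fix g n assume "g \<in> insert v S"
    then consider "g = v" | "g \<in> S" by blast
    then show "A.taylor n (B.taylor n g) \<ominus> g \<in> ideal_pow R J n"
    proof cases
      case 1
      show ?thesis unfolding 1
        by (rule A_cong[OF B.taylor_shift[OF v \<delta>'v, unfolded sums] A.taylor_shift[OF u, unfolded sums]])
           (use uv closed in auto)
    next
      case 2
      then have g: "g \<in> carrier R" "\<delta> g = \<zero>" using S by auto
      show ?thesis
        by (rule A_cong[OF B.taylor_fixed[OF g(1) \<delta>'0[OF g(2)]] A.taylor_fixed[OF g]]) (use g closed in auto)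
    qed
  qed (use S uv in auto)
  show thesis
  proof
    have "bij_betw A.completed_map (carrier C) (carrier C)"
      by (rule bij_betw_byWitness[of _ B.completed_map])
        (use AB BA A.completed_map_closed B.completed_map_closed in auto)
    then show "A.completed_map \<in> ring_iso C C" using A.completed_map_hom by (simp add: ring_iso_def)
    show "A.completed_map (incl (\<kappa> c)) = incl (\<kappa> c)" for c
      by (rule A.completed_map_fixed[OF A.const_closed A.deriv_const])
    show "A.completed_map (incl u) = incl v"
      using A.completed_map_shift[OF u] sums by simp
    show "\<exists>b\<in>carrier C. A.completed_map s = s \<oplus>\<^bsub>C\<^esub> incl (v \<ominus> u) \<otimes>\<^bsub>C\<^esub> b" if "s \<in> carrier C" for s
      using A.completed_map_diff[OF that] .
    show "A.completed_map ` (Idl\<^bsub>C\<^esub> (incl ` (PIdl e))) = Idl\<^bsub>C\<^esub> (incl ` (PIdl e))"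
      if e: "e \<in> carrier R" "\<delta> e = \<zero>" for e
    proof (rule C.automorphism_generated_ideal[OF A.completed_map_hom B.completed_map_hom _ AB])
      have PI: "PIdl e \<subseteq> carrier R" by (rule subsetI) (rule ideal.Icarr[OF cgenideal_ideal[OF e(1)]])
      show sub: "incl ` (PIdl e) \<subseteq> carrier C" using PI incl_closed by blast
      have self: "incl e \<in> Idl\<^bsub>C\<^esub> (incl ` (PIdl e))"
        using C.genideal_self[OF sub] cgenideal_self[OF e(1)] by blast
      have gen: "\<phi> a \<in> Idl\<^bsub>C\<^esub> (incl ` (PIdl e))" if a: "a \<in> incl ` (PIdl e)"
        and \<phi>: "\<phi> \<in> ring_hom C C" "\<phi> (incl e) = incl e" for \<phi> a
      proof -
        obtain y where y: "y \<in> carrier R" "a = incl (y \<otimes> e)" using a by (auto simp: cgenideal_def)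
        have "\<phi> a = \<phi> (incl y) \<otimes>\<^bsub>C\<^esub> incl e"
          unfolding y(2) ring_hom_mult[OF incl_hom y(1) e(1)]
          using ring_hom_mult[OF \<phi>(1) incl_closed[OF y(1)] incl_closed[OF e(1)]] \<phi>(2) by simp
        then show ?thesis
          using ideal.I_l_closed[OF C.genideal_ideal[OF sub] self ring_hom_closed[OF \<phi>(1) incl_closed[OF y(1)]]] by simp
      qed
      show "A.completed_map a \<in> Idl\<^bsub>C\<^esub> (incl ` (PIdl e))" if "a \<in> incl ` (PIdl e)" for a
        by (rule gen[OF that A.completed_map_hom A.completed_map_fixed[OF e]])
      show "B.completed_map a \<in> Idl\<^bsub>C\<^esub> (incl ` (PIdl e))" if "a \<in> incl ` (PIdl e)" for a
        by (rule gen[OF that B.completed_map_hom B.completed_map_fixed[OF e(1) \<delta>'0[OF e(2)]]])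
    qed
    show "A.completed_map ` (Idl\<^bsub>C\<^esub> (incl ` H)) = Idl\<^bsub>C\<^esub> (incl ` H)"
      if H: "ideal H R" "\<And>a. a \<in> H \<Longrightarrow> (v \<ominus> u) \<otimes> \<delta> a \<in> H" "(v \<ominus> u) [^] (K::nat) \<in> H" for H K
    proof (rule C.automorphism_generated_ideal[OF A.completed_map_hom B.completed_map_hom _ AB])
      show "incl ` H \<subseteq> carrier C" using ideal.Icarr[OF H(1)] incl_closed by blast
      show "A.completed_map a \<in> Idl\<^bsub>C\<^esub> (incl ` H)" if "a \<in> incl ` H" for a
        using that A.completed_map_stable_ideal[OF H] by blast
      \<comment> \<open>The operator of the inverse is a multiple of the original one, with factor
        \<open>\<ominus> \<omega>\<close>, so the same H is stable under it.\<close>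
      have "(u \<ominus> v) \<otimes> \<delta>' a \<in> H" if a: "a \<in> H" for a
      proof -
        have "(u \<ominus> v) \<otimes> \<delta>' a = (\<ominus> \<omega>) \<otimes> ((v \<ominus> u) \<otimes> \<delta> a)"
          unfolding \<delta>'_def using uv \<omega>(1) A.deriv_closed[OF ideal.Icarr[OF H(1) a]] by algebra
        then show ?thesis using ideal.I_l_closed[OF H(1) H(2)[OF a]] \<omega>(1) by simp
      qed
      moreover have "(u \<ominus> v) [^] K \<in> H"
      proof -
        have "u \<ominus> v = (\<ominus> \<one>) \<otimes> (v \<ominus> u)" using uv by algebra
        then have "(u \<ominus> v) [^] K = (\<ominus> \<one>) [^] K \<otimes> (v \<ominus> u) [^] K"
          using uv nat_pow_distrib[of "\<ominus> \<one>" "v \<ominus> u" K] by simp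
        then show ?thesis using ideal.I_l_closed[OF H(1) H(3)] by simp
      qed
      ultimately show "B.completed_map a \<in> Idl\<^bsub>C\<^esub> (incl ` H)" if "a \<in> incl ` H" for a
        using that B.completed_map_stable_ideal[OF H(1)] by blast
    qed
  qed
qed

end

subsection \<open>The derivation adapted to two tangent directions\<close>

lemma ideal_subset_carrier: "ideal I R \<Longrightarrow> I \<subseteq> carrier R"
  by (rule subsetI) (rule ideal.Icarr)

context pointed_space
begin

text \<open>A germ at x sees a closed set only inside a neighbourhood of x, so the components of a
  divisor that miss x can be discarded.\<close>

lemma vanishing_stalk_mono_near:
  assumes "openin (topol X) W" "x \<in> W" "B \<inter> W \<subseteq> A"
  shows "vanishing_stalk X A x \<subseteq> vanishing_stalk X B x"
proof
  fix a assume "a \<in> vanishing_stalk X A x"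
  then obtain f V where V: "a = germ X x f" "openin (topol X) V" "x \<in> V" "f \<in> reg X V" "\<And>z. z \<in> V \<inter> A \<Longrightarrow> f z = 0"
    by (auto simp: vanishing_stalk_def stalk_def)
  have VW: "openin (topol X) (V \<inter> W)" using V(2) assms(1) by (simp add: openin_Int)
  have "f \<in> reg X (V \<inter> W)" using reg_restrict[OF V(4,2) VW] by simp
  moreover have "\<forall>z\<in>V \<inter> W \<inter> B. f z = 0" using V(5) assms(3) by blast
  ultimately show "a \<in> vanishing_stalk X B x"
    unfolding vanishing_stalk_def stalk_def using VW V(1,3) assms(2)
    by (intro CollectI exI[of _ f] conjI exI[of _ "V \<inter> W"]) auto
qed

lemma vanishing_stalk_empty: "vanishing_stalk X {} x = carrier L"
proof
  show "vanishing_stalk X {} x \<subseteq> carrier L"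
    using germ_closed by (auto simp: vanishing_stalk_def stalk_def F_iff)
  show "carrier L \<subseteq> vanishing_stalk X {} x"
  proof
    fix a assume "a \<in> carrier L"
    then obtain f where "f \<in> F" "a = germ X x f" by (rule local_ring_cases)
    then show "a \<in> vanishing_stalk X {} x" by (auto simp: vanishing_stalk_def stalk_def F_iff)
  qed
qed

text \<open>As the components of \<open>D\<close> are disjoint, at most one of them passes through the point.\<close>

lemma vanishing_stalk_divisor:
  assumes D: "finite D" "\<And>Y. Y \<in> D \<Longrightarrow> closedin (topol X) Y" "pairwise disjnt D" "D \<in> set E"
    and es: "local_equations X E x es"
  shows "\<exists>e\<in>insert \<one>\<^bsub>L\<^esub> (set es). e \<in> carrier L \<and> vanishing_stalk X (\<Union>D) x = PIdl\<^bsub>L\<^esub> e"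
proof (cases "\<exists>Y\<in>D. x \<in> Y")
  case True
  then obtain Y where Y: "Y \<in> D" "x \<in> Y" by blast
  define W where "W = topspace (topol X) - \<Union>(D - {Y})"
  have W: "openin (topol X) W"
    unfolding W_def using D(1,2) by (intro openin_diff openin_topspace closedin_Union) auto
  have xW: "x \<in> W" using D(3) Y point unfolding W_def pairwise_def disjnt_def by blast
  have "vanishing_stalk X (\<Union>D) x = vanishing_stalk X Y x"
    by (rule antisym; rule vanishing_stalk_mono_near[OF W xW]) (use Y W_def in auto)
  moreover obtain Ys where Ys: "set Ys = {Y \<in> divisor_components E. x \<in> Y}" "list_all2 (local_equation X x) Ys es"
    using es by (auto simp: local_equations_def)
  then obtain i where "i < length Ys" "Ys ! i = Y"
    using Y D(4) by (metis (mono_tags, lifting) UnionI divisor_components_def in_set_conv_nth mem_Collect_eq)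
  then have "es ! i \<in> set es" "local_equation X x Y (es ! i)"
    using Ys(2) by (auto simp: list_all2_conv_all_nth)
  ultimately show ?thesis by (auto simp: local_equation_def intro: bexI[of _ "es ! i"])
next
  case False
  define W where "W = topspace (topol X) - \<Union>D"
  have W: "openin (topol X) W"
    unfolding W_def using D(1,2) by (intro openin_diff openin_topspace closedin_Union) auto
  have xW: "x \<in> W" using False point unfolding W_def by blast
  have "vanishing_stalk X (\<Union>D) x = vanishing_stalk X {} x"
    by (rule antisym; rule vanishing_stalk_mono_near[OF W xW]) (use W_def in auto)
  \<comment> \<open>If D misses x, its equation is \<one>, which is killed by every derivation just
    like the equations of E are by the adapted one.\<close>
  then have "vanishing_stalk X (\<Union>D) x = PIdl\<^bsub>L\<^esub> \<one>\<^bsub>L\<^esub>"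
    by (simp add: vanishing_stalk_empty L.cgenideal_eq_genideal L.genideal_one)
  then show ?thesis by blast
qed

lemma stalk_ideal:
  assumes "ideal_sheaf X \<I>" shows "ideal (stalk X \<I> x) L"
proof (rule idealI[OF L.ring_axioms])
  note ax = assms[unfolded ideal_sheaf_def, THEN spec, THEN mp]
  have sheafD: "\<I> W \<subseteq> reg X W" "(\<lambda>_. 0) \<in> \<I> W" if "openin (topol X) W" for W
    using ax[OF that] by simp_all
  have sheaf_add: "(\<lambda>z. f z + g z) \<in> \<I> W" if "openin (topol X) W" "f \<in> \<I> W" "g \<in> \<I> W" for W f g
    using ax[OF that(1), THEN conjunct2, THEN conjunct2, THEN conjunct1] that by blast
  have sheaf_mult: "(\<lambda>z. b z * f z) \<in> \<I> W" if "openin (topol X) W" "b \<in> reg X W" "f \<in> \<I> W" for W f b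
    using ax[OF that(1), THEN conjunct2, THEN conjunct2, THEN conjunct2, THEN conjunct1] that by blast
  have sheaf_restrict: "f \<in> \<I> V" if "openin (topol X) W" "f \<in> \<I> W" "openin (topol X) V" "V \<subseteq> W" for W V f
    using ax[OF that(1), THEN conjunct2, THEN conjunct2, THEN conjunct2, THEN conjunct2, THEN conjunct1] that by blast
  have F: "f \<in> F" if "openin (topol X) W" "x \<in> W" "f \<in> \<I> W" for f W
    using sheafD(1)[OF that(1)] that by (intro F_I[OF that(1,2)]) auto
  have elim: "\<exists>f W. openin (topol X) W \<and> x \<in> W \<and> f \<in> \<I> W \<and> a = germ X x f" if "a \<in> stalk X \<I> x" for a
    using that by (auto simp: stalk_def)
  have intro: "germ X x f \<in> stalk X \<I> x" if "openin (topol X) W" "x \<in> W" "f \<in> \<I> W" for f W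
    using that by (auto simp: stalk_def)
  have sub: "stalk X \<I> x \<subseteq> carrier L" using elim F germ_closed by blast
  have mult: "b \<otimes>\<^bsub>L\<^esub> a \<in> stalk X \<I> x" if "a \<in> stalk X \<I> x" "b \<in> carrier L" for a b
  proof -
    obtain f W where f: "openin (topol X) W" "x \<in> W" "f \<in> \<I> W" "a = germ X x f" using elim[OF \<open>a \<in> _\<close>] by blast
    obtain g where g: "g \<in> F" "b = germ X x g" using \<open>b \<in> _\<close> by (rule local_ring_cases)
    obtain V where V: "openin (topol X) V" "x \<in> V" "g \<in> reg X V" using g(1) by (auto simp: F_iff)
    have VW: "openin (topol X) (V \<inter> W)" using V(1) f(1) by (simp add: openin_Int)
    have "f \<in> \<I> (V \<inter> W)" using sheaf_restrict[OF f(1) f(3) VW] by simp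
    then have "(\<lambda>z. g z * f z) \<in> \<I> (V \<inter> W)"
      using sheaf_mult[OF VW] reg_restrict[OF V(3,1) VW] by simp
    then show ?thesis
      using intro[OF VW] V(2) f(2) germ_mult[OF g(1) F[OF f(1-3)]] f(4) g(2) by simp
  qed
  show "b \<otimes>\<^bsub>L\<^esub> a \<in> stalk X \<I> x" "a \<otimes>\<^bsub>L\<^esub> b \<in> stalk X \<I> x" if "a \<in> stalk X \<I> x" "b \<in> carrier L" for a b
    using mult[OF that] that sub L.m_comm[of a b] by auto
  show "subgroup (stalk X \<I> x) (add_monoid L)"
  proof (rule L.add.subgroupI[OF sub])
    show "stalk X \<I> x \<noteq> {}" using intro[of "topspace (topol X)" "\<lambda>_. 0"] sheafD(2) point by blast
    fix a assume a: "a \<in> stalk X \<I> x"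
    have "\<ominus>\<^bsub>L\<^esub> a = (\<ominus>\<^bsub>L\<^esub> \<one>\<^bsub>L\<^esub>) \<otimes>\<^bsub>L\<^esub> a" using a sub by (simp add: L.l_minus subsetD)
    then show "\<ominus>\<^bsub>L\<^esub> a \<in> stalk X \<I> x" using mult[OF a] by simp
    fix b assume b: "b \<in> stalk X \<I> x"
    obtain f W where f: "openin (topol X) W" "x \<in> W" "f \<in> \<I> W" "a = germ X x f" using elim[OF a] by blast
    obtain g V where g: "openin (topol X) V" "x \<in> V" "g \<in> \<I> V" "b = germ X x g" using elim[OF b] by blast
    have VW: "openin (topol X) (V \<inter> W)" using g(1) f(1) by (simp add: openin_Int)
    have "(\<lambda>z. f z + g z) \<in> \<I> (V \<inter> W)"
      using sheaf_restrict[OF f(1) f(3) VW] sheaf_restrict[OF g(1) g(3) VW] by (intro sheaf_add[OF VW]) simp_all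
    then show "a \<oplus>\<^bsub>L\<^esub> b \<in> stalk X \<I> x"
      using intro[OF VW] f(2) g(2) germ_add[OF F[OF f(1-3)] F[OF g(1-3)]] f(4) g(4) by simp
  qed
qed

lemma derivation_closed: "derivation X x \<delta> \<Longrightarrow> a \<in> carrier L \<Longrightarrow> \<delta> a \<in> carrier L"
  by (auto simp: derivation_def Let_def)

lemma D_ideal_generators:
  "J \<subseteq> carrier L \<Longrightarrow> J \<union> {\<delta> f | \<delta> f. derivation X x \<delta> \<and> f \<in> J} \<subseteq> carrier L"
  using derivation_closed by blast

lemma D_stalk_ideal: "ideal_sheaf X \<I> \<Longrightarrow> ideal (D_stalk X \<I> i x) L"
proof (induction i)
  case 0
  then show ?case by (simp add: D_stalk_def stalk_ideal)
next
  case (Suc i)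
  then have "D_stalk X \<I> i x \<subseteq> carrier L" by (intro ideal_subset_carrier)
  then show ?case
    using L.genideal_ideal[OF D_ideal_generators] by (simp add: D_stalk_def D_ideal_def)
qed

lemma derivation_D_stalk:
  assumes "ideal_sheaf X \<I>" "derivation X x \<delta>" "a \<in> D_stalk X \<I> i x"
  shows "\<delta> a \<in> D_stalk X \<I> (Suc i) x"
proof -
  have "D_stalk X \<I> i x \<subseteq> carrier L" by (intro ideal_subset_carrier D_stalk_ideal assms(1))
  from L.genideal_self[OF D_ideal_generators[OF this]] assms(2,3)
  show ?thesis by (auto simp: D_stalk_def D_ideal_def)
qed

lemma cotangent_spanI:
  assumes "finite A" "f \<in> F" "\<And>i. i \<in> A \<Longrightarrow> g i \<in> F" "\<And>i. i \<in> A \<Longrightarrow> germ X x (g i) \<in> S"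
    and "(\<lambda>z. f z - (\<Sum>i\<in>A. c i * g i z)) \<in> M2"
  shows "germ X x f \<in> cotangent_span L \<mm> (const_germ X x) S"
  using assms
proof (induction A arbitrary: f rule: finite_induct)
  case empty
  then show ?case by (auto simp: M2_def intro: cotangent_span.square)
next
  case (insert i A)
  define f' where "f' = (\<lambda>z. f z - c i * g i z)"
  have gF: "(\<lambda>z. c i * g i z) \<in> F" using insert.prems(2) by (intro F_mult F_const) simp
  have f': "f' \<in> F" unfolding f'_def using insert.prems(1) gF by (rule F_diff)
  have "(\<lambda>z. f' z - (\<Sum>i\<in>A. c i * g i z)) \<in> M2"
    using insert.prems(4) insert.hyps by (simp add: f'_def algebra_simps)
  then have "germ X x f' \<in> cotangent_span L \<mm> (const_germ X x) S"
    using insert.prems by (intro insert.IH f') auto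
  then have "const_germ X x (c i) \<otimes>\<^bsub>L\<^esub> germ X x (g i) \<oplus>\<^bsub>L\<^esub> germ X x f' \<in> cotangent_span L \<mm> (const_germ X x) S"
    using insert.prems(3) by (intro cotangent_span.step) auto
  then show ?case
    using insert.prems(2) gF f' by (simp add: germ_mult F_const germ_add) (simp add: f'_def)
qed

text \<open>Equations of the same component generate the same ideal, so one is a multiple of the
  other; modulo the square of the maximal ideal the factor may be replaced by its value at
  x.\<close>

lemma local_equations_associate:
  assumes "local_equation X x Y e" "local_equation X x Y e'" "e = germ X x f" "e' = germ X x f'"
    "f \<in> F" "f' \<in> F" "f' x = 0"
  shows "\<exists>c. (\<lambda>z. f z - c * f' z) \<in> M2"
proof -
  have "e \<in> PIdl\<^bsub>L\<^esub> e'"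
    using assms(1,2) L.cgenideal_self unfolding local_equation_def by blast
  then obtain b where b: "b \<in> carrier L" "e = b \<otimes>\<^bsub>L\<^esub> e'" by (auto simp: cgenideal_def)
  obtain g where g: "g \<in> F" "b = germ X x g" using b(1) by (rule local_ring_cases)
  have ev: "eventually (\<lambda>z. f z = g z * f' z) near"
    using b(2) assms(3-6) g germ_mult[OF g(1) assms(6)] germ_eq_iff[OF assms(5) F_mult[OF g(1) assms(6)]] by simp
  have "(\<lambda>z. (g z - g x) * f' z) \<in> M2"
    using assms g by (intro M2_prod F_diff F_const) auto
  then have "(\<lambda>z. f z - g x * f' z) \<in> M2"
    by (rule M2_cong) (use ev in eventually_elim, simp add: algebra_simps)
  then show ?thesis by blast
qed

text \<open>The equations of the components of \<open>E\<close> in the two systems of parameters agree up to units, so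
  \<open>v\<close> involves a parameter of the first system that is not an equation of \<open>E\<close>.\<close>

lemma transversal_coefficient:
  assumes es: "local_equations X E x es" and es': "local_equations X E x es'"
    and params: "local_parameters X x (a # es @ ws)" and params': "local_parameters X x (b # es' @ ws')"
    and t: "\<And>i. i < length (a # es @ ws) \<Longrightarrow> t i \<in> F"
      "\<And>i. i < length (a # es @ ws) \<Longrightarrow> (a # es @ ws) ! i = germ X x (t i)"
    and v: "v \<in> F" "b = germ X x v"
    and exp: "(\<lambda>z. v z - (\<Sum>i<length (a # es @ ws). c i * t i z)) \<in> M2"
  shows "\<exists>j<length (a # es @ ws). (j = 0 \<or> length es < j) \<and> c j \<noteq> 0"
proof (rule ccontr)
  assume contra: "\<not> ?thesis"
  define n where "n = length (a # es @ ws)"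
  define n' where "n' = length (b # es' @ ws')"
  obtain t' where t': "\<And>i. i < n' \<Longrightarrow> t' i \<in> F" "\<And>i. i < n' \<Longrightarrow> t' i x = 0"
    "\<And>i. i < n' \<Longrightarrow> (b # es' @ ws') ! i = germ X x (t' i)"
    using local_parameters_functions[OF params'] unfolding n'_def by blast
  obtain Ys where Ys: "set Ys = {Y \<in> divisor_components E. x \<in> Y}" "list_all2 (local_equation X x) Ys es"
    using es by (auto simp: local_equations_def)
  obtain Ys' where Ys': "set Ys' = {Y \<in> divisor_components E. x \<in> Y}" "list_all2 (local_equation X x) Ys' es'"
    using es' by (auto simp: local_equations_def)
  \<comment> \<open>Under the contrary assumption every \<open>t i\<close> with
    \<open>c i \<noteq> 0\<close> is an equation of a component of E. Here s is the place of an
    equation of the same component in the second system, so it is not the place 0 of v.\<close>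
  have "\<exists>s \<rho>. s < n' \<and> (i < n \<and> c i \<noteq> 0 \<longrightarrow> s \<noteq> 0 \<and> (\<lambda>z. t i z - \<rho> * t' s z) \<in> M2)" for i
  proof (cases "i < n \<and> c i \<noteq> 0")
    case False
    then show ?thesis by (intro exI[of _ 0]) (simp add: n'_def)
  next
    case True
    then have i: "0 < i" "i \<le> length es" using contra unfolding n_def by (metis gr0I, metis not_le)
    define q where "q = i - 1"
    have q: "q < length es" "i = Suc q" using i by (auto simp: q_def)
    have len: "length Ys = length es" "length Ys' = length es'" using Ys(2) Ys'(2) by (auto dest: list_all2_lengthD)
    have eq: "local_equation X x (Ys ! q) (es ! q)" using Ys(2) q(1) len by (simp add: list_all2_conv_all_nth)
    have "Ys ! q \<in> set Ys'" using q(1) len Ys(1) Ys'(1) nth_mem by metis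
    then obtain s where s: "s < length es'" "Ys' ! s = Ys ! q" using len by (metis in_set_conv_nth)
    have eq': "local_equation X x (Ys ! q) (es' ! s)" using Ys'(2)[unfolded list_all2_conv_all_nth] s len by metis
    have sn: "Suc s < n'" using s(1) by (simp add: n'_def)
    have "es ! q = germ X x (t i)" "t i \<in> F" using t[of i] True q by (simp_all add: nth_append n_def)
    moreover have "es' ! s = germ X x (t' (Suc s))" using t'(3)[OF sn] s(1) by (simp add: nth_append)
    ultimately have "\<exists>c. (\<lambda>z. t i z - c * t' (Suc s) z) \<in> M2"
      using local_equations_associate[OF eq eq'] t'(1,2)[OF sn] by blast
    then show ?thesis using sn by blast
  qed
  then obtain \<sigma> \<rho> where \<sigma>: "\<And>i. \<sigma> i < n'" "\<And>i. i < n \<Longrightarrow> c i \<noteq> 0 \<Longrightarrow> \<sigma> i \<noteq> 0"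
    "\<And>i. i < n \<Longrightarrow> c i \<noteq> 0 \<Longrightarrow> (\<lambda>z. t i z - \<rho> i * t' (\<sigma> i) z) \<in> M2" by metis
  \<comment> \<open>Substitution into the expansion of v gives this relation between the parameters
    of the second system. Parameter 0 is v itself and keeps the coefficient 1, against
    independence.\<close>
  define C where "C s = (if s = 0 then 1 else 0) - (\<Sum>i<n. if \<sigma> i = s then c i * \<rho> i else 0)" for s
  have "(\<lambda>z. c i * (t i z - \<rho> i * t' (\<sigma> i) z)) \<in> M2" if "i < n" for i
    using \<sigma>(3)[OF that] by (cases "c i = 0") (auto intro: M2_scale M2_zero)
  then have sum: "(\<lambda>z. (v z - (\<Sum>i<n. c i * t i z)) + (\<Sum>i<n. c i * (t i z - \<rho> i * t' (\<sigma> i) z))) \<in> M2"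
    using exp unfolding n_def[symmetric] by (intro M2_add M2_sum) auto
  have "0 < n'" by (simp add: n'_def)
  then have "eventually (\<lambda>z. v z = t' 0 z) near"
    using germ_eq_iff[OF v(1) t'(1)] t'(3)[of 0] v(2) by simp
  then have "eventually (\<lambda>z. (\<Sum>s<n'. C s * t' s z) =
      (v z - (\<Sum>i<n. c i * t i z)) + (\<Sum>i<n. c i * (t i z - \<rho> i * t' (\<sigma> i) z))) near"
  proof eventually_elim
    case (elim z)
    have "(\<Sum>s<n'. (\<Sum>i<n. if \<sigma> i = s then c i * \<rho> i else 0) * t' s z) =
      (\<Sum>i<n. \<Sum>s<n'. (if s = \<sigma> i then c i * \<rho> i * t' s z else 0))"
      unfolding sum_distrib_right by (subst sum.swap) (intro sum.cong refl, auto)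
    also have "\<dots> = (\<Sum>i<n. c i * \<rho> i * t' (\<sigma> i) z)" using \<sigma>(1) by simp
    finally have "(\<Sum>s<n'. C s * t' s z) = t' 0 z - (\<Sum>i<n. c i * \<rho> i * t' (\<sigma> i) z)"
      using \<open>0 < n'\<close> by (simp add: C_def left_diff_distrib sum_subtractf if_distrib[of "\<lambda>y. y * _"] cong: if_cong)
    then show ?case using elim by (simp add: right_diff_distrib sum_subtractf mult.assoc)
  qed
  then have "(\<lambda>z. \<Sum>s<n'. C s * t' s z) \<in> M2" using M2_cong[OF sum] by simp
  then have "C 0 = 0"
    using parameters_independent[OF params', of t'] t' \<open>0 < n'\<close> unfolding n'_def by blast
  moreover have "(\<Sum>i<n. if \<sigma> i = 0 then c i * \<rho> i else 0) = 0"
    using \<sigma>(2) by (intro sum.neutral) force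
  then have "C 0 = 1" by (simp add: C_def)
  ultimately show False by simp
qed

end

lemma smooth_chart_exists:
  fixes X :: "('p, 'k::field_char_0) fun_space"
  assumes "pointed_space X x" "smooth_at X x"
  shows "\<exists>U m Z h r f. smooth_chart X x U m Z h r f"
  using assms(2) unfolding smooth_at_def
proof (elim exE conjE)
  fix U m Z h and r :: nat and f
  assume "x \<in> U" "affine_chart X U m Z h" "\<forall>j<r. f j \<in> polys m"
    "{p \<in> polys m. \<forall>a\<in>Z. p a = 0} = {\<lambda>a. \<Sum>j<r. q j a * f j a | q. \<forall>j<r. q j \<in> polys m}"
    "\<forall>c. (\<forall>i<m. (\<Sum>j<r. c j * partial i (f j) (h x)) = 0) \<longrightarrow> (\<forall>j<r. c j = 0)"
  then have "smooth_chart X x U m Z h r f"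
    using assms(1) by (simp add: smooth_chart_def smooth_chart_axioms_def)
  then show ?thesis by (intro exI)
qed

context smooth_chart
begin

lemma derivation_taylor_data:
  assumes "derivation X x \<delta>" "h' \<in> \<mm>"
  shows "taylor_data \<mm> L (const_germ X x) \<delta> h'"
proof
  show "const_germ X x c \<in> carrier L" for c using germ_closed[OF F_const] .
qed (use assms in \<open>auto simp: derivation_def Let_def germ_add germ_mult F_const germ_one germ_zero\<close>)

text \<open>Evaluated at x, \<delta> is a linear form on the cotangent space that is nonzero at both
  tangent directions. S spans its kernel, so it becomes a generating set when either direction is
  added.\<close>

lemma adapted_derivation:
  assumes es: "local_equations X E x es" and es': "local_equations X E x es'"
    and params: "local_parameters X x (a # es @ ws)" and params': "local_parameters X x (b # es' @ ws')"
  obtains \<delta> \<omega> S where "derivation X x \<delta>" "\<delta> a = \<one>\<^bsub>L\<^esub>" "\<And>e. e \<in> set es \<Longrightarrow> \<delta> e = \<zero>\<^bsub>L\<^esub>"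
    "\<omega> \<in> carrier L" "\<omega> \<otimes>\<^bsub>L\<^esub> \<delta> b = \<one>\<^bsub>L\<^esub>"
    "S \<subseteq> carrier L" "\<And>g. g \<in> S \<Longrightarrow> \<delta> g = \<zero>\<^bsub>L\<^esub>"
    "\<mm> \<subseteq> cotangent_span L \<mm> (const_germ X x) (insert a S)"
    "\<mm> \<subseteq> cotangent_span L \<mm> (const_germ X x) (insert b S)"
proof -
  define ts where "ts = a # es @ ws"
  define n where "n = length ts"
  have params: "local_parameters X x ts" unfolding ts_def by fact
  obtain t where t: "\<And>i. i < n \<Longrightarrow> t i \<in> F" "\<And>i. i < n \<Longrightarrow> t i x = 0" "\<And>i. i < n \<Longrightarrow> ts ! i = germ X x (t i)"
    using local_parameters_functions[OF params] unfolding n_def by blast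
  have n0: "0 < n" by (simp add: n_def ts_def)
  have a: "a = germ X x (t 0)" using t(3)[OF n0] by (simp add: ts_def)
  have "b \<in> \<mm>" using assms(4) by (simp add: local_parameters_def)
  then obtain v where v: "v \<in> F" "v x = 0" "b = germ X x v" by (auto simp: max_ideal_def)
  obtain c where c: "(\<lambda>z. v z - (\<Sum>i<n. c i * t i z)) \<in> M2"
    using parameters_span[OF params, of t v] t v unfolding n_def by blast
  obtain j where j: "j < n" "j = 0 \<or> length es < j" "c j \<noteq> 0"
    using transversal_coefficient[OF es es' assms(3,4), of t v c] t v c unfolding n_def ts_def by auto
  \<comment> \<open>The value at u is 1. If v involves u to first order, all other values are 0; if
    not, parameter j, which occurs in v, gets the value 1 as well. In both cases the positions 1 to
    \<open>length es\<close> of the equations get 0.\<close>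
  define \<beta> where "\<beta> i = (if i = 0 then 1 else 0) + (if i = j \<and> c 0 = 0 then 1 else (0::'k))" for i
  have j0: "c 0 = 0 \<Longrightarrow> j \<noteq> 0" using j(3) by metis
  then have \<beta>0: "\<beta> 0 = 1" by (auto simp: \<beta>_def)
  obtain \<delta> where \<delta>: "derivation X x \<delta>" "\<And>i. i < n \<Longrightarrow> \<delta> (ts ! i) = const_germ X x (\<beta> i)"
    using derivation_with_values[OF params, of \<beta>] unfolding n_def by blast
  interpret T: taylor_data \<mm> L "const_germ X x" \<delta> "\<zero>\<^bsub>L\<^esub>"
    by (rule derivation_taylor_data[OF \<delta>(1)]) (simp add: additive_subgroup.zero_closed ideal.axioms(1) max_ideal_ideal)
  \<comment> \<open>This will be the value of \<delta> v at x, because \<delta> maps the square of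
    the maximal ideal into the maximal ideal.\<close>
  define \<alpha> where "\<alpha> = (\<Sum>i<n. c i * \<beta> i)"
  have "\<alpha> = c 0 + (if c 0 = 0 then c j else 0)"
    using n0 j(1) by (cases "c 0 = 0")
      (simp_all add: \<alpha>_def \<beta>_def distrib_left sum.distrib if_distrib[of "\<lambda>y. _ * y"] cong: if_cong)
  then have \<alpha>: "\<alpha> \<noteq> 0" using j(3) by auto
  have \<delta>_t: "\<delta> (germ X x (t i)) = const_germ X x (\<beta> i)" if "i < n" for i using \<delta>(2)[OF that] t(3)[OF that] by simp
  have ct: "(\<lambda>z. c' * t i z) \<in> F" if "i < n" for i c' using t(1)[OF that] by (intro F_mult F_const)
  have \<delta>_ct: "\<delta> (germ X x (\<lambda>z. c' * t i z)) = const_germ X x (c' * \<beta> i)" if "i < n" for i c'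
    using T.deriv_scale[OF germ_closed[OF t(1)[OF that]], of c'] \<delta>_t[OF that] t(1)[OF that] F_const
    by (simp add: germ_mult)
  have \<delta>_sum: "\<delta> (germ X x (\<lambda>z. \<Sum>i<N. c i * t i z)) = const_germ X x (\<Sum>i<N. c i * \<beta> i)" if "N \<le> n" for N
    using that
  proof (induction N)
    case 0
    then show ?case using T.deriv_const[of 0] by (simp add: germ_zero)
  next
    case (Suc N)
    have s: "(\<lambda>z. \<Sum>i<N. c i * t i z) \<in> F" using ct Suc.prems by (intro F_sum) auto
    have "germ X x (\<lambda>z. \<Sum>i<Suc N. c i * t i z) = germ X x (\<lambda>z. \<Sum>i<N. c i * t i z) \<oplus>\<^bsub>L\<^esub> germ X x (\<lambda>z. c N * t N z)"
      using s ct[of N "c N"] Suc.prems by (simp add: germ_add)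
    then show ?case
      using Suc T.deriv_add[OF germ_closed[OF s] germ_closed[OF ct[of N "c N"]]] \<delta>_ct[of N "c N"]
      by (simp add: germ_add F_const)
  qed
  have sum_F: "(\<lambda>z. \<Sum>i<n. c i * t i z) \<in> F" using ct by (intro F_sum) auto
  obtain d where d: "d \<in> F" "\<delta> b = germ X x d"
    using T.deriv_closed[OF germ_closed[OF v(1)]] v(3) local_ring_cases by metis
  have "germ X x (\<lambda>z. v z - (\<Sum>i<n. c i * t i z)) \<in> ideal_pow L \<mm> (Suc 1)"
    using c by (simp add: M2_def numeral_2_eq_2)
  then have "\<delta> (germ X x (\<lambda>z. v z - (\<Sum>i<n. c i * t i z))) \<in> \<mm>"
    using T.deriv_ideal_pow[of _ 1, unfolded m.ideal_pow_one] by simp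
  also have "germ X x (\<lambda>z. v z - (\<Sum>i<n. c i * t i z)) = b \<ominus>\<^bsub>L\<^esub> germ X x (\<lambda>z. \<Sum>i<n. c i * t i z)"
    using v sum_F by (simp add: germ_diff)
  also have "\<delta> (b \<ominus>\<^bsub>L\<^esub> germ X x (\<lambda>z. \<Sum>i<n. c i * t i z)) = germ X x (\<lambda>z. d z - \<alpha>)"
    using T.deriv_minus[OF germ_closed[OF v(1)] germ_closed[OF sum_F]] \<delta>_sum[of n] d v(3)
    by (simp add: germ_diff F_const \<alpha>_def)
  finally have dx: "d x = \<alpha>" using germ_mem_max_ideal[OF F_diff[OF d(1) F_const]] by simp
  then have inv: "(\<lambda>z. inverse (d z)) \<in> F" "eventually (\<lambda>z. d z \<noteq> 0) near" using F_inverse[OF d(1)] \<alpha> by auto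
  define \<omega> where "\<omega> = germ X x (\<lambda>z. inverse (d z))"
  have "eventually (\<lambda>z. inverse (d z) * d z = 1) near" using inv(2) by eventually_elim simp
  then have \<omega>: "\<omega> \<in> carrier L" "\<omega> \<otimes>\<^bsub>L\<^esub> \<delta> b = \<one>\<^bsub>L\<^esub>"
    unfolding \<omega>_def d(2) germ_one germ_mult[OF inv(1) d(1)] germ_eq_iff[OF F_mult[OF inv(1) d(1)] F_const]
    using germ_closed[OF inv(1)] by simp_all
  \<comment> \<open>Parameter i corrected by a multiple of \<open>t 0\<close> so that \<delta> kills
    it; for i > 0 a change can occur at i = j only.\<close>
  define g where "g i = (\<lambda>z. t i z - \<beta> i * t 0 z)" for i
  define S where "S = (\<lambda>i. germ X x (g i)) ` {1..<n}"
  have gF: "g i \<in> F" if "i < n" for i unfolding g_def using t(1)[OF that] ct[OF n0] by (intro F_diff)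
  have \<delta>_g: "\<delta> (germ X x (g i)) = \<zero>\<^bsub>L\<^esub>" if "i < n" for i
  proof -
    have "germ X x (g i) = germ X x (t i) \<ominus>\<^bsub>L\<^esub> germ X x (\<lambda>z. \<beta> i * t 0 z)"
      unfolding g_def using t(1)[OF that] ct[OF n0] by (simp add: germ_diff)
    then show ?thesis
      using T.deriv_minus[OF germ_closed[OF t(1)[OF that]] germ_closed[OF ct[OF n0]], of "\<beta> i"] \<delta>_t[OF that] \<delta>_ct[OF n0, of "\<beta> i"] \<beta>0
      by (simp add: germ_diff F_const germ_zero)
  qed
  have split: "(\<Sum>i<n. e i * t i z) = (\<Sum>i<n. e i * \<beta> i) * t 0 z + (\<Sum>i\<in>{1..<n}. e i * g i z)" for e z
  proof -
    have "(\<Sum>i\<in>{1..<n}. e i * g i z) = (\<Sum>i<n. e i * g i z)"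
      using \<beta>0 by (intro sum.mono_neutral_left) (auto simp: g_def Suc_le_eq)
    also have "\<dots> = (\<Sum>i<n. e i * t i z) - (\<Sum>i<n. e i * \<beta> i) * t 0 z"
      by (simp add: g_def right_diff_distrib sum_subtractf sum_distrib_right mult.assoc)
    finally show ?thesis by simp
  qed
  have span: "\<mm> \<subseteq> cotangent_span L \<mm> (const_germ X x) (insert (germ X x y) S)"
    if y: "y \<in> F" and exp: "\<And>f. f \<in> F \<Longrightarrow> f x = 0 \<Longrightarrow> \<exists>e c. (\<lambda>z. f z - (c * y z + (\<Sum>i\<in>{1..<n}. e i * g i z))) \<in> M2" for y
  proof
    fix p assume "p \<in> \<mm>"
    then obtain f where f: "f \<in> F" "f x = 0" "p = germ X x f" by (auto simp: max_ideal_def)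
    obtain e c where ec: "(\<lambda>z. f z - (c * y z + (\<Sum>i\<in>{1..<n}. e i * g i z))) \<in> M2" using exp[OF f(1,2)] by blast
    have eq: "(\<Sum>i\<in>{..<n}. (if i = 0 then c else e i) * (if i = 0 then y else g i) z) = c * y z + (\<Sum>i\<in>{1..<n}. e i * g i z)" for z
      using n0 by (simp add: lessThan_atLeast0 sum.atLeast_Suc_lessThan)
    show "p \<in> cotangent_span L \<mm> (const_germ X x) (insert (germ X x y) S)"
      unfolding f(3)
      by (rule cotangent_spanI[of "{..<n}" f "\<lambda>i. if i = 0 then y else g i" _ "\<lambda>i. if i = 0 then c else e i"])
        (use f y gF ec eq in \<open>auto simp: S_def\<close>)
  qed
  show thesis
  proof
    show "derivation X x \<delta>" "\<omega> \<in> carrier L" "\<omega> \<otimes>\<^bsub>L\<^esub> \<delta> b = \<one>\<^bsub>L\<^esub>" by fact+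
    show "\<delta> a = \<one>\<^bsub>L\<^esub>" using \<delta>_t[OF n0] \<beta>0 a by (simp add: germ_one)
    show "\<delta> e = \<zero>\<^bsub>L\<^esub>" if e: "e \<in> set es" for e
    proof -
      obtain i where i: "i < length es" "es ! i = e" using e by (metis in_set_conv_nth)
      then have "Suc i < n" "ts ! Suc i = e" by (simp_all add: n_def ts_def nth_append)
      moreover have "\<beta> (Suc i) = 0" using i j(2) j0 by (auto simp: \<beta>_def)
      ultimately show ?thesis using \<delta>(2)[of "Suc i"] by (simp add: germ_zero)
    qed
    show "S \<subseteq> carrier L" unfolding S_def using gF germ_closed by auto
    show "\<delta> s = \<zero>\<^bsub>L\<^esub>" if "s \<in> S" for s using that \<delta>_g by (auto simp: S_def)
    have expand: "\<exists>e. (\<lambda>z. f z - (\<Sum>i<n. e i * t i z)) \<in> M2" if "f \<in> F" "f x = 0" for f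
      using parameters_span[OF params, of t f] t that unfolding n_def by blast
    show "\<mm> \<subseteq> cotangent_span L \<mm> (const_germ X x) (insert a S)"
      unfolding a
    proof (rule span[OF t(1)[OF n0]])
      fix f assume "f \<in> F" "f x = 0"
      then obtain e where "(\<lambda>z. f z - (\<Sum>i<n. e i * t i z)) \<in> M2" using expand by blast
      then show "\<exists>e c. (\<lambda>z. f z - (c * t 0 z + (\<Sum>i\<in>{1..<n}. e i * g i z))) \<in> M2" unfolding split by blast
    qed
    show "\<mm> \<subseteq> cotangent_span L \<mm> (const_germ X x) (insert b S)"
      unfolding v(3)
    proof (rule span[OF v(1)])
      fix f assume "f \<in> F" "f x = 0"
      then obtain e where e: "(\<lambda>z. f z - (\<Sum>i<n. e i * t i z)) \<in> M2" using expand by blast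
      \<comment> \<open>The coefficient of v is read off by applying \<delta> at x: S contributes
        nothing, v contributes \<alpha>.\<close>
      define q where "q = (\<Sum>i<n. e i * \<beta> i) / \<alpha>"
      have "(\<lambda>z. (f z - (\<Sum>i<n. e i * t i z)) - q * (v z - (\<Sum>i<n. c i * t i z))) \<in> M2"
        by (intro M2_diff M2_scale e c)
      moreover have "(f z - (\<Sum>i<n. e i * t i z)) - q * (v z - (\<Sum>i<n. c i * t i z)) =
          f z - (q * v z + (\<Sum>i\<in>{1..<n}. (e i - q * c i) * g i z))" for z
      proof -
        have "q * (\<Sum>i<n. c i * t i z) = (\<Sum>i<n. e i * \<beta> i) * t 0 z + (\<Sum>i\<in>{1..<n}. q * c i * g i z)"
          unfolding split \<alpha>_def[symmetric] using \<alpha> by (simp add: q_def distrib_left sum_distrib_left mult.assoc)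
        then show ?thesis unfolding split[of e]
          by (simp add: left_diff_distrib sum_subtractf right_diff_distrib)
      qed
      ultimately show "\<exists>e c. (\<lambda>z. f z - (c * v z + (\<Sum>i\<in>{1..<n}. e i * g i z))) \<in> M2" by auto
    qed
  qed
qed

end

theorem lemma2p9p4:
  fixes X :: "('p, 'k::{alg_closed_field, field_char_0}) fun_space"
    and \<I> :: "'p set \<Rightarrow> ('p \<Rightarrow> 'k) set"
    and E :: "'p set set list"
    and \<mu> :: nat
    and x :: 'p
    and U V :: "'p set"
    and u v :: "'p \<Rightarrow> 'k"
  assumes "marked_ideal X \<I> E \<mu>"
    and "maximal_order X \<I> \<mu>"
    and "x \<in> marked_support X \<I> \<mu>"
    and "tangent_direction X \<I> \<mu> x U u" and "transversal X E x u"
    and "tangent_direction X \<I> \<mu> x V v" and "transversal X E x v"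
  shows "\<exists>\<phi>. completed_automorphism X x \<phi> \<and>
    \<phi> ` completed_ideal X x (H_stalk X \<I> \<mu> x) = completed_ideal X x (H_stalk X \<I> \<mu> x) \<and>
    (\<forall>D\<in>set E. \<phi> ` completed_ideal X x (vanishing_stalk X (\<Union>D) x)
                 = completed_ideal X x (vanishing_stalk X (\<Union>D) x)) \<and>
    \<phi> (to_completed X x (germ X x u)) = to_completed X x (germ X x v) \<and>
    zero_locus (completed_ring X x) (completed_ideal X x (T_stalk X \<I> \<mu> x))
      \<subseteq> fixed_points (completed_ring X x) \<phi>"
proof -
  have point: "x \<in> topspace (topol X)" using assms(3) by (simp add: marked_support_def)
  have "smooth_variety X" and I_sheaf: "ideal_sheaf X \<I>"
    and D: "\<And>D. D \<in> set E \<Longrightarrow> finite D \<and> (\<forall>Y\<in>D. prime_divisor X Y) \<and> pairwise disjnt D"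
    using assms(1) by (auto simp: marked_ideal_def coherent_ideal_sheaf_def)
  then have "smooth_at X x" and fun_sheaf: "sheaf_of_functions X"
    using point by (simp_all add: smooth_variety_def variety_def)
  have "pointed_space X x" using fun_sheaf point by (rule pointed_space.intro)
  then obtain W m Z h r f where "smooth_chart X x W m Z h r f"
    using smooth_chart_exists[OF _ \<open>smooth_at X x\<close>] by blast
  then interpret smooth_chart X x W m Z h r f .
  obtain es ws where es: "local_equations X E x es" "local_parameters X x (germ X x u # es @ ws)"
    using assms(5) by (auto simp: transversal_def part_of_local_parameters_def)
  obtain es' ws' where es': "local_equations X E x es'" "local_parameters X x (germ X x v # es' @ ws')"
    using assms(7) by (auto simp: transversal_def part_of_local_parameters_def)
  obtain \<delta> \<omega> S where \<delta>: "derivation X x \<delta>" "\<delta> (germ X x u) = \<one>\<^bsub>L\<^esub>" "\<And>e. e \<in> set es \<Longrightarrow> \<delta> e = \<zero>\<^bsub>L\<^esub>"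
    and \<omega>: "\<omega> \<in> carrier L" "\<omega> \<otimes>\<^bsub>L\<^esub> \<delta> (germ X x v) = \<one>\<^bsub>L\<^esub>"
    and S: "S \<subseteq> carrier L" "\<And>g. g \<in> S \<Longrightarrow> \<delta> g = \<zero>\<^bsub>L\<^esub>"
      "\<mm> \<subseteq> cotangent_span L \<mm> (const_germ X x) (insert (germ X x u) S)"
      "\<mm> \<subseteq> cotangent_span L \<mm> (const_germ X x) (insert (germ X x v) S)"
  proof (rule adapted_derivation[OF es(1) es'(1) es(2) es'(2)])
    fix \<delta> \<omega> S
    assume *: "derivation X x \<delta>" "\<delta> (germ X x u) = \<one>\<^bsub>L\<^esub>" "\<And>e. e \<in> set es \<Longrightarrow> \<delta> e = \<zero>\<^bsub>L\<^esub>"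
      "\<omega> \<in> carrier L" "\<omega> \<otimes>\<^bsub>L\<^esub> \<delta> (germ X x v) = \<one>\<^bsub>L\<^esub>"
      "S \<subseteq> carrier L" "\<And>g. g \<in> S \<Longrightarrow> \<delta> g = \<zero>\<^bsub>L\<^esub>"
      "\<mm> \<subseteq> cotangent_span L \<mm> (const_germ X x) (insert (germ X x u) S)"
      "\<mm> \<subseteq> cotangent_span L \<mm> (const_germ X x) (insert (germ X x v) S)"
    show thesis by (rule that[OF *])
  qed
  have uv: "germ X x u \<in> \<mm>" "germ X x v \<in> \<mm>"
    using es(2) es'(2) by (auto simp: local_parameters_def)
  define k where "k = germ X x v \<ominus>\<^bsub>L\<^esub> germ X x u"
  have k_m: "k \<in> \<mm>" unfolding k_def using m.ideal_pow_minus[of _ 1, unfolded m.ideal_pow_one] uv by blast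
  interpret T: taylor_data \<mm> L "const_germ X x" \<delta> k by (rule derivation_taylor_data[OF \<delta>(1) k_m])
  \<comment> \<open>\<open>Suc N\<close> is \<mu> for positive \<mu> and 1 for \<mu> = 0, where
    truncated subtraction gives N = 0.\<close>
  define N where "N = \<mu> - 1"
  have T_ideal: "ideal (T_stalk X \<I> \<mu> x) L" unfolding T_stalk_def by (rule D_stalk_ideal[OF I_sheaf])
  have "germ X x u \<in> T_stalk X \<I> \<mu> x" "germ X x v \<in> T_stalk X \<I> \<mu> x"
    using assms(4,6) by (auto simp: tangent_direction_def)
  then have k_T: "k \<in> T_stalk X \<I> \<mu> x" unfolding k_def a_minus_def
    using additive_subgroup.a_closed[OF ideal.axioms(1)[OF T_ideal]] additive_subgroup.a_inv_closed[OF ideal.axioms(1)[OF T_ideal]]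
    by blast
  have T_eq: "T_stalk X \<I> \<mu> x = D_stalk X \<I> N x" by (simp add: T_stalk_def N_def)
  have H_eq: "H_stalk X \<I> \<mu> x = Idl\<^bsub>L\<^esub> (\<Union>i\<in>{..N}. ideal_prod L (D_stalk X \<I> i x) (ideal_pow L (D_stalk X \<I> N x) i))"
    unfolding H_stalk_def T_eq by (simp add: N_def)
  have k_D: "k \<in> D_stalk X \<I> N x" using k_T T_eq by simp
  note stable = T.homogenized_stable[of "\<lambda>i. D_stalk X \<I> i x" N, OF D_stalk_ideal[OF I_sheaf] _ k_D, folded H_eq]
  have H: "ideal (H_stalk X \<I> \<mu> x) L" "\<And>a. a \<in> H_stalk X \<I> \<mu> x \<Longrightarrow> k \<otimes>\<^bsub>L\<^esub> \<delta> a \<in> H_stalk X \<I> \<mu> x"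
    "k [^]\<^bsub>L\<^esub> Suc N \<in> H_stalk X \<I> \<mu> x"
    using stable derivation_D_stalk[OF I_sheaf \<delta>(1)] by blast+
  interpret C: cring m.C by (rule m.completion_cring)
  have incl: "to_completed X x = m.incl" by (auto simp: to_completed_def m.incl_def)
  have C_eq: "completed_ring X x = m.C" by (simp add: completed_ring_def)
  obtain \<phi> where \<phi>: "\<phi> \<in> ring_iso m.C m.C" "\<And>c. \<phi> (m.incl (const_germ X x c)) = m.incl (const_germ X x c)"
    "\<phi> (m.incl (germ X x u)) = m.incl (germ X x v)"
    "\<And>s. s \<in> carrier m.C \<Longrightarrow> \<exists>b\<in>carrier m.C. \<phi> s = s \<oplus>\<^bsub>m.C\<^esub> m.incl k \<otimes>\<^bsub>m.C\<^esub> b"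
    "\<And>e. e \<in> carrier L \<Longrightarrow> \<delta> e = \<zero>\<^bsub>L\<^esub> \<Longrightarrow> \<phi> ` (Idl\<^bsub>m.C\<^esub> (m.incl ` (PIdl\<^bsub>L\<^esub> e))) = Idl\<^bsub>m.C\<^esub> (m.incl ` (PIdl\<^bsub>L\<^esub> e))"
    "\<And>H K. ideal H L \<Longrightarrow> (\<And>a. a \<in> H \<Longrightarrow> k \<otimes>\<^bsub>L\<^esub> \<delta> a \<in> H) \<Longrightarrow> k [^]\<^bsub>L\<^esub> (K::nat) \<in> H \<Longrightarrow>
        \<phi> ` (Idl\<^bsub>m.C\<^esub> (m.incl ` H)) = Idl\<^bsub>m.C\<^esub> (m.incl ` H)"
  proof (rule m.taylor_automorphism[OF T.taylor_data_axioms[unfolded k_def] uv(1) \<delta>(2) uv(2) \<omega> S const_germ_residue, folded k_def])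
    fix \<phi>
    assume *: "\<phi> \<in> ring_iso m.C m.C" "\<And>c. \<phi> (m.incl (const_germ X x c)) = m.incl (const_germ X x c)"
    "\<phi> (m.incl (germ X x u)) = m.incl (germ X x v)"
    "\<And>s. s \<in> carrier m.C \<Longrightarrow> \<exists>b\<in>carrier m.C. \<phi> s = s \<oplus>\<^bsub>m.C\<^esub> m.incl k \<otimes>\<^bsub>m.C\<^esub> b"
    "\<And>e. e \<in> carrier L \<Longrightarrow> \<delta> e = \<zero>\<^bsub>L\<^esub> \<Longrightarrow> \<phi> ` (Idl\<^bsub>m.C\<^esub> (m.incl ` (PIdl\<^bsub>L\<^esub> e))) = Idl\<^bsub>m.C\<^esub> (m.incl ` (PIdl\<^bsub>L\<^esub> e))"
    "\<And>H K. ideal H L \<Longrightarrow> (\<And>a. a \<in> H \<Longrightarrow> k \<otimes>\<^bsub>L\<^esub> \<delta> a \<in> H) \<Longrightarrow> k [^]\<^bsub>L\<^esub> (K::nat) \<in> H \<Longrightarrow>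
        \<phi> ` (Idl\<^bsub>m.C\<^esub> (m.incl ` H)) = Idl\<^bsub>m.C\<^esub> (m.incl ` H)"
    show thesis by (rule that[OF *])
  qed
  have "\<phi> ` completed_ideal X x (vanishing_stalk X (\<Union>D) x) = completed_ideal X x (vanishing_stalk X (\<Union>D) x)"
    if DE: "D \<in> set E" for D
  proof -
    obtain e where e: "e \<in> insert \<one>\<^bsub>L\<^esub> (set es)" "e \<in> carrier L" "vanishing_stalk X (\<Union>D) x = PIdl\<^bsub>L\<^esub> e"
      using vanishing_stalk_divisor[OF _ _ _ DE es(1)] D[OF DE] by (auto simp: prime_divisor_def)
    have "\<delta> e = \<zero>\<^bsub>L\<^esub>" using e(1) \<delta>(3) T.deriv_const[of 1] by (auto simp: germ_one)
    then show ?thesis using \<phi>(5)[OF e(2)] e(3) by (simp add: completed_ideal_def incl C_eq)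
  qed
  moreover have "zero_locus (completed_ring X x) (completed_ideal X x (T_stalk X \<I> \<mu> x)) \<subseteq> fixed_points (completed_ring X x) \<phi>"
  proof
    fix P assume "P \<in> zero_locus (completed_ring X x) (completed_ideal X x (T_stalk X \<I> \<mu> x))"
    then have P: "primeideal P m.C" and sub: "completed_ideal X x (T_stalk X \<I> \<mu> x) \<subseteq> P"
      by (auto simp: zero_locus_def C_eq)
    interpret P: ideal P m.C using P by (simp add: primeideal_def)
    have "m.incl ` T_stalk X \<I> \<mu> x \<subseteq> carrier m.C" using ideal_subset_carrier[OF T_ideal] m.incl_closed by blast
    then have "m.incl k \<in> P"
      using C.genideal_self k_T sub unfolding completed_ideal_def incl C_eq by blast
    then have diff: "\<phi> s \<ominus>\<^bsub>m.C\<^esub> s \<in> P \<and> \<phi> s \<in> carrier m.C" if s: "s \<in> carrier m.C" for s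
    proof -
      obtain b where b: "b \<in> carrier m.C" "\<phi> s = s \<oplus>\<^bsub>m.C\<^esub> m.incl k \<otimes>\<^bsub>m.C\<^esub> b" using \<phi>(4)[OF s] by blast
      have kb: "m.incl k \<otimes>\<^bsub>m.C\<^esub> b \<in> P" using P.I_r_closed[OF \<open>m.incl k \<in> P\<close> b(1)] .
      have "\<phi> s \<ominus>\<^bsub>m.C\<^esub> s = m.incl k \<otimes>\<^bsub>m.C\<^esub> b" unfolding b(2) using s P.Icarr[OF kb] by algebra
      then show ?thesis using kb b s P.Icarr[OF kb] by simp
    qed
    \<comment> \<open>Since \<open>\<phi> s\<close> and s differ by an element of P, they lie in P
      together; so P equals its preimage, the first condition for a fixed point, while
      \<open>diff\<close> is the second.\<close>
    have "\<phi> s \<in> P \<longleftrightarrow> s \<in> P" if s: "s \<in> carrier m.C" for s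
    proof
      have c: "\<phi> s \<in> carrier m.C" using diff[OF s] by simp
      assume "s \<in> P"
      then have "(\<phi> s \<ominus>\<^bsub>m.C\<^esub> s) \<oplus>\<^bsub>m.C\<^esub> s \<in> P" using diff[OF s] P.a_closed by blast
      moreover have "(\<phi> s \<ominus>\<^bsub>m.C\<^esub> s) \<oplus>\<^bsub>m.C\<^esub> s = \<phi> s"
        using c s by (simp add: a_minus_def C.a_assoc C.l_neg)
      ultimately show "\<phi> s \<in> P" by simp
    next
      have c: "\<phi> s \<in> carrier m.C" using diff[OF s] by simp
      assume "\<phi> s \<in> P"
      then have "\<phi> s \<oplus>\<^bsub>m.C\<^esub> (\<ominus>\<^bsub>m.C\<^esub> (\<phi> s \<ominus>\<^bsub>m.C\<^esub> s)) \<in> P" using diff[OF s] P.a_closed P.a_inv_closed by blast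
      moreover have "\<phi> s \<oplus>\<^bsub>m.C\<^esub> (\<ominus>\<^bsub>m.C\<^esub> (\<phi> s \<ominus>\<^bsub>m.C\<^esub> s)) = s" using c s by algebra
      ultimately show "s \<in> P" by simp
    qed
    then have "{a \<in> carrier m.C. \<phi> a \<in> P} = P" using P.Icarr by blast
    then show "P \<in> fixed_points (completed_ring X x) \<phi>"
      using P diff by (simp add: fixed_points_def C_eq)
  qed
  moreover have "\<phi> ` completed_ideal X x (H_stalk X \<I> \<mu> x) = completed_ideal X x (H_stalk X \<I> \<mu> x)"
    unfolding completed_ideal_def incl C_eq by (rule \<phi>(6)[OF H])
  moreover have "completed_automorphism X x \<phi>"
    unfolding completed_automorphism_def incl C_eq using \<phi>(1,2) by blast
  ultimately show ?thesis using \<phi>(3) by (intro exI[of _ \<phi>]) (simp add: incl)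
qed

end
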